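(* Let $d\ge 2$, $k>d$, and let $G_{k+1,m}$ be a connected graph that is minimally infinitesimally rigid in $\mathbb R^d$. Let $E$ be a compact subset of $\mathbb R^d$ with Hausdorff dimension $\dim E> d-\frac{1}{k+1}$. Then $$\mathcal L^m\big(\Delta(G_{k+1,m},E^{k+1})\big)>0 .$$
   Context: $\dim$ is Hausdorff dimension and $\mathcal L^m$ is Lebesgue measure on $\mathbb R^m$. $K_{k+1}$ is the complete graph on the vertex set $\{1,\dots,k+1\}$, with edge set ordered lexicographically. $G_{k+1,m}$ denotes a subgraph of $K_{k+1}$ with all $k+1$ vertices and $m$ edges, inheriting the edge order; $ij\in G_{k+1,m}$ means $i<j$ and $\{i,j\}$ is an edge. A $(k+1)$-tuple in $\mathbb R^d$ is $\mathbf x=(x^1,\dots,x^{k+1})\in\mathbb R^{d(k+1)}$ with $x^j\in\mathbb R^d$. For a graph $G$ on these vertices, $f_G(\mathbf x)=(|x^i-x^j|)_{ij\in G}$ and $F_G(\mathbf x)=(|x^i-x^j|^2)_{ij\in G}$, with $|\cdot|$ the Euclidean norm. For $\mathfrak X\subseteq\mathbb R^{d(k+1)}$, $\Delta(G,\mathfrak X)=f_G(\mathfrak X)$. $DF_G(\mathbf x)$ is the total derivative (Jacobian matrix) of $F_G$, whose rows are indexed by the edges of $G$. A set $H$ of edges of $K_{k+1}$ is independent in $\mathbb R^d$ with respect to $\mathbf x_0$ if the rows of $DF_{K_{k+1}}(\mathbf x_0)$ corresponding to $H$ are linearly independent; $H$ is independent in $\mathbb R^d$ if this holds for some $\mathbf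 x_0\in\mathbb R^{d(k+1)}$. For a nonempty independent $H$, $P_H(\mathbf x)$ is the sum of the squares of all $|H|\times|H|$ minors of the submatrix of $DF_{K_{k+1}}(\mathbf x)$ formed by the rows in $H$, and $X_H$ is its zero set. A tuple is generic if it lies outside $X$, where $X$ is the zero set of $P=\prod_{H\text{ independent}}P_H$ (so $X=\bigcup_H X_H$). A framework $(G,\mathbf x)$ is infinitesimally rigid in $\mathbb R^d$ if $\ker DF_G(\mathbf x)=\ker DF_{K_{k+1}}(\mathbf x)$. A graph $G$ is infinitesimally rigid in $\mathbb R^d$ if $(G,\mathbf x)$ is infinitesimally rigid for every generic tuple $\mathbf x$; it is minimally infinitesimally rigid if moreover no proper subgraph on the same vertex set is infinitesimally rigid. *)

theory Defs
  imports "HOL-Analysis.Analysis" "Jordan_Normal_Form.Determinant"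
begin

no_notation Matrix.vec_index (infixl "$" 100)
no_notation Matrix.scalar_prod (infix "\<bullet>" 70)
hide_const (open) Matrix.mat Determinant.det
hide_type (open) Matrix.vec

section \<open>Hausdorff dimension\<close>

text \<open>The gauge \<open>diam(U)^s\<close> with the conventions \<open>diam(U)^0 = 1\<close> for \<open>U \<noteq> {}\<close> and
  \<open>diam({})^s = 0\<close>; note that \<^term>\<open>0 powr 0 = (0::real)\<close> in the library.\<close>

definition diam_pow :: "real \<Rightarrow> 'a::metric_space set \<Rightarrow> ennreal" where
  "diam_pow s U = (if U = {} then 0 else if s = 0 then 1 else ennreal (diameter U powr s))"

text \<open>\<^const>\<open>diameter\<close> is only meaningful on bounded sets, hence the explicit boundedness.\<close>

definition hausdorff_premeasure :: "real \<Rightarrow> real \<Rightarrow> 'a::metric_space set \<Rightarrow> ennreal" where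
  "hausdorff_premeasure s \<delta> A =
     (INF U \<in> {U :: nat \<Rightarrow> 'a set. A \<subseteq> (\<Union>i. U i) \<and> (\<forall>i. bounded (U i) \<and> diameter (U i) \<le> \<delta>)}.
        (\<Sum>i. diam_pow s (U i)))"

definition hausdorff_measure :: "real \<Rightarrow> 'a::metric_space set \<Rightarrow> ennreal" where
  "hausdorff_measure s A = (SUP \<delta> \<in> {0<..}. hausdorff_premeasure s \<delta> A)"

definition hausdorff_dim :: "'a::metric_space set \<Rightarrow> ereal" where
  "hausdorff_dim A = (INF s \<in> {s. 0 \<le> s \<and> hausdorff_measure s A = 0}. ereal s)"

section \<open>Graphs on a finite linearly ordered vertex type\<close>

text \<open>The vertex set \<open>{1, ..., k+1}\<close> is a finite linearly ordered type \<open>'v\<close> with \<open>k+1\<close> elements.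
  An edge \<open>{i, j}\<close> is the pair \<open>(i, j)\<close> with \<open>i < j\<close>; a graph is its edge set, and every graph
  has all of \<open>'v\<close> as its vertices.\<close>

definition complete_edges :: "('v::linorder \<times> 'v) set" where
  "complete_edges = {(i, j). i < j}"

definition graph_connected :: "('v \<times> 'v) set \<Rightarrow> bool" where
  "graph_connected G \<longleftrightarrow> (\<forall>u v. (u, v) \<in> (G \<union> G\<inverse>)\<^sup>*)"

text \<open>The elements of a set of pairs in increasing lexicographic order
  (the product of two sorted lists is sorted lexicographically).\<close>

definition lex_list :: "('a::{finite,linorder} \<times> 'b::{finite,linorder}) set \<Rightarrow> ('a \<times> 'b) list" where
  "lex_list S = filter (\<lambda>p. p \<in> S)
     (List.product (sorted_list_of_set UNIV) (sorted_list_of_set UNIV))"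

section \<open>Distance maps\<close>

text \<open>This is \<^typ>\<open>(real^'d)^'v\<close>; its norm is the Euclidean norm of \<open>\<real>^(d(k+1))\<close>.\<close>

type_synonym ('d, 'v) tuple = "((real, 'd) vec, 'v) vec"

definition edge_dist :: "'v \<times> 'v::finite \<Rightarrow> ('d::finite, 'v) tuple \<Rightarrow> real" where
  "edge_dist e x = norm (x $ fst e - x $ snd e)"

text \<open>\<open>f_G\<close> with values in \<open>\<real>^m\<close> where \<open>m = card G = CARD('m)\<close>: the \<open>n\<close>-th coordinate belongs to
  the \<open>n\<close>-th edge of \<open>G\<close>, the position of a coordinate \<open>a :: 'm\<close> being \<^term>\<open>card {..<a}\<close>
  (counted from zero).\<close>

definition dist_map ::
  "('v::{finite,linorder} \<times> 'v) set \<Rightarrow> ('d::finite, 'v) tuple \<Rightarrow> real^('m::{finite,linorder})" where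
  "dist_map G x = (\<chi> a. edge_dist (lex_list G ! card {..<a}) x)"

definition dist_set ::
  "('v::{finite,linorder} \<times> 'v) set \<Rightarrow> ('d::finite, 'v) tuple set \<Rightarrow> (real^('m::{finite,linorder})) set" where
  "dist_set G X = dist_map G ` X"

section \<open>Rigidity\<close>

text \<open>The row of the Jacobian matrix \<open>DF_G(x)\<close> indexed by the edge \<open>e\<close>; its entries are the partial
  derivatives at \<open>x\<close> of the \<open>e\<close>-coordinate \<open>(edge_dist e)^2\<close> of \<open>F_G\<close>. It is the same for all \<open>G\<close>
  containing \<open>e\<close>, so \<open>DF_G(x)\<close> is the submatrix of \<open>DF(x)\<close> for the complete graph with rows in \<open>G\<close>.\<close>

definition DF_row :: "'v \<times> 'v \<Rightarrow> ('d::finite, 'v) tuple \<Rightarrow> ('d::finite, 'v::finite) tuple" where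
  "DF_row e x = (\<chi> v c. frechet_derivative (\<lambda>y. (edge_dist e y)\<^sup>2) (at x) (axis v (axis c 1)))"

definition DF_kernel :: "('v \<times> 'v) set \<Rightarrow> ('d::finite, 'v) tuple \<Rightarrow> ('d::finite, 'v::finite) tuple set" where
  "DF_kernel G x = {u. \<forall>e\<in>G. DF_row e x \<bullet> u = 0}"

text \<open>Linear independence of the family of rows: equal rows at different edges are dependent.\<close>

definition indep_edges_at :: "('v \<times> 'v) set \<Rightarrow> ('d::finite, 'v::finite) tuple \<Rightarrow> bool" where
  "indep_edges_at H x \<longleftrightarrow>
     (\<forall>a. (\<Sum>e\<in>H. a e *\<^sub>R DF_row e x) = 0 \<longrightarrow> (\<forall>e\<in>H. a e = 0))"

text \<open>The dimension \<open>d\<close> is passed through the type of tuples.\<close>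

definition indep_edges :: "('d::finite, 'v) tuple itself \<Rightarrow> ('v::finite \<times> 'v) set \<Rightarrow> bool" where
  "indep_edges _ H \<longleftrightarrow> (\<exists>x :: ('d, 'v) tuple. indep_edges_at H x)"

text \<open>The minor of the rows \<open>H\<close> of \<open>DF(x)\<close> on a set \<open>C\<close> of columns with \<open>card C = card H\<close>;
  the columns are indexed by pairs of a vertex and a coordinate of \<open>\<real>^d\<close>.\<close>

definition DF_minor ::
  "('v \<times> 'v) set \<Rightarrow> ('v \<times> 'd) set \<Rightarrow> ('d::{finite,linorder}, 'v::{finite,linorder}) tuple \<Rightarrow> real" where
  "DF_minor H C x = Determinant.det (Matrix.mat (card H) (card C)
     (\<lambda>(a, b). DF_row (lex_list H ! a) x $ fst (lex_list C ! b) $ snd (lex_list C ! b)))"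

definition P_edges ::
  "('v \<times> 'v) set \<Rightarrow> ('d::{finite,linorder}, 'v::{finite,linorder}) tuple \<Rightarrow> real" where
  "P_edges H x = (\<Sum>C \<in> {C :: ('v \<times> 'd) set. card C = card H}. (DF_minor H C x)\<^sup>2)"

definition P_total :: "('d::{finite,linorder}, 'v::{finite,linorder}) tuple \<Rightarrow> real" where
  "P_total x =
     (\<Prod>H \<in> {H. H \<subseteq> complete_edges \<and> H \<noteq> {} \<and> indep_edges TYPE(('d, 'v) tuple) H}. P_edges H x)"

definition generic :: "('d::{finite,linorder}, 'v::{finite,linorder}) tuple \<Rightarrow> bool" where
  "generic x \<longleftrightarrow> x \<notin> {y. P_total y = 0}"

definition inf_rigid_framework ::
  "('v \<times> 'v) set \<Rightarrow> ('d::finite, 'v::{finite,linorder}) tuple \<Rightarrow> bool" where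
  "inf_rigid_framework G x \<longleftrightarrow> DF_kernel G x = DF_kernel complete_edges x"

definition inf_rigid ::
  "('d::{finite,linorder}, 'v) tuple itself \<Rightarrow> ('v::{finite,linorder} \<times> 'v) set \<Rightarrow> bool" where
  "inf_rigid _ G \<longleftrightarrow> (\<forall>x :: ('d, 'v) tuple. generic x \<longrightarrow> inf_rigid_framework G x)"

definition min_inf_rigid ::
  "('d::{finite,linorder}, 'v) tuple itself \<Rightarrow> ('v::{finite,linorder} \<times> 'v) set \<Rightarrow> bool" where
  "min_inf_rigid T G \<longleftrightarrow> inf_rigid T G \<and> (\<forall>H. H \<subset> G \<longrightarrow> \<not> inf_rigid T H)"

end

theory Submission
  imports Defs "HOL-Probability.Characteristic_Functions"
begin

text \<open>
  By minimality the edges of \<open>G\<close> are generically independent, so the squared distance map is a submersion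
  off a null set, and preimages of null sets under it are null. It therefore suffices that the set of tuples
  congruent to a tuple of points of \<open>E\<close> has positive measure.

  Let \<open>\<mu>\<close> be a Frostman mass of dimension \<open>s\<close> on \<open>E\<close>, discretised at scale \<open>2^-n\<close>, and average the
  density of the \<open>(k+1)\<close>-fold product of \<open>\<mu>\<close> over the isometries \<open>x \<mapsto> reflect w x + z\<close>. By Cauchy--Schwarz a
  bound for the \<open>L^2\<close> norm of the average that is uniform in \<open>n\<close> suffices, and that norm is controlled by the
  \<open>L^(k+1)\<close> norms of the densities of \<open>b - g a\<close> under \<open>\<mu> \<times> \<mu>\<close>, averaged over products \<open>g\<close> of two
  reflections. At scale \<open>2^-l\<close> these densities are bounded by \<open>2^(l (d - s))\<close>, while the squared \<open>L^2\<close> norm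
  of the part finer than that scale is nearly \<open>2^(-l (1 - 2 (d - s)))\<close>, because the average of \<open>|\<mu>^|^2\<close> over
  reflections of a frequency is controlled by its average over a ball. The sum over the scales converges if
  \<open>(k + 1) (d - s) < 1\<close>. All smoothing is Gaussian, which reduces the Fourier analysis to explicit
  Gaussian integrals of finite sums.
\<close>

section \<open>Gaussian integrals\<close>

text \<open>Congruent tuples have the same edge lengths, so if the distance set were null, all
  tuples congruent to tuples of \<open>E\<close> would lie in the preimage of a null set; hence
  their positive measure is enough. Reflections replace the orthogonal group because they are
  parametrised by vectors: Lebesgue measure on a ball away from the origin serves in place of Haar
  measure. Squaring the average compares two isometries, whence the products of two reflections; one
  factor is frozen and averaging over the other suffices. The averaging gains nearly one power of
  the frequency R, from motion along a single curve, and loses the energy R^(d - s) of a ball.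
  Combining the sup bound with the square bound in the p-th power leaves at scale 2^(-l) about 2^(-l
  (1 - p (d - s))), and the hypothesis on dim E admits an \<open>s\<close> for which this decays
  with p = k + 1. Besides the Gaussians, uniform densities on balls occur where compact support is
  needed to confine the tuples near copies of \<open>E\<close>.\<close>

lemma nn_integral_lborel_translate:
  fixes f :: "'a::euclidean_space \<Rightarrow> ennreal"
  assumes [measurable]: "f \<in> borel_measurable borel"
  shows "(\<integral>\<^sup>+x. f (x + c) \<partial>lborel) = (\<integral>\<^sup>+x. f x \<partial>lborel)"
proof -
  have "(\<integral>\<^sup>+x. f x \<partial>lborel) = (\<integral>\<^sup>+x. f x \<partial>distr lborel borel ((+) c))"
    by (simp add: lborel_distr_plus)
  also have "\<dots> = (\<integral>\<^sup>+x. f (x + c) \<partial>lborel)"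
    by (subst nn_integral_distr) (auto simp: add.commute)
  finally show ?thesis by simp
qed

lemma has_bochner_integral_lborel_translate:
  fixes f :: "'a::euclidean_space \<Rightarrow> 'b::{banach,second_countable_topology}"
  assumes "has_bochner_integral lborel f i"
  shows "has_bochner_integral lborel (\<lambda>x. f (x + c)) i"
proof -
  have "has_bochner_integral (distr lborel borel ((+) c)) f i"
    using assms by (simp add: lborel_distr_plus)
  moreover have "f \<in> borel_measurable borel"
    using assms by (auto simp: has_bochner_integral_iff)
  ultimately show ?thesis
    by (auto simp: has_bochner_integral_iff integrable_distr_eq integral_distr add.commute)
qed

lemma has_bochner_integral_lborel_prod:
  fixes f :: "'a::euclidean_space \<Rightarrow> real \<Rightarrow> complex"
  assumes "\<And>b. b \<in> Basis \<Longrightarrow> has_bochner_integral lborel (f b) (c b)"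
  shows "has_bochner_integral lborel (\<lambda>x::'a. \<Prod>b\<in>Basis. f b (x \<bullet> b)) (\<Prod>b\<in>Basis. c b)"
proof -
  interpret P: product_sigma_finite "\<lambda>_::'a. lborel :: real measure" ..
  have int: "integrable lborel (f b)" "integral\<^sup>L lborel (f b) = c b" if "b \<in> Basis" for b
    using assms[OF that] by (auto simp: has_bochner_integral_iff)
  have [measurable]: "f b \<in> borel_measurable borel" if "b \<in> Basis" for b
    using int(1)[OF that] by auto
  have m1: "(\<lambda>x::'a. \<Prod>b\<in>Basis. f b (x \<bullet> b)) \<in> borel_measurable borel"
    by measurable
  have m2: "(\<lambda>g. \<Sum>b\<in>Basis. g b *\<^sub>R (b::'a)) \<in> measurable (\<Pi>\<^sub>M b\<in>Basis. lborel) borel"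
    by measurable
  have eq: "(\<Prod>b\<in>Basis. f b ((\<Sum>b\<in>Basis. g b *\<^sub>R (b::'a)) \<bullet> b)) = (\<Prod>b\<in>Basis. f b (g b))" for g
    by (intro prod.cong) (auto simp: inner_sum_left inner_Basis if_distrib cong: if_cong)
  have "integrable (\<Pi>\<^sub>M b\<in>(Basis::'a set). lborel) (\<lambda>g. \<Prod>b\<in>Basis. f b (g b))"
    by (intro P.product_integrable_prod int) auto
  moreover have "(LINT g|(\<Pi>\<^sub>M b\<in>(Basis::'a set). lborel). (\<Prod>b\<in>Basis. f b (g b))) = (\<Prod>b\<in>Basis. c b)"
    by (subst P.product_integral_prod) (auto simp: int)
  ultimately show ?thesis
    unfolding has_bochner_integral_iff
    by (subst (1 2) lborel_eq) (simp add: integrable_distr_eq[OF m2 m1] integral_distr[OF m2 m1] eq)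
qed

text \<open>Rescaling by \<open>sqrt t\<close> reduces this to the characteristic function of the
  standard normal distribution, evaluated at the rescaled frequency \<open>u\<close>.\<close>

lemma has_bochner_integral_gauss_cis_real:
  fixes t v :: real
  assumes "t > 0"
  shows "has_bochner_integral lborel (\<lambda>x. cis (x * v) * of_real (exp (- (t * x\<^sup>2 / 2))))
           (of_real (sqrt (2 * pi / t) * exp (- (v\<^sup>2 / (2 * t)))))"
proof -
  define u where "u = v / sqrt t"
  have m: "integrable std_normal_distribution (\<lambda>x. iexp (u * x))"
  proof -
    interpret prob_space std_normal_distribution
      by (rule prob_space_normal_density) simp
    show ?thesis
      using integrable_iexp[of "\<lambda>x. complex_of_real (u * x)"] by simp
  qed
  have "has_bochner_integral std_normal_distribution (\<lambda>x. iexp (u * x)) (of_real (exp (- (u\<^sup>2) / 2)))"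
    using m fun_cong[OF char_std_normal_distribution, of u]
    by (simp add: has_bochner_integral_iff char_def)
  then have "has_bochner_integral lborel (\<lambda>x. std_normal_density x *\<^sub>R iexp (u * x)) (of_real (exp (- (u\<^sup>2)
    / 2)))"
    by (auto simp: has_bochner_integral_iff integrable_density integral_density normal_density_nonneg)
  then have "has_bochner_integral lborel (\<lambda>x. std_normal_density (0 + sqrt t * x) *\<^sub>R iexp (u * (0 + sqrt t
    * x)))
      (of_real (exp (- (u\<^sup>2) / 2)) /\<^sub>R \<bar>sqrt t\<bar>)"
    using assms by (subst (asm) lborel_has_bochner_integral_real_affine_iff[where c="sqrt t" and t=0]) auto
  then have "has_bochner_integral lborel (\<lambda>x. of_real (sqrt (2*pi)) * (std_normal_density (0 + sqrt t * x)
    *\<^sub>R iexp (u * (0 + sqrt t * x))))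
      (of_real (sqrt (2*pi)) * (of_real (exp (- (u\<^sup>2) / 2)) /\<^sub>R \<bar>sqrt t\<bar>))"
    by (intro has_bochner_integral_mult_right)
  also have "(\<lambda>x. of_real (sqrt (2*pi)) * (std_normal_density (0 + sqrt t * x) *\<^sub>R iexp (u * (0 + sqrt t * x))))
     = (\<lambda>x. cis (x * v) * of_real (exp (- (t * x\<^sup>2 / 2))))"
  proof
    fix x :: real
    have "of_real (sqrt (2*pi)) * (std_normal_density (0 + sqrt t * x) *\<^sub>R iexp (u * (0 + sqrt t * x)))
        = complex_of_real (sqrt (2*pi) * std_normal_density (sqrt t * x)) * cis (u * (sqrt t * x))"
      by (simp add: cis_conv_exp scaleR_conv_of_real)
    also have "sqrt (2*pi) * std_normal_density (sqrt t * x) = exp (- (t * x\<^sup>2 / 2))"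
      using assms by (simp add: normal_density_def power_mult_distrib)
    also have "u * (sqrt t * x) = x * v"
      using assms by (simp add: u_def)
    finally show "of_real (sqrt (2*pi)) * (std_normal_density (0 + sqrt t * x) *\<^sub>R iexp (u * (0 + sqrt t * x)))
        = cis (x * v) * of_real (exp (- (t * x\<^sup>2 / 2)))"
      by (simp only: mult.commute)
  qed
  also have "of_real (sqrt (2*pi)) * (of_real (exp (- (u\<^sup>2) / 2)) /\<^sub>R \<bar>sqrt t\<bar>)
     = (of_real (sqrt (2 * pi / t) * exp (- (v\<^sup>2 / (2 * t)))) :: complex)"
  proof -
    have "- (u\<^sup>2) / 2 = - (v\<^sup>2 / (2 * t))"
      using assms by (simp add: u_def power_divide)
    moreover have "sqrt (2 * pi) * (y / \<bar>sqrt t\<bar>) = sqrt (2 * pi / t) * y" for y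
      using assms by (simp add: real_sqrt_divide)
    moreover have "of_real (sqrt (2*pi)) * (of_real y /\<^sub>R \<bar>sqrt t\<bar>) =
        (of_real (sqrt (2 * pi) * (y / \<bar>sqrt t\<bar>)) :: complex)" for y
      by (simp add: scaleR_conv_of_real divide_inverse)
    ultimately show ?thesis by (simp only:)
  qed
  finally show ?thesis .
qed

lemma has_bochner_integral_gauss_cis:
  fixes v :: "'a::euclidean_space"
  assumes "t > 0"
  shows "has_bochner_integral lborel (\<lambda>x. cis (x \<bullet> v) * of_real (exp (- (t * (norm x)\<^sup>2 / 2))))
           (of_real ((2 * pi / t) powr (DIM('a) / 2) * exp (- ((norm v)\<^sup>2 / (2 * t)))))"
proof -
  have nrm: "(norm x)\<^sup>2 = (\<Sum>b\<in>Basis. (x \<bullet> b)\<^sup>2)" for x :: 'a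
  proof -
    have "(norm x)\<^sup>2 = x \<bullet> x" by (rule power2_norm_eq_inner)
    also have "\<dots> = (\<Sum>b\<in>Basis. (x \<bullet> b)\<^sup>2)" by (subst euclidean_inner) (simp add: power2_eq_square)
    finally show ?thesis .
  qed
  have cis_sum: "cis (\<Sum>b\<in>B. h b) = (\<Prod>b\<in>B. cis (h b))" if "finite B" for B :: "'a set" and h
    using that by induction (auto simp: cis_mult[symmetric])
  have "has_bochner_integral lborel
     (\<lambda>x::'a. \<Prod>b\<in>Basis. cis ((x \<bullet> b) * (v \<bullet> b)) * of_real (exp (- (t * (x \<bullet> b)\<^sup>2 / 2))))
     (\<Prod>b\<in>Basis. of_real (sqrt (2 * pi / t) * exp (- ((v \<bullet> b)\<^sup>2 / (2 * t)))))"
    by (intro has_bochner_integral_lborel_prod has_bochner_integral_gauss_cis_real assms)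
  moreover have "(\<Prod>b\<in>Basis. cis ((x \<bullet> b) * (v \<bullet> b)) * of_real (exp (- (t * (x \<bullet> b)\<^sup>2 / 2))))
     = cis (x \<bullet> v) * of_real (exp (- (t * (norm x)\<^sup>2 / 2)))" for x
  proof -
    have "exp (- (t * (norm x)\<^sup>2 / 2)) = exp (\<Sum>b\<in>Basis. - (t * (x \<bullet> b)\<^sup>2 / 2))"
      by (simp add: nrm sum_negf sum_divide_distrib sum_distrib_left)
    then show ?thesis
      by (simp add: prod.distrib euclidean_inner[of x v] cis_sum exp_sum)
  qed
  moreover have "(\<Prod>b\<in>Basis. of_real (sqrt (2 * pi / t) * exp (- ((v \<bullet> b)\<^sup>2 / (2 * t))))) =
     (of_real ((2 * pi / t) powr (DIM('a) / 2) * exp (- ((norm v)\<^sup>2 / (2 * t)))) :: complex)"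
  proof -
    have "sqrt (2 * pi / t) ^ DIM('a) = (2 * pi / t) powr (DIM('a) / 2)"
      using assms by (simp add: powr_half_sqrt[symmetric] powr_powr flip: powr_realpow)
    then show ?thesis
      by (simp add: prod.distrib nrm sum_negf sum_divide_distrib exp_sum del: of_real_mult
        flip: of_real_prod sum_negf exp_sum)
  qed
  ultimately show ?thesis by simp
qed

text \<open>Centred Gaussian density with variance \<open>t\<close> in every coordinate. The
  parameter is the variance, so parameters add under convolution and the scale 2^(-l) corresponds to
  \<open>t = (1/4)^l\<close>.\<close>

definition gauss :: "real \<Rightarrow> 'a::euclidean_space \<Rightarrow> real" where
  "gauss t x = exp (- ((norm x)\<^sup>2 / (2 * t))) / (2 * pi * t) powr (DIM('a) / 2)"

lemma gauss_nonneg [simp]: "0 \<le> gauss t x"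
  by (simp add: gauss_def)

lemma borel_measurable_gauss [measurable]: "gauss t \<in> borel_measurable borel"
  unfolding gauss_def by measurable

lemma has_bochner_integral_gauss_cos:
  fixes v :: "'a::euclidean_space"
  assumes "t > 0"
  shows "has_bochner_integral lborel (\<lambda>x. cos (x \<bullet> v) * exp (- (t * (norm x)\<^sup>2 / 2)))
           ((2 * pi) ^ DIM('a) * gauss t v)"
proof -
  have "has_bochner_integral lborel (\<lambda>x. Re (cis (x \<bullet> v) * of_real (exp (- (t * (norm x)\<^sup>2 / 2)))))
           (Re (of_real ((2 * pi / t) powr (DIM('a) / 2) * exp (- ((norm v)\<^sup>2 / (2 * t))))))"
    by (intro has_bochner_integral_bounded_linear[OF bounded_linear_Re] has_bochner_integral_gauss_cis assms)
  moreover have "(2 * pi / t) powr (DIM('a) / 2) = (2 * pi) ^ DIM('a) / (2 * pi * t) powr (DIM('a) / 2)"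
  proof -
    have "(2 * pi) ^ DIM('a) = ((2*pi) powr (DIM('a) / 2))\<^sup>2"
      by (simp add: power2_eq_square powr_add[symmetric] powr_realpow)
    then show ?thesis
      using assms by (simp add: powr_mult powr_divide power2_eq_square)
  qed
  ultimately show ?thesis
    by (simp add: gauss_def)
qed

text \<open>The phase \<open>c\<close> carries a shift of the frequency variable and, moved by
  \<open>pi/2\<close>, turns cosines into sines, so real integrals suffice for both parts of a
  Fourier transform.\<close>

lemma has_bochner_integral_gauss_cos_phase:
  fixes v :: "'a::euclidean_space"
  assumes "t > 0"
  shows "has_bochner_integral lborel (\<lambda>x. gauss t x * cos (x \<bullet> v + c)) (exp (- (t * (norm v)\<^sup>2 / 2)) * cos c)"
proof -
  define K where "K = (2 * pi * t) powr (DIM('a) / 2)"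
  have K: "K > 0" using assms by (simp add: K_def)
  have eqK: "(2 * pi / (1/t)) powr (DIM('a) / 2) = K" by (simp add: K_def)
  have "has_bochner_integral lborel (\<lambda>x. Re (cis c * of_real (1/K) * (cis (x \<bullet> v) * of_real (exp (- ((1/t) *
    (norm x)\<^sup>2 / 2))))))
           (Re (cis c * of_real (1/K) * of_real ((2 * pi / (1/t)) powr (DIM('a) / 2) * exp (- ((norm v)\<^sup>2 /
             (2 * (1/t)))))))"
    using assms by (intro has_bochner_integral_bounded_linear[OF bounded_linear_Re] has_bochner_integral_mult_right has_bochner_integral_gauss_cis) auto
  moreover have "Re (cis c * of_real (1/K) * (cis (x \<bullet> v) * of_real (exp (- ((1/t) * (norm x)\<^sup>2 / 2))))) =
     gauss t x * cos (x \<bullet> v + c)" for x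
  proof -
    have "cis c * of_real (1/K) * (cis (x \<bullet> v) * of_real (exp (- ((1/t) * (norm x)\<^sup>2 / 2)))) =
       of_real (gauss t x) * cis (x \<bullet> v + c)"
      by (simp add: gauss_def K_def cis_mult[symmetric] mult_ac)
    then show ?thesis by simp
  qed
  moreover have "Re (cis c * of_real (1/K) * of_real ((2 * pi / (1/t)) powr (DIM('a) / 2) * exp (-
    ((norm v)\<^sup>2 / (2 * (1/t))))))
     = exp (- (t * (norm v)\<^sup>2 / 2)) * cos c"
    unfolding eqK using K by (simp add: mult_ac)
  ultimately show ?thesis by simp
qed

lemma has_bochner_integral_gauss:
  assumes "t > 0"
  shows "has_bochner_integral lborel (gauss t :: 'a::euclidean_space \<Rightarrow> real) 1"
  using has_bochner_integral_gauss_cos_phase[OF assms, of "0::'a" 0] by simp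

text \<open>Completing the square: reciprocal variances add, the new centre is the mean of
  \<open>a\<close> and \<open>b\<close> weighted by reciprocal variances, and the leftover is a
  Gaussian in \<open>a - b\<close>.\<close>

lemma gauss_mult:
  fixes a b x :: "'a::euclidean_space"
  assumes t: "t > 0" and u: "u > 0"
  shows "gauss t (x - a) * gauss u (x - b) =
     gauss (t + u) (a - b) * gauss (t * u / (t + u)) (x - ((u / (t + u)) *\<^sub>R a + (t / (t + u)) *\<^sub>R b))"
proof -
  have 1: "(2 * pi * t) powr (DIM('a) / 2) * (2 * pi * u) powr (DIM('a) / 2) =
    (2 * pi * (t + u)) powr (DIM('a) / 2) * (2 * pi * (t * u / (t + u))) powr (DIM('a) / 2)"
  proof -
    have "(2 * pi * t) * (2 * pi * u) = (2 * pi * (t + u)) * (2 * pi * (t * u / (t + u)))"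
      using t u by simp
    then show ?thesis
      by (simp only: powr_mult[symmetric])
  qed
  define s where "s = t + u"
  have s: "s > 0" "s \<noteq> 0" using t u by (auto simp: s_def)
  have inn: "(norm y)\<^sup>2 = y \<bullet> y" for y :: 'a by (rule power2_norm_eq_inner)
  have "(norm (x - ((u/s) *\<^sub>R a + (t/s) *\<^sub>R b)))\<^sup>2 = x\<bullet>x + (u/s)\<^sup>2 * (a\<bullet>a) + (t/s)\<^sup>2 * (b\<bullet>b)
      - 2 * (u/s) * (x\<bullet>a) - 2 * (t/s) * (x\<bullet>b) + 2 * (u/s) * (t/s) * (a\<bullet>b)"
    unfolding inn by (simp add: inner_simps inner_commute algebra_simps power2_eq_square)
  moreover have "(norm (a - b))\<^sup>2 = a\<bullet>a - 2 * (a\<bullet>b) + b\<bullet>b"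
    by (simp add: inn inner_simps inner_commute algebra_simps)
  ultimately have "(norm (a - b))\<^sup>2 / (2 * s) + (norm (x - ((u/s) *\<^sub>R a + (t/s) *\<^sub>R b)))\<^sup>2 / (2 * (t * u / s))
    = (a\<bullet>a - 2 * (a\<bullet>b) + b\<bullet>b) / (2 * s) + (x\<bullet>x + (u/s)\<^sup>2 * (a\<bullet>a) + (t/s)\<^sup>2 * (b\<bullet>b)
      - 2 * (u/s) * (x\<bullet>a) - 2 * (t/s) * (x\<bullet>b) + 2 * (u/s) * (t/s) * (a\<bullet>b)) / (2 * (t * u / s))"
    by (simp only:)
  also have "\<dots> = (x\<bullet>x - 2 * (x\<bullet>a) + a\<bullet>a) / (2 * t) + (x\<bullet>x - 2 * (x\<bullet>b) + b\<bullet>b) / (2 * u)"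
  proof -
    \<comment> \<open>Applied with \<open>\<alpha> = u / s\<close> and
      \<open>\<beta> = t / s\<close>, so that \<open>s * \<beta> = t\<close>,
      \<open>s * \<alpha> = u\<close> and \<open>s * \<alpha> * \<beta> = t * u / s\<close>. After
      clearing denominators it is a polynomial identity in \<open>\<alpha>\<close>.\<close>
    have key: "(A - 2 * C + B) / (2 * s) + (X + \<alpha>\<^sup>2 * A + \<beta>\<^sup>2 * B - 2 * \<alpha> * P - 2 * \<beta> * Q + 2 * \<alpha> * \<beta> * C) /
      (2 * (s * \<alpha> * \<beta>))
       = (X - 2 * P + A) / (2 * (s * \<beta>)) + (X - 2 * Q + B) / (2 * (s * \<alpha>))"
      if "\<alpha> + \<beta> = 1" "\<alpha> > 0" "\<beta> > 0" for A B C X P Q \<alpha> \<beta> :: real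
    proof -
      have \<beta>: "\<beta> = 1 - \<alpha>" using that(1) by simp
      have "(\<alpha> * \<beta>) * (A - 2 * C + B) + (X + \<alpha>\<^sup>2 * A + \<beta>\<^sup>2 * B - 2 * \<alpha> * P - 2 * \<beta> * Q + 2 * \<alpha> * \<beta> * C)
         = \<alpha> * (X - 2 * P + A) + \<beta> * (X - 2 * Q + B)"
        unfolding \<beta> by (simp add: algebra_simps power2_eq_square)
      then have "((\<alpha> * \<beta>) * (A - 2 * C + B) + (X + \<alpha>\<^sup>2 * A + \<beta>\<^sup>2 * B - 2 * \<alpha> * P - 2 * \<beta> * Q + 2 * \<alpha> * \<beta>
        * C)) / (2 * (s * \<alpha> * \<beta>))
         = (\<alpha> * (X - 2 * P + A) + \<beta> * (X - 2 * Q + B)) / (2 * (s * \<alpha> * \<beta>))"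
        by (simp only:)
      then show ?thesis
        using that s by (simp add: add_divide_distrib mult.assoc)
    qed
    have "u / s + t / s = 1" using s by (simp add: s_def add_divide_distrib[symmetric])
    from key[OF this, of "a \<bullet> a" "a \<bullet> b" "b \<bullet> b" "x \<bullet> x" "x \<bullet> a" "x \<bullet> b"] show ?thesis
      using s t u by (simp add: mult.commute)
  qed
  also have "\<dots> = (norm (x - a))\<^sup>2 / (2 * t) + (norm (x - b))\<^sup>2 / (2 * u)"
    by (simp add: inn inner_simps inner_commute algebra_simps)
  finally have 2: "(norm (x - a))\<^sup>2 / (2 * t) + (norm (x - b))\<^sup>2 / (2 * u) =
     (norm (a - b))\<^sup>2 / (2 * s) + (norm (x - ((u/s) *\<^sub>R a + (t/s) *\<^sub>R b)))\<^sup>2 / (2 * (t * u / s))" ..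
  have "exp (- ((norm (x - a))\<^sup>2 / (2 * t))) * exp (- ((norm (x - b))\<^sup>2 / (2 * u))) =
     exp (- ((norm (a - b))\<^sup>2 / (2 * s))) * exp (- ((norm (x - ((u/s) *\<^sub>R a + (t/s) *\<^sub>R b)))\<^sup>2 / (2 * (t * u
       / s))))"
    using 2 by (simp only: exp_add[symmetric] minus_add_distrib[symmetric])
  then show ?thesis
    using 1 unfolding gauss_def s_def by (simp add: times_divide_times_eq)
qed

lemma has_bochner_integral_gauss_mult:
  fixes a b :: "'a::euclidean_space"
  assumes t: "t > 0" and u: "u > 0"
  shows "has_bochner_integral lborel (\<lambda>x. gauss t (x - a) * gauss u (x - b)) (gauss (t + u) (a - b))"
proof -
  have "has_bochner_integral lborel (\<lambda>x. gauss (t * u / (t + u)) (x + (- ((u / (t + u)) *\<^sub>R a + (t / (t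
    + u)) *\<^sub>R b)))) 1"
    using t u by (intro has_bochner_integral_lborel_translate has_bochner_integral_gauss) auto
  from has_bochner_integral_mult_right[OF this, of "gauss (t + u) (a - b)"]
  show ?thesis
    by (subst gauss_mult[OF t u]) (simp add: algebra_simps)
qed

section \<open>Reflections\<close>

text \<open>The reflection in the hyperplane orthogonal to \<open>w\<close>. At \<open>w = 0\<close>
  division by zero makes it the identity, so the isometry laws hold for every \<open>w\<close>
  without a side condition.\<close>

definition reflect :: "'a::real_inner \<Rightarrow> 'a \<Rightarrow> 'a" where
  "reflect w x = x - (2 * (w \<bullet> x) / (w \<bullet> w)) *\<^sub>R w"

lemma reflect_add: "reflect w (x + y) = reflect w x + reflect w y"
  by (simp add: reflect_def inner_simps algebra_simps add_divide_distrib)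

lemma reflect_diff: "reflect w (x - y) = reflect w x - reflect w y"
  by (simp add: reflect_def inner_simps algebra_simps diff_divide_distrib)

lemma reflect_scaleR: "reflect w (c *\<^sub>R x) = c *\<^sub>R reflect w x"
  by (simp add: reflect_def algebra_simps)

lemma inner_reflect: "reflect w x \<bullet> reflect w y = x \<bullet> y"
  by (cases "w = 0") (simp_all add: reflect_def inner_simps inner_commute algebra_simps)

lemma norm_reflect [simp]: "norm (reflect w x) = norm x"
  by (simp add: norm_eq_sqrt_inner inner_reflect)

lemma reflect_reflect [simp]: "reflect w (reflect w x) = x"
  by (cases "w = 0") (simp_all add: reflect_def inner_simps algebra_simps)

lemma inner_reflect_left: "reflect w x \<bullet> y = x \<bullet> reflect w y"
  by (metis inner_reflect reflect_reflect)

lemma borel_measurable_reflect [measurable (raw)]: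
  fixes f g :: "'b \<Rightarrow> 'a::euclidean_space"
  assumes [measurable]: "f \<in> borel_measurable M" "g \<in> borel_measurable M"
  shows "(\<lambda>x. reflect (f x) (g x)) \<in> borel_measurable M"
  unfolding reflect_def by measurable

text \<open>This is the chordal distance under stereographic projection.\<close>

lemma norm_reflect_diff:
  fixes e u :: "'a::real_inner"
  assumes e: "norm e = 1" and ortho: "u \<bullet> e = 0" and u: "u \<noteq> 0"
  shows "norm (reflect (u + \<sigma> *\<^sub>R e) e - reflect (u + \<tau> *\<^sub>R e) e) * (norm (u + \<sigma> *\<^sub>R e) * norm (u + \<tau> *\<^sub>R e)) =
     2 * norm u * \<bar>\<sigma> - \<tau>\<bar>"
proof -
  define q where "q = u \<bullet> u"
  have q: "q > 0" using u by (simp add: q_def)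
  have ee: "e \<bullet> e = 1" using e by (simp add: norm_eq_1)
  have oe: "e \<bullet> u = 0" using ortho by (simp add: inner_commute)
  have ww: "(u + t *\<^sub>R e) \<bullet> (u + t *\<^sub>R e) = q + t\<^sup>2" for t
    by (simp add: inner_simps ee ortho oe q_def power2_eq_square)
  have we: "(u + t *\<^sub>R e) \<bullet> e = t" for t by (simp add: inner_simps ee ortho)
  define a where "a = q + \<sigma>\<^sup>2"
  define b where "b = q + \<tau>\<^sup>2"
  have ab: "a > 0" "b > 0" using q by (auto simp: a_def b_def add_pos_nonneg)
  define x where "x = 2 * \<tau> / b - 2 * \<sigma> / a"
  define y where "y = 2 * \<tau>\<^sup>2 / b - 2 * \<sigma>\<^sup>2 / a"
  have d: "reflect (u + \<sigma> *\<^sub>R e) e - reflect (u + \<tau> *\<^sub>R e) e = x *\<^sub>R u + y *\<^sub>R e"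
    unfolding reflect_def ww we by (simp add: x_def y_def a_def b_def algebra_simps power2_eq_square)
  have xa: "x * (a * b) = 2 * (\<tau> - \<sigma>) * (q - \<sigma> * \<tau>)"
    using ab by (simp add: x_def field_simps) (simp add: a_def b_def algebra_simps power2_eq_square)
  have ya: "y * (a * b) = 2 * q * (\<tau> - \<sigma>) * (\<tau> + \<sigma>)"
    using ab by (simp add: y_def field_simps) (simp add: a_def b_def algebra_simps power2_eq_square)
  have "(norm (x *\<^sub>R u + y *\<^sub>R e))\<^sup>2 * (a * b)\<^sup>2 = q * (x * (a * b))\<^sup>2 + (y * (a * b))\<^sup>2"
    unfolding power2_norm_eq_inner
    by (simp add: inner_simps ee ortho oe algebra_simps power2_eq_square flip: q_def)
  \<comment> \<open>The common factor is \<open>(q - \<sigma> * \<tau>)^2 + q * (\<sigma> +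
    \<tau>)^2 = (q + \<sigma>^2) * (q + \<tau>^2)\<close>, which is \<open>a * b\<close>.\<close>
  also have "\<dots> = 4 * q * (\<tau> - \<sigma>)\<^sup>2 * (a * b)"
    unfolding xa ya by (simp add: a_def b_def algebra_simps power2_eq_square)
  finally have "(norm (x *\<^sub>R u + y *\<^sub>R e))\<^sup>2 * (a * b) = 4 * q * (\<tau> - \<sigma>)\<^sup>2"
    using ab by (simp add: power2_eq_square)
  also have "a * b = (norm (u + \<sigma> *\<^sub>R e) * norm (u + \<tau> *\<^sub>R e))\<^sup>2"
    unfolding power_mult_distrib power2_norm_eq_inner ww by (simp add: a_def b_def)
  also have "4 * q * (\<tau> - \<sigma>)\<^sup>2 = (2 * norm u * \<bar>\<sigma> - \<tau>\<bar>)\<^sup>2"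
    unfolding power_mult_distrib power2_norm_eq_inner q_def by (simp add: power2_commute)
  finally have "(norm (x *\<^sub>R u + y *\<^sub>R e) * (norm (u + \<sigma> *\<^sub>R e) * norm (u + \<tau> *\<^sub>R e)))\<^sup>2 = (2 * norm u
    * \<bar>\<sigma> - \<tau>\<bar>)\<^sup>2"
    by (simp only: power_mult_distrib)
  then show ?thesis
    unfolding d by (rule power2_eq_imp_eq) auto
qed

section \<open>Gaussian averages along curves and over reflections\<close>

lemma nn_integral_exp_minus_square:
  assumes "c > 0"
  shows "(\<integral>\<^sup>+\<tau>. ennreal (exp (- (c\<^sup>2 * (\<tau> - \<sigma>)\<^sup>2 / 32))) \<partial>lborel) = ennreal (sqrt (32 * pi) / c)"
proof -
  have "has_bochner_integral lborel (\<lambda>x. exp (- (c\<^sup>2 / 16 * (norm (x::real))\<^sup>2 / 2))) ((2 * pi) ^ DIM(real)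
    * gauss (c\<^sup>2/16) (0::real))"
    using has_bochner_integral_gauss_cos[of "c\<^sup>2/16" "0::real"] assms by simp
  also have "(2 * pi) ^ DIM(real) * gauss (c\<^sup>2/16) (0::real) = sqrt (32 * pi) / c"
  proof -
    have "2 * pi / sqrt (2 * pi * (c\<^sup>2/16)) = sqrt (32 * pi) / c"
    proof (rule power2_eq_imp_eq)
      show "(2 * pi / sqrt (2 * pi * (c\<^sup>2/16)))\<^sup>2 = (sqrt (32 * pi) / c)\<^sup>2"
        using assms by (simp add: power_divide power_mult_distrib) (simp add: power2_eq_square field_simps)
    qed (use assms in auto)
    then show ?thesis
      using assms by (simp add: gauss_def powr_half_sqrt)
  qed
  finally have "has_bochner_integral lborel (\<lambda>x. exp (- (c\<^sup>2 * x\<^sup>2 / 32))) (sqrt (32 * pi) / c)"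
    by simp
  from has_bochner_integral_lborel_translate[OF this, of "-\<sigma>"]
  have "has_bochner_integral lborel (\<lambda>x. exp (- (c\<^sup>2 * (x - \<sigma>)\<^sup>2 / 32))) (sqrt (32 * pi) / c)"
    by simp
  then show ?thesis
    by (auto simp: has_bochner_integral_iff nn_integral_eq_integral)
qed

text \<open>A curve that spreads at speed at least \<open>c\<close> stays close to
  \<open>\<eta>\<close> only for a time of order 1/c. Comparison with a parameter
  \<open>\<sigma>\<close> whose point is almost nearest to \<open>\<eta>\<close> turns the Gaussian
  of the distance into a Gaussian of \<open>c * (\<tau> - \<sigma>)\<close>.\<close>

lemma nn_integral_gauss_along_spread_curve:
  fixes p :: "real \<Rightarrow> 'a::euclidean_space"
  assumes c: "c > 0" and spread: "\<And>\<sigma> \<tau>. \<sigma> \<in> T \<Longrightarrow> \<tau> \<in> T \<Longrightarrow> c * \<bar>\<sigma> - \<tau>\<bar> \<le> norm (p \<sigma> - p \<tau>)"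
  shows "(\<integral>\<^sup>+\<tau>. indicator T \<tau> * ennreal (exp (- (norm (p \<tau> - \<eta>))\<^sup>2 / 4)) \<partial>lborel) \<le> ennreal (12 / c)"
proof (cases "T = {}")
  case True
  then show ?thesis by simp
next
  case False
  define i where "i = (INF \<tau>\<in>T. norm (p \<tau> - \<eta>))"
  have bdd: "bdd_below ((\<lambda>\<tau>. norm (p \<tau> - \<eta>)) ` T)" by (rule bdd_belowI2[of _ 0]) simp
  obtain \<sigma> where \<sigma>: "\<sigma> \<in> T" "norm (p \<sigma> - \<eta>) < i + 1"
    using cINF_less_iff[OF False bdd, of "i + 1"] by (auto simp: i_def)
  have "indicator T \<tau> * ennreal (exp (- (norm (p \<tau> - \<eta>))\<^sup>2 / 4)) \<le>
      ennreal (exp (1/16)) * ennreal (exp (- (c\<^sup>2 * (\<tau> - \<sigma>)\<^sup>2 / 32)))" for \<tau>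
  proof (cases "\<tau> \<in> T")
    case True
    have "i \<le> norm (p \<tau> - \<eta>)" unfolding i_def by (rule cINF_lower[OF bdd True])
    moreover have "norm (p \<tau> - p \<sigma>) \<le> norm (p \<tau> - \<eta>) + norm (p \<sigma> - \<eta>)"
      by (metis norm_triangle_ineq4 diff_diff_eq2 diff_add_cancel)
    ultimately have "c * \<bar>\<tau> - \<sigma>\<bar> \<le> 2 * norm (p \<tau> - \<eta>) + 1"
      using \<sigma> spread[OF True \<sigma>(1)] by linarith
    then have "(c * \<bar>\<tau> - \<sigma>\<bar>)\<^sup>2 \<le> (2 * norm (p \<tau> - \<eta>) + 1)\<^sup>2"
      using c by (intro power_mono) auto
    also have "\<dots> \<le> 8 * (norm (p \<tau> - \<eta>))\<^sup>2 + 2"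
      using sum_squares_ge_zero[of "2 * norm (p \<tau> - \<eta>) - 1" 0] by (simp add: power2_eq_square algebra_simps)
    finally have "- (norm (p \<tau> - \<eta>))\<^sup>2 / 4 \<le> 1/16 + - (c\<^sup>2 * (\<tau> - \<sigma>)\<^sup>2 / 32)"
      by (simp add: power_mult_distrib)
    then have "exp (- (norm (p \<tau> - \<eta>))\<^sup>2 / 4) \<le> exp (1/16 + - (c\<^sup>2 * (\<tau> - \<sigma>)\<^sup>2 / 32))" by simp
    also have "\<dots> = exp (1/16) * exp (- (c\<^sup>2 * (\<tau> - \<sigma>)\<^sup>2 / 32))" by (simp only: exp_add)
    finally show ?thesis
      using True by (simp add: ennreal_leI flip: ennreal_mult)
  qed simp
  then have "(\<integral>\<^sup>+\<tau>. indicator T \<tau> * ennreal (exp (- (norm (p \<tau> - \<eta>))\<^sup>2 / 4)) \<partial>lborel) \<le>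
     (\<integral>\<^sup>+\<tau>. ennreal (exp (1/16)) * ennreal (exp (- (c\<^sup>2 * (\<tau> - \<sigma>)\<^sup>2 / 32))) \<partial>lborel)"
    by (rule nn_integral_mono)
  also have "\<dots> = ennreal (exp (1/16)) * ennreal (sqrt (32 * pi) / c)"
    by (subst nn_integral_cmult) (auto simp: nn_integral_exp_minus_square[OF c])
  \<comment> \<open>The constant 12 comes from \<open>exp (1/16) \<le> 11/10\<close> and
    \<open>sqrt (32 * pi) \<le> 102/10\<close>.\<close>
  also have "\<dots> \<le> ennreal (12 / c)"
  proof -
    have "exp (1/16::real) \<le> 1 + 1/16 + (1/16)\<^sup>2" by (rule exp_bound) auto
    then have "exp (1/16::real) \<le> 11/10" by (simp add: power2_eq_square)
    moreover have "sqrt (32 * pi) \<le> 102/10"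
      using pi_approx by (intro real_le_lsqrt) (auto simp: power2_eq_square)
    ultimately have "exp (1/16) * sqrt (32 * pi) \<le> 11/10 * (102/10)" by (intro mult_mono) auto
    then have "exp (1/16) * sqrt (32 * pi) / c \<le> 12 / c" using c by (intro divide_right_mono) auto
    then show ?thesis using c by (simp flip: ennreal_mult)
  qed
  finally show ?thesis .
qed

text \<open>By translation invariance an integral over \<open>w\<close> can be averaged along a unit
  segment in any direction, so one-dimensional estimates apply without coordinates adapted to that
  direction.\<close>

lemma nn_integral_average_translates:
  fixes f :: "'a::euclidean_space \<Rightarrow> ennreal"
  assumes [measurable]: "f \<in> borel_measurable borel"
  shows "(\<integral>\<^sup>+w. f w \<partial>lborel) = (\<integral>\<^sup>+w. (\<integral>\<^sup>+\<tau>. indicator {0..1} \<tau> * f (w + \<tau> *\<^sub>R e) \<partial>lborel) \<partial>lborel)"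
proof -
  have "(\<integral>\<^sup>+w. (\<integral>\<^sup>+\<tau>. indicator {0..1} \<tau> * f (w + \<tau> *\<^sub>R e) \<partial>lborel) \<partial>lborel) =
     (\<integral>\<^sup>+\<tau>. (\<integral>\<^sup>+w. indicator {0..1} \<tau> * f (w + \<tau> *\<^sub>R e) \<partial>lborel) \<partial>(lborel :: real measure))"
    by (rule lborel_pair.Fubini'[symmetric]) measurable
  also have "\<dots> = (\<integral>\<^sup>+\<tau>. indicator {0..1} \<tau> * (\<integral>\<^sup>+w. f w \<partial>lborel) \<partial>(lborel :: real measure))"
    by (subst nn_integral_cmult) (auto simp: nn_integral_lborel_translate)
  also have "\<dots> = (\<integral>\<^sup>+w. f w \<partial>lborel)"
    by (subst nn_integral_multc) auto
  finally show ?thesis by simp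
qed

lemma nn_integral_inverse_shift:
  fixes a :: real
  assumes "a > 0"
  shows "(\<integral>\<^sup>+y. ennreal (2 * a / (a + \<bar>y\<bar>)) * indicator {-4..4} y \<partial>lborel) \<le> ennreal (4 * a * ln ((a + 4) / a))"
proof -
  define h where "h y = 2 * a / (a + \<bar>y\<bar>)" for y :: real
  have [measurable]: "h \<in> borel_measurable borel" unfolding h_def by measurable
  have "(\<integral>\<^sup>+y. ennreal (h y) * indicator {0..4} y \<partial>lborel) = ennreal (2 * a * ln (a + 4) - 2 * a * ln (a + 0))"
    using assms
    by (intro nn_integral_FTC_Icc[where F="\<lambda>y. 2 * a * ln (a + y)"])
       (auto simp: h_def field_simps has_real_derivative_iff_has_vector_derivative[symmetric] intro!: derivative_eq_intros)
  then have 1: "(\<integral>\<^sup>+y. ennreal (h y) * indicator {0..4} y \<partial>lborel) = ennreal (2 * a * ln ((a + 4) / a))"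
    using assms by (simp add: ln_div right_diff_distrib)
  have 2: "(\<integral>\<^sup>+y. ennreal (h y) * indicator {0..4} y \<partial>lborel) = (\<integral>\<^sup>+y. ennreal (h y) * indicator {-4..0} y
    \<partial>lborel)"
    by (subst nn_integral_real_affine[where c="-1" and t=0])
       (auto simp: h_def intro!: nn_integral_cong split: split_indicator)
  have "(\<integral>\<^sup>+y. ennreal (h y) * indicator {-4..4} y \<partial>lborel) \<le>
     (\<integral>\<^sup>+y. ennreal (h y) * indicator {0..4} y + ennreal (h y) * indicator {-4..0} y \<partial>lborel)"
    by (intro nn_integral_mono) (auto split: split_indicator)
  also have "\<dots> = (\<integral>\<^sup>+y. ennreal (h y) * indicator {0..4} y \<partial>lborel) + (\<integral>\<^sup>+y. ennreal (h y)
    * indicator {-4..0} y \<partial>lborel)"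
    by (intro nn_integral_add) auto
  also have "\<dots> = ennreal (2 * a * ln ((a + 4) / a)) + ennreal (2 * a * ln ((a + 4) / a))"
    using 1 2 by simp
  also have "\<dots> = ennreal (4 * a * ln ((a + 4) / a))"
    using assms by (subst ennreal_plus[symmetric]) auto
  finally show ?thesis by (simp add: h_def)
qed

text \<open>Motion of \<open>w\<close> along \<open>e\<close> leaves its orthogonal part
  \<open>u\<close> unchanged, and by the chordal distance formula the reflected points spread at
  speed of order \<open>R * norm u\<close>. The resulting bound \<open>a / norm u\<close> is merged
  with the trivial bound 1 and weakened through
  \<open>\<bar>w \<bullet> f\<bar> \<le> norm u\<close>, so that only one coordinate of
  \<open>w\<close> orthogonal to \<open>e\<close> remains.\<close>

lemma nn_integral_reflect_line:
  fixes c0 e w \<eta> :: "'a::euclidean_space"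
  assumes c0: "norm c0 = 2" and e: "norm e = 1" and f: "norm f = 1" "f \<bullet> e = 0" and R: "R > 0"
  shows "(\<integral>\<^sup>+\<tau>. indicator {0..1} \<tau> * (indicator (cball c0 1) (w + \<tau> *\<^sub>R e) *
            ennreal (exp (- (norm (reflect (w + \<tau> *\<^sub>R e) (R *\<^sub>R e) - \<eta>))\<^sup>2 / 4))) \<partial>lborel)
     \<le> indicator (cball c0 2) w * ennreal (2 * (54 / R) / (54 / R + \<bar>w \<bullet> f\<bar>))"
proof -
  define s where "s = w \<bullet> e"
  define u where "u = w - s *\<^sub>R e"
  have w: "w + \<tau> *\<^sub>R e = u + (s + \<tau>) *\<^sub>R e" for \<tau> by (simp add: u_def algebra_simps)
  have ue: "u \<bullet> e = 0" using e by (simp add: u_def s_def inner_simps norm_eq_1)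
  have "\<bar>w \<bullet> f\<bar> = \<bar>u \<bullet> f\<bar>" using f(2) by (simp add: u_def inner_simps inner_commute)
  also have "\<dots> \<le> norm u * norm f" by (rule Cauchy_Schwarz_ineq2)
  finally have wf: "\<bar>w \<bullet> f\<bar> \<le> norm u" using f by simp
  \<comment> \<open>54 = 12 * 9 / 2: the 12 is the constant of the curve bound, 9 = 3 * 3 bounds the
    norms of two vectors within distance 1 of \<open>c0\<close>, and the 2 stems from the chordal
    distance.\<close>
  define a where "a = 54 / R"
  have a: "a > 0" using R by (simp add: a_def)
  define p where "p \<tau> = reflect (w + \<tau> *\<^sub>R e) (R *\<^sub>R e)" for \<tau>
  define T where "T = {\<tau> \<in> {0..1}. w + \<tau> *\<^sub>R e \<in> cball c0 1}"
  let ?I = "\<integral>\<^sup>+\<tau>. indicator T \<tau> * ennreal (exp (- (norm (p \<tau> - \<eta>))\<^sup>2 / 4)) \<partial>lborel"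
  have "?I \<le> (\<integral>\<^sup>+\<tau>. indicator {0..1::real} \<tau> \<partial>lborel)"
    by (intro nn_integral_mono) (auto simp: T_def split: split_indicator)
  then have I1: "?I \<le> 1" by simp
  have I2: "?I \<le> ennreal (a / norm u)" if "u \<noteq> 0"
  proof -
    have "?I \<le> ennreal (12 / (2 * R * norm u / 9))"
    proof (rule nn_integral_gauss_along_spread_curve)
      show "0 < 2 * R * norm u / 9" using R that by simp
      fix \<sigma> \<tau> assume "\<sigma> \<in> T" "\<tau> \<in> T"
      then have n: "norm (w + \<sigma> *\<^sub>R e) \<le> 3" "norm (w + \<tau> *\<^sub>R e) \<le> 3"
        using c0 norm_triangle_ineq2[of "w + \<sigma> *\<^sub>R e" c0] norm_triangle_ineq2[of "w + \<tau> *\<^sub>R e" c0]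
        by (auto simp: T_def dist_norm norm_minus_commute)
      have "2 * norm u * \<bar>\<sigma> - \<tau>\<bar> =
         norm (reflect (w + \<sigma> *\<^sub>R e) e - reflect (w + \<tau> *\<^sub>R e) e) * (norm (w + \<sigma> *\<^sub>R e) * norm (w + \<tau> *\<^sub>R e))"
        unfolding w using norm_reflect_diff[OF e ue that, of "s + \<sigma>" "s + \<tau>"] by simp
      also have "\<dots> \<le> norm (reflect (w + \<sigma> *\<^sub>R e) e - reflect (w + \<tau> *\<^sub>R e) e) * (3 * 3)"
        using n by (intro mult_left_mono mult_mono) auto
      finally have "R * (2 * norm u * \<bar>\<sigma> - \<tau>\<bar>) \<le> R * (norm (reflect (w + \<sigma> *\<^sub>R e) e - reflect (w + \<tau>
        *\<^sub>R e) e) * (3 * 3))"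
        using R by (intro mult_left_mono) auto
      moreover have "norm (p \<sigma> - p \<tau>) = R * norm (reflect (w + \<sigma> *\<^sub>R e) e - reflect (w + \<tau> *\<^sub>R e) e)"
        using R by (simp add: p_def reflect_scaleR flip: scaleR_diff_right)
      ultimately show "2 * R * norm u / 9 * \<bar>\<sigma> - \<tau>\<bar> \<le> norm (p \<sigma> - p \<tau>)"
        by (simp add: mult_ac)
    qed
    also have "12 / (2 * R * norm u / 9) = a / norm u" using R that by (simp add: a_def)
    finally show ?thesis .
  qed
  have I: "?I \<le> indicator (cball c0 2) w * ennreal (2 * a / (a + \<bar>w \<bullet> f\<bar>))"
  proof (cases "w \<in> cball c0 2")
    case False
    have "T = {}"
    proof (rule ccontr)
      assume "T \<noteq> {}"
      then obtain \<tau> where "\<tau> \<in> T" by blast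
      then have "dist c0 (w + \<tau> *\<^sub>R e) \<le> 1" "dist (w + \<tau> *\<^sub>R e) w \<le> 1"
        using e by (auto simp: T_def dist_norm)
      then show False using False dist_triangle[of c0 w "w + \<tau> *\<^sub>R e"] by simp
    qed
    then show ?thesis by simp
  next
    case True
    have "?I \<le> ennreal (2 * a / (a + norm u))"
    proof (cases "norm u \<le> a")
      case True
      then have "1 \<le> 2 * a / (a + norm u)" using a by (simp add: add_pos_nonneg)
      then have "1 \<le> ennreal (2 * a / (a + norm u))"
        by (metis ennreal_1 ennreal_leI)
      from order_trans[OF I1 this] show ?thesis .
    next
      case False
      then have u: "norm u > a" "norm u > 0" using a by auto
      then have "a / norm u \<le> 2 * a / (a + norm u)"
        using a by (simp add: divide_simps)
      from order_trans[OF I2 ennreal_leI[OF this]] u show ?thesis by auto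
    qed
    also have "\<dots> \<le> ennreal (2 * a / (a + \<bar>w \<bullet> f\<bar>))"
      using wf a by (intro ennreal_leI divide_left_mono) (auto simp: add_pos_nonneg)
    finally show ?thesis using True by simp
  qed
  have "(\<integral>\<^sup>+\<tau>. indicator {0..1} \<tau> * (indicator (cball c0 1) (w + \<tau> *\<^sub>R e) *
            ennreal (exp (- (norm (reflect (w + \<tau> *\<^sub>R e) (R *\<^sub>R e) - \<eta>))\<^sup>2 / 4))) \<partial>lborel) = ?I"
    by (intro nn_integral_cong) (auto simp: T_def p_def split: split_indicator)
  then show ?thesis using I by (simp add: a_def)
qed

text \<open>When \<open>w\<close> moves in the direction of \<open>\<zeta>\<close>, the point \<open>reflect w \<zeta>\<close> runs through a circle at speed
  comparable to \<open>norm \<zeta>\<close> times the distance of \<open>w\<close> to the line through \<open>\<zeta>\<close>. A second average in a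
  direction orthogonal to \<open>\<zeta>\<close> handles small distances at the cost of a logarithm, which \<open>\<kappa>\<close> absorbs.\<close>

lemma nn_integral_reflect_gauss:
  fixes c0 :: "'a::euclidean_space"
  assumes dim: "DIM('a) \<ge> 2" and c0: "norm c0 = 2" and \<kappa>: "\<kappa> > 0"
  obtains C where "C > 0" "\<And>\<zeta> \<eta>. norm \<zeta> \<ge> 1 \<Longrightarrow>
    (\<integral>\<^sup>+w. indicator (cball c0 1) w * ennreal (exp (- (norm (reflect w \<zeta> - \<eta>))\<^sup>2 / 4)) \<partial>lborel)
      \<le> ennreal (C * norm \<zeta> powr (\<kappa> - 1))"
proof -
  define V where "V = measure lborel (cball c0 3)"
  have "emeasure lborel (cball c0 3) < \<infinity>"
    by (rule emeasure_bounded_finite) simp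
  then have V: "emeasure lborel (cball c0 3) = ennreal V" "V > 0"
    by (auto simp: V_def content_cball_pos intro!: emeasure_eq_ennreal_measure)
  define C where "C = V * (4 * 54 powr (1 - \<kappa>) * 58 powr \<kappa> / \<kappa>)"
  have "C > 0" using V \<kappa> by (simp add: C_def)
  moreover have "(\<integral>\<^sup>+w. indicator (cball c0 1) w * ennreal (exp (- (norm (reflect w \<zeta> - \<eta>))\<^sup>2 / 4)) \<partial>lborel)
      \<le> ennreal (C * norm \<zeta> powr (\<kappa> - 1))" if \<zeta>: "norm \<zeta> \<ge> 1" for \<zeta> \<eta> :: 'a
  proof -
    define R where "R = norm \<zeta>"
    have R: "R \<ge> 1" "R > 0" using \<zeta> by (auto simp: R_def)
    define e where "e = \<zeta> /\<^sub>R R"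
    have e: "norm e = 1" "\<zeta> = R *\<^sub>R e" using R by (auto simp: e_def R_def)
    \<comment> \<open>A direction orthogonal to \<open>e\<close> exists because the dimension is at
      least 2; on a line, reflections only change signs and give no averaging.\<close>
    obtain f0 where f0: "f0 \<noteq> 0" "e \<bullet> f0 = 0"
      using orthogonal_to_vector_exists[OF dim, of e] by (auto simp: Linear_Algebra.orthogonal_def)
    define f where "f = f0 /\<^sub>R norm f0"
    have f: "norm f = 1" "f \<bullet> e = 0"
      using f0 by (auto simp: f_def inner_commute)
    then have ff: "f \<bullet> f = 1" by (simp add: norm_eq_1)
    define a where "a = 54 / R"
    have a: "a > 0" "a \<le> 54" using R by (auto simp: a_def field_simps)
    define h where "h y = 2 * a / (a + \<bar>y\<bar>)" for y :: real
    have [measurable]: "h \<in> borel_measurable borel" unfolding h_def by measurable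
    let ?H = "\<integral>\<^sup>+y. ennreal (h y) * indicator {-4..4} y \<partial>lborel"
    have [measurable]: "cball c0 r \<in> sets borel" for r by simp
    have "(\<integral>\<^sup>+w. indicator (cball c0 1) w * ennreal (exp (- (norm (reflect w \<zeta> - \<eta>))\<^sup>2 / 4)) \<partial>lborel)
      = (\<integral>\<^sup>+w. (\<integral>\<^sup>+\<tau>. indicator {0..1} \<tau> * (indicator (cball c0 1) (w + \<tau> *\<^sub>R e) *
            ennreal (exp (- (norm (reflect (w + \<tau> *\<^sub>R e) \<zeta> - \<eta>))\<^sup>2 / 4))) \<partial>lborel) \<partial>lborel)"
      by (rule nn_integral_average_translates) measurable
    also have "\<dots> \<le> (\<integral>\<^sup>+w. indicator (cball c0 2) w * ennreal (h (w \<bullet> f)) \<partial>lborel)"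
      unfolding e(2) h_def a_def by (intro nn_integral_mono nn_integral_reflect_line c0 e f R)
    also have "\<dots> = (\<integral>\<^sup>+w. (\<integral>\<^sup>+\<tau>. indicator {0..1} \<tau> * (indicator (cball c0 2) (w + \<tau> *\<^sub>R f) *
            ennreal (h ((w + \<tau> *\<^sub>R f) \<bullet> f))) \<partial>lborel) \<partial>lborel)"
      by (rule nn_integral_average_translates) measurable
    \<comment> \<open>Shifts along \<open>f\<close> by at most 1 enlarge the ball of radius 2 to
      radius 3, and points of the former have norm at most 4, so their \<open>f\<close>-coordinate
      stays in [-4, 4]. The inner integral then depends on \<open>w\<close> only through the
      indicator.\<close>
    also have "\<dots> \<le> (\<integral>\<^sup>+w. (\<integral>\<^sup>+\<tau>. indicator (cball c0 3) w * (ennreal (h (w \<bullet> f + 1 * \<tau>)) * indicator {-4..4}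
      (w \<bullet> f + 1 * \<tau>)) \<partial>lborel) \<partial>lborel)"
    proof (intro nn_integral_mono)
      fix w :: 'a and \<tau> :: real
      show "indicator {0..1} \<tau> * (indicator (cball c0 2) (w + \<tau> *\<^sub>R f) * ennreal (h ((w + \<tau> *\<^sub>R f) \<bullet> f)))
        \<le> indicator (cball c0 3) w * (ennreal (h (w \<bullet> f + 1 * \<tau>)) * indicator {-4..4} (w \<bullet> f + 1 * \<tau>))"
      proof (cases "\<tau> \<in> {0..1} \<and> w + \<tau> *\<^sub>R f \<in> cball c0 2")
        case True
        have wf: "(w + \<tau> *\<^sub>R f) \<bullet> f = w \<bullet> f + 1 * \<tau>" by (simp add: inner_simps ff)
        have "\<bar>(w + \<tau> *\<^sub>R f) \<bullet> f\<bar> \<le> norm (w + \<tau> *\<^sub>R f) * norm f" by (rule Cauchy_Schwarz_ineq2)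
        also have "\<dots> \<le> 4"
          using True c0 f norm_triangle_ineq2[of "w + \<tau> *\<^sub>R f" c0] by (auto simp: dist_norm norm_minus_commute)
        finally have "w \<bullet> f + 1 * \<tau> \<in> {-4..4}" unfolding wf by auto
        moreover have "dist c0 w \<le> dist c0 (w + \<tau> *\<^sub>R f) + dist (w + \<tau> *\<^sub>R f) w"
          by (rule dist_triangle)
        then have "w \<in> cball c0 3" using True f by (auto simp: dist_norm)
        ultimately show ?thesis using True wf by simp
      qed (auto split: split_indicator)
    qed
    also have "\<dots> = (\<integral>\<^sup>+w. indicator (cball c0 3) w * ?H \<partial>lborel)"
    proof (intro nn_integral_cong)
      fix w :: 'a
      have "?H =
         (\<integral>\<^sup>+\<tau>. ennreal (h (w \<bullet> f + 1 * \<tau>)) * indicator {-4..4} (w \<bullet> f + 1 * \<tau>) \<partial>lborel)"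
        by (subst nn_integral_real_affine[where c=1 and t="w \<bullet> f"]) auto
      then show "(\<integral>\<^sup>+\<tau>. indicator (cball c0 3) w * (ennreal (h (w \<bullet> f + 1 * \<tau>)) * indicator {-4..4} (w \<bullet> f
        + 1 * \<tau>)) \<partial>lborel)
        = indicator (cball c0 3) w * ?H"
        by (subst nn_integral_cmult) (auto simp: borel_measurable_indicator)
    qed
    also have "\<dots> = ennreal V * ?H"
      by (subst nn_integral_multc) (auto simp: V)
    also have "\<dots> \<le> ennreal V * ennreal (4 * a * ln ((a + 4) / a))"
      unfolding h_def by (intro mult_left_mono nn_integral_inverse_shift a) auto
    also have "\<dots> \<le> ennreal V * ennreal (4 * 54 powr (1 - \<kappa>) * 58 powr \<kappa> / \<kappa> * R powr (\<kappa> - 1))"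
    proof (intro mult_left_mono ennreal_leI)
      \<comment> \<open>The power \<open>\<kappa>\<close> absorbs the logarithm; since
        \<open>a \<le> 54\<close>, the numerator \<open>a + 4\<close> is at most 58.\<close>
      have "ln ((a + 4) / a) \<le> ((a + 4) / a) powr \<kappa> / \<kappa>"
        using a \<kappa> by (intro ln_powr_bound) auto
      also have "\<dots> \<le> (58 / a) powr \<kappa> / \<kappa>"
        using a \<kappa> by (intro divide_right_mono powr_mono2) auto
      finally have "4 * a * ln ((a + 4) / a) \<le> 4 * a * ((58 / a) powr \<kappa> / \<kappa>)"
        using a by (intro mult_left_mono) auto
      also have "\<dots> = 4 * 58 powr \<kappa> / \<kappa> * (a * a powr (- \<kappa>))"
        using a by (simp add: powr_divide powr_minus field_simps)
      also have "a * a powr (- \<kappa>) = a powr (1 - \<kappa>)"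
        using a by (simp add: powr_diff powr_minus field_simps)
      also have "a powr (1 - \<kappa>) = 54 powr (1 - \<kappa>) * R powr (\<kappa> - 1)"
        using R by (simp add: a_def powr_divide powr_diff field_simps)
      finally show "4 * a * ln ((a + 4) / a) \<le> 4 * 54 powr (1 - \<kappa>) * 58 powr \<kappa> / \<kappa> * R powr (\<kappa> - 1)"
        by (simp add: mult_ac)
    qed auto
    also have "\<dots> = ennreal (C * norm \<zeta> powr (\<kappa> - 1))"
      using V \<kappa> by (simp add: C_def R_def mult_ac flip: ennreal_mult)
    finally show ?thesis .
  qed
  ultimately show ?thesis by (rule that)
qed

section \<open>Energy of finite-scale Frostman masses\<close>

lemma powr_le_exp:
  fixes x p \<gamma> :: real
  assumes "0 < p" "0 < \<gamma>" "0 \<le> x"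
  shows "x powr p \<le> (p / \<gamma>) powr p * exp (\<gamma> * x)"
proof -
  have "\<gamma> * x / p \<le> exp (\<gamma> * x / p)" using exp_ge_add_one_self[of "\<gamma> * x / p"] by linarith
  then have "x \<le> p / \<gamma> * exp (\<gamma> * x / p)" using assms by (simp add: field_simps)
  then have "x powr p \<le> (p / \<gamma> * exp (\<gamma> * x / p)) powr p"
    using assms by (intro powr_mono2) auto
  also have "\<dots> = (p / \<gamma>) powr p * exp (\<gamma> * x)"
    unfolding powr_mult[of "p / \<gamma>"] using assms by (simp add: powr_def[of "exp _"])
  finally show ?thesis .
qed

lemma sum_power_half_le: "(\<Sum>j\<le>J. (1/2::real) ^ j) \<le> 2"
proof -
  have "(\<Sum>j\<le>J. (1/2::real) ^ j) = 2 - (1/2) ^ J" by (induction J) auto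
  then show ?thesis by simp
qed

lemma sum_geometric_powr_le:
  fixes \<kappa> :: real
  assumes "\<kappa> > 0"
  shows "(\<Sum>j\<in>{..<J}. (2 powr (- \<kappa>)) ^ j) \<le> 1 / (1 - 2 powr (- \<kappa>))"
proof -
  have "2 powr (- \<kappa>) < (1::real)" using assms by (simp add: powr_less_one)
  then show ?thesis
    by (intro order_trans[OF sum_le_suminf[OF summable_geometric]]) (auto simp: suminf_geometric)
qed

text \<open>A discrete Frostman measure: the ball condition is required only down to radius 2^(-n),
  below which single atoms become visible. One constant \<open>C\<close> bounds support, total mass
  and ball masses, so that later constants depend on \<open>C\<close> and \<open>s\<close> but
  neither on \<open>n\<close> nor on the atoms.\<close>

definition frostman :: "real \<Rightarrow> real \<Rightarrow> nat \<Rightarrow> 'a::euclidean_space set \<Rightarrow> ('a \<Rightarrow> real) \<Rightarrow> bool" where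
  "frostman C s n A m \<longleftrightarrow> finite A \<and> (\<forall>a. 0 \<le> m a) \<and> (\<forall>a\<in>A. norm a \<le> C) \<and> sum m A \<le> C \<and>
     (\<forall>x r. (1/2) ^ n \<le> r \<longrightarrow> sum m (A \<inter> cball x r) \<le> C * r powr s)"

text \<open>A layer-cake argument: a Gaussian of width \<open>sqrt \<tau>\<close> is dominated by
  indicators of balls of radius \<open>2^j * sqrt \<tau>\<close> with coefficients of order 2^(-j (s
  + 1)). The ball condition contributes 2^(j s), which leaves a geometric series.\<close>

lemma frostman_gaussian_mass:
  fixes C s :: real
  assumes "0 \<le> C" "0 \<le> s"
  obtains C' where "C' > 0"
    "\<And>n (A::'a::euclidean_space set) m x \<tau>. frostman C s n A m \<Longrightarrow> (1/4)^n \<le> \<tau> \<Longrightarrow>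
       (\<Sum>b\<in>A. m b * exp (- ((norm (x - b))\<^sup>2 / (2 * \<tau>)))) \<le> C' * \<tau> powr (s / 2)"
proof -
  \<comment> \<open>The constant of \<open>powr_le_exp\<close> for the exponent
    \<open>(s + 1) / 2\<close> and the rate 1/2, to be applied to the square of
    \<open>v\<close>.\<close>
  define K0 where "K0 = ((s + 1) / 2 / (1/2)) powr ((s + 1) / 2)"
  define K where "K = max 1 (K0 * 2 powr (s + 1))"
  have K: "K \<ge> 1" by (simp add: K_def)
  define c where "c j = K * (1/2) ^ j * 2 powr (- s * real j)" for j :: nat
  have c: "c j \<ge> 0" for j using K by (simp add: c_def)
  have layer: "exp (- (v\<^sup>2 / 2)) \<le> (\<Sum>j\<le>J. c j * (if v \<le> 2 ^ j then 1 else 0))"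
    if v: "0 \<le> v" "v \<le> 2 ^ J" for v J
  proof -
    define j where "j = (LEAST j. v \<le> 2 ^ j)"
    have j: "v \<le> 2 ^ j" "j \<le> J"
      using v LeastI[of "\<lambda>j. v \<le> 2 ^ j" J] Least_le[of "\<lambda>j. v \<le> 2 ^ j" J] by (auto simp: j_def)
    have "exp (- (v\<^sup>2 / 2)) \<le> c j"
    proof (cases j)
      case 0
      have "exp (- (v\<^sup>2 / 2)) \<le> 1" by simp
      also have "1 \<le> c j" using K 0 by (simp add: c_def)
      finally show ?thesis .
    next
      case (Suc i)
      then have vi: "2 ^ i < v"
        using not_less_Least[of i "\<lambda>j. v \<le> 2 ^ j"] by (auto simp: j_def not_le)
      then have v0: "v > 0" by (smt (verit) zero_less_power)
      have "v powr (s + 1) = (v\<^sup>2) powr ((s + 1) / 2)"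
      proof -
        have e: "2 * ((s + 1) / 2) = s + 1" by simp
        have "(v\<^sup>2) powr ((s + 1) / 2) = v powr (2 * ((s + 1) / 2))"
          using v0 by (subst powr_numeral[symmetric]) (auto simp only: powr_powr)
        then show ?thesis unfolding e by simp
      qed
      also have "\<dots> \<le> K0 * exp (1/2 * v\<^sup>2)"
        unfolding K0_def using assms(2) by (intro powr_le_exp) auto
      finally have "exp (- (v\<^sup>2 / 2)) * v powr (s + 1) \<le> K0"
        by (simp add: exp_minus field_simps)
      moreover have "(2 ^ i) powr (s + 1) \<le> v powr (s + 1)"
        using vi assms(2) by (intro powr_mono2) auto
      then have "exp (- (v\<^sup>2 / 2)) * (2 ^ i) powr (s + 1) \<le> exp (- (v\<^sup>2 / 2)) * v powr (s + 1)"
        by (intro mult_left_mono) auto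
      ultimately have "exp (- (v\<^sup>2 / 2)) * (2 ^ i) powr (s + 1) \<le> K0" by linarith
      then have "exp (- (v\<^sup>2 / 2)) * ((2 ^ i) powr (s + 1) * 2 powr (s + 1)) \<le> K0 * 2 powr (s + 1)"
        by (simp add: mult.assoc[symmetric])
      also have "\<dots> \<le> K" by (simp add: K_def)
      also have "(2 ^ i) powr (s + 1) * 2 powr (s + 1) = (2 ^ j) powr (s + 1 :: real)"
        using Suc by (simp add: powr_mult mult.commute)
      also have "(2 ^ j) powr (s + 1) = 2 ^ j * 2 powr (s * real j)"
        by (simp add: powr_powr powr_add flip: powr_realpow) (simp add: mult.commute)
      finally show ?thesis
        by (simp add: c_def powr_minus field_simps power_one_over)
    qed
    also have "c j = c j * (if v \<le> 2 ^ j then 1 else 0)" using j by simp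
    also have "\<dots> \<le> (\<Sum>j\<le>J. c j * (if v \<le> 2 ^ j then 1 else 0))"
      using j c by (intro member_le_sum) auto
    finally show ?thesis .
  qed
  \<comment> \<open>The 2 bounds the geometric series, and the summand 1 keeps \<open>C'\<close>
    positive when \<open>C = 0\<close>.\<close>
  define C' where "C' = 2 * K * C + 1"
  have "C' > 0" using K assms(1) by (simp add: C'_def add_nonneg_pos)
  moreover have "(\<Sum>b\<in>A. m b * exp (- ((norm (x - b))\<^sup>2 / (2 * \<tau>)))) \<le> C' * \<tau> powr (s / 2)"
    if fr: "frostman C s n A m" and \<tau>: "(1/4)^n \<le> \<tau>" for n and A :: "'a set" and m x \<tau>
  proof -
    have fA: "finite A" and m: "\<And>a. 0 \<le> m a"
      and ball: "\<And>x r. (1/2) ^ n \<le> r \<Longrightarrow> sum m (A \<inter> cball x r) \<le> C * r powr s"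
      using fr by (auto simp: frostman_def)
    have \<tau>0: "\<tau> > 0" by (rule less_le_trans[OF _ \<tau>]) simp
    have sq: "(1/2)^n \<le> sqrt \<tau>"
      using \<tau> by (intro real_le_rsqrt) (simp add: power_mult_distrib power2_eq_square flip: power_mult_distrib)
    define v where "v b = norm (x - b) / sqrt \<tau>" for b
    have v: "v b \<ge> 0" for b using \<tau>0 by (simp add: v_def)
    obtain J where J: "\<And>b. b \<in> A \<Longrightarrow> v b \<le> 2 ^ J"
    proof -
      obtain J where J: "(\<Sum>b\<in>A. v b) < 2 ^ J" using real_arch_pow[of 2] by auto
      show ?thesis
        by (rule that[of J]) (use J member_le_sum[of _ A v] v fA in fastforce)
    qed
    have "(\<Sum>b\<in>A. m b * exp (- ((norm (x - b))\<^sup>2 / (2 * \<tau>)))) = (\<Sum>b\<in>A. m b * exp (- ((v b)\<^sup>2 / 2)))"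
      using \<tau>0 by (simp add: v_def power_divide mult.commute)
    also have "\<dots> \<le> (\<Sum>b\<in>A. m b * (\<Sum>j\<le>J. c j * (if v b \<le> 2 ^ j then 1 else 0)))"
      by (intro sum_mono mult_left_mono layer v J m)
    also have "\<dots> = (\<Sum>j\<le>J. c j * (\<Sum>b\<in>A. if v b \<le> 2 ^ j then m b else 0))"
      unfolding sum_distrib_left by (subst sum.swap) (auto intro!: sum.cong)
    also have "\<dots> = (\<Sum>j\<le>J. c j * sum m (A \<inter> cball x (2 ^ j * sqrt \<tau>)))"
    proof (intro sum.cong refl)
      fix j :: nat
      have "v b \<le> 2 ^ j \<longleftrightarrow> b \<in> cball x (2 ^ j * sqrt \<tau>)" for b
        using \<tau>0 by (simp add: v_def dist_norm field_simps)
      then show "c j * (\<Sum>b\<in>A. if v b \<le> 2 ^ j then m b else 0) = c j * sum m (A \<inter> cball x (2 ^ j * sqrt \<tau>))"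
        using fA by (simp add: sum.inter_restrict)
    qed
    also have "\<dots> \<le> (\<Sum>j\<le>J. c j * (C * (2 ^ j * sqrt \<tau>) powr s))"
    proof (intro sum_mono mult_left_mono ball c)
      fix j :: nat
      have "1 * sqrt \<tau> \<le> 2 ^ j * sqrt \<tau>" using \<tau>0 by (intro mult_right_mono) auto
      then show "(1/2)^n \<le> 2 ^ j * sqrt \<tau>" using sq by linarith
    qed
    also have "\<dots> = (\<Sum>j\<le>J. K * C * \<tau> powr (s / 2) * (1/2) ^ j)"
    proof (intro sum.cong refl)
      fix j
      have "(2 ^ j * sqrt \<tau>) powr s = 2 powr (s * real j) * \<tau> powr (s / 2)"
        using \<tau>0 by (simp add: powr_mult powr_powr mult.commute flip: powr_realpow powr_half_sqrt)
      then show "c j * (C * (2 ^ j * sqrt \<tau>) powr s) = K * C * \<tau> powr (s / 2) * (1/2) ^ j"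
        by (simp add: c_def powr_minus)
    qed
    also have "\<dots> = K * C * \<tau> powr (s / 2) * (\<Sum>j\<le>J. (1/2) ^ j)"
      by (simp only: sum_distrib_left)
    also have "\<dots> \<le> K * C * \<tau> powr (s / 2) * 2"
      using K assms(1) by (intro mult_left_mono sum_power_half_le) auto
    also have "\<dots> \<le> C' * \<tau> powr (s / 2)"
      by (simp add: C'_def algebra_simps)
    finally show ?thesis .
  qed
  ultimately show ?thesis by (rule that)
qed

text \<open>The squared modulus of the Fourier transform of the measure with masses
  \<open>M i\<close> at the points \<open>P i\<close>. Indexing by \<open>i\<close> rather than by
  points admits coincident points, as can occur among differences of pairs.\<close>

definition spectrum :: "'i set \<Rightarrow> ('i \<Rightarrow> real) \<Rightarrow> ('i \<Rightarrow> 'a::euclidean_space) \<Rightarrow> 'a \<Rightarrow> real" where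
  "spectrum I M P \<xi> = (norm (\<Sum>i\<in>I. M i *\<^sub>R cis (\<xi> \<bullet> P i)))\<^sup>2"

lemma spectrum_nonneg [simp]: "0 \<le> spectrum I M P \<xi>"
  by (simp add: spectrum_def)

lemma spectrum_cos_sin:
  "spectrum I M P \<xi> = (\<Sum>i\<in>I. M i * cos (\<xi> \<bullet> P i))\<^sup>2 + (\<Sum>i\<in>I. M i * sin (\<xi> \<bullet> P i))\<^sup>2"
  by (simp add: spectrum_def cmod_power2)

lemma spectrum_double_sum:
  "spectrum I M P \<xi> = (\<Sum>i\<in>I. \<Sum>j\<in>I. M i * M j * cos (\<xi> \<bullet> (P i - P j)))"
  unfolding spectrum_cos_sin power2_eq_square sum_product sum.distrib[symmetric]
  by (intro sum.cong refl) (simp add: inner_diff_right cos_diff algebra_simps)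

lemma borel_measurable_spectrum [measurable]: "spectrum I M P \<in> borel_measurable borel"
  unfolding spectrum_cos_sin by measurable

lemma spectrum_le:
  assumes "\<And>i. i \<in> I \<Longrightarrow> 0 \<le> M i"
  shows "spectrum I M P \<xi> \<le> (sum M I)\<^sup>2"
proof -
  have "norm (\<Sum>i\<in>I. M i *\<^sub>R cis (\<xi> \<bullet> P i)) \<le> (\<Sum>i\<in>I. norm (M i *\<^sub>R cis (\<xi> \<bullet> P i)))"
    by (rule norm_sum)
  also have "\<dots> = sum M I" using assms by (intro sum.cong) auto
  finally show ?thesis unfolding spectrum_def by (intro power_mono) auto
qed

text \<open>Expanding the square into pairs makes each term the transform of a Gaussian, so the
  damped energy in frequency is an interaction energy between the point masses.\<close>

lemma has_bochner_integral_spectrum_gauss: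
  fixes P :: "'i \<Rightarrow> 'a::euclidean_space"
  assumes "\<tau> > 0"
  shows "has_bochner_integral lborel (\<lambda>\<xi>. spectrum I M P \<xi> * exp (- (\<tau> * (norm \<xi>)\<^sup>2 / 2)))
    ((2 * pi) ^ DIM('a) * (\<Sum>i\<in>I. \<Sum>j\<in>I. M i * M j * gauss \<tau> (P i - P j)))"
proof -
  have "has_bochner_integral lborel
     (\<lambda>\<xi>. \<Sum>i\<in>I. \<Sum>j\<in>I. M i * M j * (cos (\<xi> \<bullet> (P i - P j)) * exp (- (\<tau> * (norm \<xi>)\<^sup>2 / 2))))
     (\<Sum>i\<in>I. \<Sum>j\<in>I. M i * M j * ((2 * pi) ^ DIM('a) * gauss \<tau> (P i - P j)))"
    by (intro has_bochner_integral_sum has_bochner_integral_mult_right has_bochner_integral_gauss_cos assms)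
  also have "(\<lambda>\<xi>. \<Sum>i\<in>I. \<Sum>j\<in>I. M i * M j * (cos (\<xi> \<bullet> (P i - P j)) * exp (- (\<tau> * (norm \<xi>)\<^sup>2 / 2)))) =
      (\<lambda>\<xi>. spectrum I M P \<xi> * exp (- (\<tau> * (norm \<xi>)\<^sup>2 / 2)))"
    unfolding spectrum_double_sum sum_distrib_right by (intro ext sum.cong refl) (rule mult.assoc[symmetric])
  also have "(\<Sum>i\<in>I. \<Sum>j\<in>I. M i * M j * ((2 * pi) ^ DIM('a) * gauss \<tau> (P i - P j))) =
      (2 * pi) ^ DIM('a) * (\<Sum>i\<in>I. \<Sum>j\<in>I. M i * M j * gauss \<tau> (P i - P j))"
    unfolding sum_distrib_left by (intro sum.cong refl) (rule mult.left_commute)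
  finally show ?thesis .
qed

lemma nn_integral_spectrum_gauss:
  fixes P :: "'i \<Rightarrow> 'a::euclidean_space"
  assumes "\<tau> > 0"
  shows "(\<integral>\<^sup>+\<xi>. ennreal (spectrum I M P \<xi> * exp (- (\<tau> * (norm \<xi>)\<^sup>2 / 2))) \<partial>lborel) =
    ennreal ((2 * pi) ^ DIM('a) * (\<Sum>i\<in>I. \<Sum>j\<in>I. M i * M j * gauss \<tau> (P i - P j)))"
  using has_bochner_integral_spectrum_gauss[OF assms, of I M P]
  by (auto simp: has_bochner_integral_iff nn_integral_eq_integral)

text \<open>The maximum accounts for frequencies beyond \<open>2^n\<close>, where the masses look like isolated points.\<close>

lemma frostman_spectrum_energy:
  fixes C s :: real
  assumes "0 \<le> C" "0 \<le> s"
  obtains C' where "C' > 0"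
    "\<And>n (A::'a::euclidean_space set) m \<tau>. frostman C s n A m \<Longrightarrow> \<tau> > 0 \<Longrightarrow>
       (\<integral>\<^sup>+\<xi>. ennreal (spectrum A m (\<lambda>a. a) \<xi> * exp (- (\<tau> * (norm \<xi>)\<^sup>2 / 2))) \<partial>lborel)
       \<le> ennreal (C' * \<tau> powr (- (DIM('a) - s) / 2) * max 1 (((1/4)^n / \<tau>) powr (s / 2)))"
proof -
  obtain C1 where C1: "C1 > 0"
    "\<And>n (A::'a set) m x \<tau>. frostman C s n A m \<Longrightarrow> (1/4)^n \<le> \<tau> \<Longrightarrow>
       (\<Sum>b\<in>A. m b * exp (- ((norm (x - b))\<^sup>2 / (2 * \<tau>)))) \<le> C1 * \<tau> powr (s / 2)"
    using frostman_gaussian_mass[OF assms] by blast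
  define L where "L = (2 * pi) ^ DIM('a) / (2 * pi) powr (DIM('a) / 2)"
  have L: "L > 0" by (simp add: L_def)
  define C' where "C' = L * C * C1 + 1"
  have C': "C' > 0" using L C1 assms(1) by (simp add: C'_def add_nonneg_pos)
  moreover have "(\<integral>\<^sup>+\<xi>. ennreal (spectrum A m (\<lambda>a. a) \<xi> * exp (- (\<tau> * (norm \<xi>)\<^sup>2 / 2))) \<partial>lborel)
       \<le> ennreal (C' * \<tau> powr (- (DIM('a) - s) / 2) * max 1 (((1/4)^n / \<tau>) powr (s / 2)))"
    if fr: "frostman C s n A m" and \<tau>: "\<tau> > 0" for n and A :: "'a set" and m \<tau>
  proof -
    have m: "\<And>a. 0 \<le> m a" and mA: "sum m A \<le> C" using fr by (auto simp: frostman_def)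
    \<comment> \<open>Gaussian masses are controlled only for variances at least (1/4)^n. For
      smaller \<open>\<tau>\<close> the variance inside the exponential is raised to
      \<open>\<tau>'\<close> while the normalising power of \<open>\<tau>\<close> is kept; this
      produces the maximum.\<close>
    define \<tau>' where "\<tau>' = max \<tau> ((1/4)^n)"
    have \<tau>': "\<tau>' \<ge> (1/4)^n" "\<tau>' \<ge> \<tau>" by (auto simp: \<tau>'_def)
    have "(2 * pi) ^ DIM('a) * (\<Sum>i\<in>A. \<Sum>j\<in>A. m i * m j * gauss \<tau> (i - j)) =
      L * \<tau> powr (- real DIM('a) / 2) * (\<Sum>i\<in>A. m i * (\<Sum>j\<in>A. m j * exp (- ((norm (i - j))\<^sup>2 / (2 * \<tau>)))))"
    proof -
      define X where "X = L * \<tau> powr (- real DIM('a) / 2)"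
      define e where "e i j = exp (- ((norm (i - j))\<^sup>2 / (2 * \<tau>)))" for i j :: 'a
      have g: "(2 * pi) ^ DIM('a) * gauss \<tau> (i - j) = X * e i j" for i j :: 'a
      proof -
        have 1: "(2 * pi * \<tau>) powr (DIM('a) / 2) = (2 * pi) powr (DIM('a) / 2) * \<tau> powr (DIM('a) / 2)"
          by (rule powr_mult)
        have 2: "\<tau> powr (- real DIM('a) / 2) = 1 / \<tau> powr (DIM('a) / 2)"
          by (simp only: powr_minus_divide[symmetric] minus_divide_left)
        have 3: "a * (y / (b * c)) = a / b * (1 / c) * y" for a b c y :: real by simp
        show ?thesis unfolding gauss_def L_def X_def e_def 1 2 by (rule 3)
      qed
      have "(2 * pi) ^ DIM('a) * (\<Sum>i\<in>A. \<Sum>j\<in>A. m i * m j * gauss \<tau> (i - j)) =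
         (\<Sum>i\<in>A. \<Sum>j\<in>A. m i * m j * ((2 * pi) ^ DIM('a) * gauss \<tau> (i - j)))"
        unfolding sum_distrib_left by (intro sum.cong refl) (rule mult.left_commute)
      also have "\<dots> = (\<Sum>i\<in>A. \<Sum>j\<in>A. m i * m j * (X * e i j))" unfolding g ..
      also have "\<dots> = X * (\<Sum>i\<in>A. m i * (\<Sum>j\<in>A. m j * e i j))"
        unfolding sum_distrib_left by (intro sum.cong refl) (simp only: mult_ac)
      finally show ?thesis unfolding X_def e_def .
    qed
    also have "\<dots> \<le> L * \<tau> powr (- real DIM('a) / 2) * (\<Sum>i\<in>A. m i * (\<Sum>j\<in>A. m j * exp (- ((norm (i - j))\<^sup>2 / (2
      * \<tau>')))))"
      using \<tau> \<tau>' m L by (intro mult_left_mono sum_mono) (auto intro!: divide_left_mono mult_pos_pos)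
    also have "\<dots> \<le> L * \<tau> powr (- real DIM('a) / 2) * (\<Sum>i\<in>A. m i * (C1 * \<tau>' powr (s / 2)))"
      using m L by (intro mult_left_mono sum_mono C1(2)[OF fr \<tau>'(1)]) auto
    also have "\<dots> = L * \<tau> powr (- real DIM('a) / 2) * (C1 * \<tau>' powr (s / 2)) * sum m A"
      unfolding sum_distrib_left by (intro sum.cong refl) (simp only: mult_ac)
    also have "\<dots> \<le> L * \<tau> powr (- real DIM('a) / 2) * (C1 * \<tau>' powr (s / 2)) * C"
      using L C1 mA by (intro mult_left_mono) auto
    also have "\<dots> = L * C * C1 * (\<tau> powr (- real DIM('a) / 2) * \<tau>' powr (s / 2))" by simp
    also have "\<dots> \<le> C' * (\<tau> powr (- real DIM('a) / 2) * \<tau>' powr (s / 2))"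
      by (intro mult_right_mono) (auto simp: C'_def)
    also have "\<tau> powr (- real DIM('a) / 2) * \<tau>' powr (s / 2) = \<tau> powr (- (DIM('a) - s) / 2) * max 1
      (((1/4)^n / \<tau>) powr (s / 2))"
    proof -
      have "\<tau>' = \<tau> * max 1 ((1/4)^n / \<tau>)" using \<tau> by (auto simp: \<tau>'_def max_def field_simps)
      then have "\<tau>' powr (s / 2) = \<tau> powr (s / 2) * (max 1 ((1/4)^n / \<tau>)) powr (s / 2)"
        using \<tau> by (simp add: powr_mult)
      also have "(max 1 ((1/4)^n / \<tau>)) powr (s / 2) = max 1 (((1/4)^n / \<tau>) powr (s / 2))"
      proof (cases "1 \<le> (1/4)^n / \<tau>")
        case True
        then show ?thesis using assms(2) ge_one_powr_ge_zero[OF True, of "s/2"] by (simp add: max_def)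
      next
        case False
        then have "((1/4)^n / \<tau>) powr (s / 2) \<le> 1 powr (s / 2)"
          using \<tau> assms(2) by (intro powr_mono2) auto
        then show ?thesis using False by (simp add: max_def)
      qed
      finally show ?thesis
        by (simp add: mult.assoc[symmetric] powr_add[symmetric] diff_divide_distrib add.commute)
    qed
    finally show ?thesis
      unfolding nn_integral_spectrum_gauss[OF \<tau>] by (intro ennreal_leI) (simp add: mult.assoc)
  qed
  ultimately show ?thesis by (rule that)
qed

text \<open>Nonnegativity of the variance of \<open>f\<close> under the Gaussian probability
  density; the bound \<open>B\<close> makes \<open>f\<close> square integrable.\<close>

lemma gauss_variance_nonneg:
  fixes f :: "'a::euclidean_space \<Rightarrow> real"
  assumes t: "t > 0" and f: "has_bochner_integral lborel (\<lambda>x. gauss t x * f x) c"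
    and [measurable]: "f \<in> borel_measurable borel" and B: "\<And>x. \<bar>f x\<bar> \<le> B"
  shows "ennreal (c\<^sup>2) \<le> (\<integral>\<^sup>+x. ennreal (gauss t x * (f x)\<^sup>2) \<partial>lborel)"
proof -
  have g: "has_bochner_integral lborel (gauss t :: 'a \<Rightarrow> real) 1" by (rule has_bochner_integral_gauss[OF t])
  have int2: "integrable lborel (\<lambda>x. gauss t x * (f x)\<^sup>2)"
  proof (rule Bochner_Integration.integrable_bound)
    show "integrable lborel (\<lambda>x::'a. B\<^sup>2 * gauss t x)" using g by (auto simp: has_bochner_integral_iff)
    show "AE x in lborel. norm (gauss t x * (f x)\<^sup>2) \<le> norm (B\<^sup>2 * gauss t x)"
    proof (intro AE_I2)
      fix x :: 'a
      have "(f x)\<^sup>2 \<le> B\<^sup>2" using B[of x] by (simp add: abs_le_square_iff[symmetric])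
      then have "gauss t x * (f x)\<^sup>2 \<le> gauss t x * B\<^sup>2" by (intro mult_left_mono) auto
      then show "norm (gauss t x * (f x)\<^sup>2) \<le> norm (B\<^sup>2 * gauss t x)" by (simp add: mult.commute)
    qed
  qed measurable
  have "0 \<le> (LINT x|lborel. gauss t x * (f x - c)\<^sup>2)" by (intro integral_nonneg_AE) auto
  also have "(\<lambda>x. gauss t x * (f x - c)\<^sup>2) = (\<lambda>x. gauss t x * (f x)\<^sup>2 - 2 * c * (gauss t x * f x) + c\<^sup>2
    * gauss t x)"
    by (auto simp: fun_eq_iff power2_eq_square algebra_simps)
  also have "(LINT x|lborel. gauss t x * (f x)\<^sup>2 - 2 * c * (gauss t x * f x) + c\<^sup>2 * gauss t x) =
     (LINT x|lborel. gauss t x * (f x)\<^sup>2) - 2 * c * c + c\<^sup>2 * 1"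
    using int2 f g by (subst Bochner_Integration.integral_add Bochner_Integration.integral_diff; auto simp: has_bochner_integral_iff)+
  finally have "c\<^sup>2 \<le> (LINT x|lborel. gauss t x * (f x)\<^sup>2)"
    by (simp add: power2_eq_square)
  then show ?thesis
    using int2 by (subst nn_integral_eq_integral) (auto intro!: ennreal_leI)
qed

text \<open>A measure is a Gaussian times a tilted measure, so its Fourier transform is a Gaussian average of the
  transform of the tilted measure.\<close>

lemma spectrum_le_gauss_average:
  fixes A :: "'a::euclidean_space set"
  shows "ennreal (spectrum A m (\<lambda>a. a) \<zeta>) \<le>
    (\<integral>\<^sup>+\<eta>. ennreal (spectrum A (\<lambda>a. m a * exp ((norm a)\<^sup>2 / 2)) (\<lambda>a. a) \<eta>) * ennreal (gauss 1 (\<eta> - \<zeta>)) \<partial>lborel)"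
proof -
  define M where "M a = m a * exp ((norm a)\<^sup>2 / 2)" for a :: 'a
  \<comment> \<open>\<open>F 0\<close> and \<open>F (pi/2)\<close> are the real and imaginary parts
    of the transform of the tilted masses at \<open>x + \<zeta>\<close>; treating them separately
    keeps all integrals real.\<close>
  define F where "F c x = (\<Sum>a\<in>A. M a * cos ((x + \<zeta>) \<bullet> a - c))" for c and x :: 'a
  define B where "B = (\<Sum>a\<in>A. \<bar>M a\<bar>)"
  have [measurable]: "F c \<in> borel_measurable borel" for c unfolding F_def by measurable
  have F: "has_bochner_integral lborel (\<lambda>x. gauss 1 x * F c x) (\<Sum>a\<in>A. m a * cos (\<zeta> \<bullet> a - c))" for c
  proof -
    have "has_bochner_integral lborel (\<lambda>x. \<Sum>a\<in>A. M a * (gauss 1 x * cos (x \<bullet> a + (\<zeta> \<bullet> a - c))))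
       (\<Sum>a\<in>A. M a * (exp (- (1 * (norm a)\<^sup>2 / 2)) * cos (\<zeta> \<bullet> a - c)))"
      by (intro has_bochner_integral_sum has_bochner_integral_mult_right has_bochner_integral_gauss_cos_phase) simp
    also have "(\<lambda>x. \<Sum>a\<in>A. M a * (gauss 1 x * cos (x \<bullet> a + (\<zeta> \<bullet> a - c)))) = (\<lambda>x. gauss 1 x * F c x)"
      unfolding F_def sum_distrib_left by (intro ext sum.cong refl) (simp add: inner_add_left add_diff_eq)
    also have "(\<Sum>a\<in>A. M a * (exp (- (1 * (norm a)\<^sup>2 / 2)) * cos (\<zeta> \<bullet> a - c))) = (\<Sum>a\<in>A. m a * cos (\<zeta> \<bullet> a - c))"
    proof (intro sum.cong refl)
      fix a :: 'a
      have "exp ((norm a)\<^sup>2 / 2) * exp (- (1 * (norm a)\<^sup>2 / 2)) = 1" by (simp flip: exp_add)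
      then show "M a * (exp (- (1 * (norm a)\<^sup>2 / 2)) * cos (\<zeta> \<bullet> a - c)) = m a * cos (\<zeta> \<bullet> a - c)"
        unfolding M_def by (metis mult.assoc mult.left_neutral)
    qed
    finally show ?thesis .
  qed
  have FB: "\<bar>F c x\<bar> \<le> B" for c x
    unfolding F_def B_def by (intro order_trans[OF sum_abs] sum_mono) (simp add: abs_mult mult_left_le)
  have sin: "cos (y - pi/2) = sin y" for y :: real by (simp add: cos_diff)
  have Fspec: "(F 0 x)\<^sup>2 + (F (pi/2) x)\<^sup>2 = spectrum A M (\<lambda>a. a) (x + \<zeta>)" for x
    unfolding F_def spectrum_cos_sin sin by simp
  have "ennreal (spectrum A m (\<lambda>a. a) \<zeta>) = ennreal ((\<Sum>a\<in>A. m a * cos (\<zeta> \<bullet> a - 0))\<^sup>2) + ennreal ((\<Sum>a\<in>A. m a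
    * cos (\<zeta> \<bullet> a - pi/2))\<^sup>2)"
    unfolding spectrum_cos_sin sin by (simp flip: ennreal_plus)
  also have "\<dots> \<le> (\<integral>\<^sup>+x. ennreal (gauss 1 x * (F 0 x)\<^sup>2) \<partial>lborel) + (\<integral>\<^sup>+x. ennreal (gauss 1 x * (F
    (pi/2) x)\<^sup>2) \<partial>lborel)"
    by (intro add_mono gauss_variance_nonneg[where B=B] F FB) auto
  also have "\<dots> = (\<integral>\<^sup>+x. ennreal (gauss 1 x * (F 0 x)\<^sup>2) + ennreal (gauss 1 x * (F (pi/2) x)\<^sup>2) \<partial>lborel)"
    by (intro nn_integral_add[symmetric]) auto
  also have "\<dots> = (\<integral>\<^sup>+x. ennreal (spectrum A M (\<lambda>a. a) (x + \<zeta>)) * ennreal (gauss 1 ((x + \<zeta>) - \<zeta>)) \<partial>lborel)"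
  proof (intro nn_integral_cong)
    fix x :: 'a
    have "ennreal (gauss 1 x * (F 0 x)\<^sup>2) + ennreal (gauss 1 x * (F (pi/2) x)\<^sup>2) = ennreal (gauss 1 x *
      ((F 0 x)\<^sup>2 + (F (pi/2) x)\<^sup>2))"
      by (simp add: ring_distribs flip: ennreal_plus)
    then show "ennreal (gauss 1 x * (F 0 x)\<^sup>2) + ennreal (gauss 1 x * (F (pi/2) x)\<^sup>2) =
       ennreal (spectrum A M (\<lambda>a. a) (x + \<zeta>)) * ennreal (gauss 1 ((x + \<zeta>) - \<zeta>))"
      unfolding Fspec by (simp add: ennreal_mult mult.commute)
  qed
  also have "\<dots> = (\<integral>\<^sup>+x. ennreal (spectrum A M (\<lambda>a. a) x) * ennreal (gauss 1 (x - \<zeta>)) \<partial>lborel)"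
    by (rule nn_integral_lborel_translate) measurable
  finally show ?thesis unfolding M_def .
qed

text \<open>The comparison takes place in physical space: the interaction energy is monotone in the
  masses because the Gaussian kernel is nonnegative, whereas the two spectra are not comparable
  pointwise. On the support the tilt is at most \<open>exp (C^2 / 2)\<close>, and it enters
  twice.\<close>

lemma spectrum_energy_tilt:
  fixes A :: "'a::euclidean_space set"
  assumes fr: "frostman C s n A m" and \<tau>: "\<tau> > 0"
  shows "(\<integral>\<^sup>+\<eta>. ennreal (spectrum A (\<lambda>a. m a * exp ((norm a)\<^sup>2 / 2)) (\<lambda>a. a) \<eta> * exp (- (\<tau> * (norm \<eta>)\<^sup>2
    / 2))) \<partial>lborel)
    \<le> ennreal (exp (C\<^sup>2)) * (\<integral>\<^sup>+\<eta>. ennreal (spectrum A m (\<lambda>a. a) \<eta> * exp (- (\<tau> * (norm \<eta>)\<^sup>2 / 2))) \<partial>lborel)"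
proof -
  have m: "\<And>a. 0 \<le> m a" and C: "\<And>a. a \<in> A \<Longrightarrow> norm a \<le> C" using fr by (auto simp: frostman_def)
  define E where "E = exp (C\<^sup>2 / 2)"
  have EE: "exp (C\<^sup>2) = E * E" by (simp add: E_def flip: exp_add)
  define M where "M a = m a * exp ((norm a)\<^sup>2 / 2)" for a :: 'a
  have M: "0 \<le> M a" "M a \<le> E * m a" if "a \<in> A" for a
  proof -
    show "0 \<le> M a" using m by (simp add: M_def)
    have "exp ((norm a)\<^sup>2 / 2) \<le> E" unfolding E_def using C[OF that] by (simp add: power_mono)
    then show "M a \<le> E * m a" unfolding M_def using m[of a] by
      (simp add: mult.commute[of "m a"] mult_right_mono)
  qed
  have "(\<Sum>i\<in>A. \<Sum>j\<in>A. M i * M j * gauss \<tau> (i - j)) \<le> (\<Sum>i\<in>A. \<Sum>j\<in>A. (E * m i) * (E * m j) * gauss \<tau> (i - j))"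
    using M m by (intro sum_mono mult_right_mono mult_mono) (auto simp: E_def)
  also have "\<dots> = exp (C\<^sup>2) * (\<Sum>i\<in>A. \<Sum>j\<in>A. m i * m j * gauss \<tau> (i - j))"
    unfolding EE sum_distrib_left by (intro sum.cong refl) (simp only: mult_ac)
  finally have "(2 * pi) ^ DIM('a) * (\<Sum>i\<in>A. \<Sum>j\<in>A. M i * M j * gauss \<tau> (i - j)) \<le>
      (2 * pi) ^ DIM('a) * (exp (C\<^sup>2) * (\<Sum>i\<in>A. \<Sum>j\<in>A. m i * m j * gauss \<tau> (i - j)))"
    by (intro mult_left_mono) auto
  moreover have "0 \<le> (\<Sum>i\<in>A. \<Sum>j\<in>A. m i * m j * gauss \<tau> (i - j))" using m by (intro sum_nonneg) auto
  ultimately show ?thesis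
    unfolding M_def[symmetric] nn_integral_spectrum_gauss[OF \<tau>]
    by (simp add: mult.left_commute flip: ennreal_mult)
qed

text \<open>If |\<eta>| \<le> 2 |\<zeta>|, the new factor in \<open>\<eta>\<close> is at least exp
  (-1/4); otherwise |\<eta> - \<zeta>| \<ge> |\<eta>| / 2, and half of the original exponent pays
  for it. The new factor confines \<open>\<eta>\<close> to a ball of radius comparable to
  \<open>norm \<zeta>\<close>, as the energy estimate requires.\<close>

lemma gauss_one_split:
  fixes \<eta> \<zeta> :: "'a::euclidean_space"
  assumes "norm \<zeta> \<ge> 1"
  shows "gauss 1 (\<eta> - \<zeta>) \<le> exp (1/4) * (exp (- (1 / (8 * (norm \<zeta>)\<^sup>2) * (norm \<eta>)\<^sup>2 / 2)) * exp (- (norm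
    (\<zeta> - \<eta>))\<^sup>2 / 4))"
proof -
  define r where "r = norm \<zeta>"
  define h where "h = norm \<eta>"
  define y where "y = norm (\<zeta> - \<eta>)"
  have r: "r \<ge> 1" "h \<ge> 0" using assms by (auto simp: r_def h_def)
  have hy: "h - r \<le> y" unfolding h_def r_def y_def by (metis norm_minus_commute norm_triangle_ineq2)
  have "h\<^sup>2 / (16 * r\<^sup>2) \<le> 1/4 + y\<^sup>2 / 4"
  proof (cases "h \<le> 2 * r")
    case True
    then have "h\<^sup>2 \<le> (2 * r)\<^sup>2" using r by (intro power_mono) auto
    then have "h\<^sup>2 / (16 * r\<^sup>2) \<le> 1/4" using r by (simp add: field_simps power_mult_distrib)
    then show ?thesis by (simp add: add_increasing2)
  next
    case False
    then have "h / 2 \<le> y" using hy by simp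
    then have "(h / 2)\<^sup>2 \<le> y\<^sup>2" using r by (intro power_mono) auto
    moreover have "1 \<le> r\<^sup>2" using r by (simp add: one_le_power)
    then have "h\<^sup>2 / (16 * r\<^sup>2) \<le> h\<^sup>2 / 16" by (intro divide_left_mono) auto
    ultimately show ?thesis by (simp add: power_divide)
  qed
  then have "- (y\<^sup>2 / 2) \<le> 1/4 + - (h\<^sup>2 / (16 * r\<^sup>2)) + - (y\<^sup>2 / 4)" by simp
  then have "exp (- (y\<^sup>2 / 2)) \<le> exp (1/4 + - (h\<^sup>2 / (16 * r\<^sup>2)) + - (y\<^sup>2 / 4))" by simp
  also have "\<dots> = exp (1/4) * (exp (- (h\<^sup>2 / (16 * r\<^sup>2))) * exp (- (y\<^sup>2 / 4)))"
    by (simp only: exp_add mult.assoc)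
  finally have 1: "exp (- (y\<^sup>2 / 2)) \<le> exp (1/4) * (exp (- (h\<^sup>2 / (16 * r\<^sup>2))) * exp (- (y\<^sup>2 / 4)))" .
  have "1 \<le> (2 * pi * 1) powr (DIM('a) / 2)"
    using pi_gt3 by (intro ge_one_powr_ge_zero) auto
  then have "gauss 1 (\<eta> - \<zeta>) \<le> exp (- (y\<^sup>2 / 2)) / 1"
    unfolding gauss_def y_def by (intro frac_le) (auto simp: norm_minus_commute)
  then show ?thesis using 1 by (simp add: r_def h_def y_def)
qed

text \<open>The spectrum at \<open>reflect w \<zeta>\<close> lies below a Gaussian average of the
  tilted spectrum. After exchanging integrals, averaging over \<open>w\<close> gains
  \<open>norm \<zeta> powr (\<kappa> - 1)\<close> uniformly in \<open>\<eta>\<close>, and what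
  remains is the energy in a ball of radius about \<open>norm \<zeta>\<close>, which costs the power
  \<open>DIM('a) - s\<close>. The exponential accounts for frequencies beyond 2^n.\<close>

lemma spherical_average:
  fixes c0 :: "'a::euclidean_space" and C s \<kappa> :: real
  assumes dim: "DIM('a) \<ge> 2" and c0: "norm c0 = 2" and \<kappa>: "\<kappa> > 0" and C: "C \<ge> 0" and s: "s > 0"
  obtains C' where "C' > 0"
    "\<And>n (A::'a set) m \<zeta>. frostman C s n A m \<Longrightarrow> norm \<zeta> \<ge> 1 \<Longrightarrow>
       (\<integral>\<^sup>+w. indicator (cball c0 1) w * ennreal (spectrum A m (\<lambda>a. a) (reflect w \<zeta>)) \<partial>lborel)
       \<le> ennreal (C' * norm \<zeta> powr (\<kappa> - 1 + (DIM('a) - s)) * exp ((1/4)^n * (norm \<zeta>)\<^sup>2 / 2))"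
proof -
  obtain C1 where C1: "C1 > 0" "\<And>\<zeta> \<eta>. norm \<zeta> \<ge> 1 \<Longrightarrow>
    (\<integral>\<^sup>+w. indicator (cball c0 1) w * ennreal (exp (- (norm (reflect w \<zeta> - \<eta>))\<^sup>2 / 4)) \<partial>lborel)
      \<le> ennreal (C1 * norm \<zeta> powr (\<kappa> - 1))"
    using nn_integral_reflect_gauss[OF dim c0 \<kappa>] by blast
  obtain C2 where C2: "C2 > 0"
    "\<And>n (A::'a set) m \<tau>. frostman C s n A m \<Longrightarrow> \<tau> > 0 \<Longrightarrow>
       (\<integral>\<^sup>+\<xi>. ennreal (spectrum A m (\<lambda>a. a) \<xi> * exp (- (\<tau> * (norm \<xi>)\<^sup>2 / 2))) \<partial>lborel)
       \<le> ennreal (C2 * \<tau> powr (- (DIM('a) - s) / 2) * max 1 (((1/4)^n / \<tau>) powr (s / 2)))"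
    using frostman_spectrum_energy[OF C less_imp_le[OF s]] by blast
  define \<delta> where "\<delta> = DIM('a) - s"
  define K where "K = max 1 ((s / 2 / (1/16)) powr (s / 2))"
  have K: "K \<ge> 1" by (simp add: K_def)
  define C' where "C' = exp (1/4) * C1 * (exp (C\<^sup>2) * (C2 * 8 powr (\<delta> / 2) * K))"
  have "C' > 0" using C1 C2 K by (simp add: C'_def)
  moreover have "(\<integral>\<^sup>+w. indicator (cball c0 1) w * ennreal (spectrum A m (\<lambda>a. a) (reflect w \<zeta>)) \<partial>lborel)
       \<le> ennreal (C' * norm \<zeta> powr (\<kappa> - 1 + (DIM('a) - s)) * exp ((1/4)^n * (norm \<zeta>)\<^sup>2 / 2))"
    if fr: "frostman C s n A m" and \<zeta>: "norm \<zeta> \<ge> 1" for n and A :: "'a set" and m \<zeta>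
  proof -
    have [measurable]: "cball c0 r \<in> sets borel" for r by simp
    define \<rho> where "\<rho> = norm \<zeta>"
    have \<rho>: "\<rho> \<ge> 1" using \<zeta> by (simp add: \<rho>_def)
    \<comment> \<open>The damping left by \<open>gauss_one_split\<close>. With it
      \<open>(1/4)^n / \<tau> / 16 = (1/4)^n * \<rho>^2 / 2\<close>, which explains the rate 1/16 in
      \<open>K\<close>.\<close>
    define \<tau> where "\<tau> = 1 / (8 * \<rho>\<^sup>2)"
    have \<tau>: "\<tau> > 0" using \<rho> by (simp add: \<tau>_def)
    let ?S = "spectrum A (\<lambda>a. m a * exp ((norm a)\<^sup>2 / 2)) (\<lambda>a. a)"
    let ?D = "indicator (cball c0 1) :: 'a \<Rightarrow> ennreal"
    have "(\<integral>\<^sup>+w. ?D w * ennreal (spectrum A m (\<lambda>a. a) (reflect w \<zeta>)) \<partial>lborel)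
       \<le> (\<integral>\<^sup>+w. ?D w * (\<integral>\<^sup>+\<eta>. ennreal (?S \<eta>) * ennreal (gauss 1 (\<eta> - reflect w \<zeta>)) \<partial>lborel) \<partial>lborel)"
      by (intro nn_integral_mono mult_left_mono spectrum_le_gauss_average) auto
    also have "\<dots> = (\<integral>\<^sup>+w. (\<integral>\<^sup>+\<eta>. ?D w * (ennreal (?S \<eta>) * ennreal (gauss 1 (\<eta> - reflect w \<zeta>))) \<partial>lborel)
      \<partial>lborel)"
      by (intro nn_integral_cong nn_integral_cmult[symmetric]) measurable
    also have "\<dots> \<le> (\<integral>\<^sup>+w. (\<integral>\<^sup>+\<eta>. ennreal (exp (1/4)) * ennreal (?S \<eta> * exp (- (\<tau> * (norm \<eta>)\<^sup>2 / 2))) *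
         (?D w * ennreal (exp (- (norm (reflect w \<zeta> - \<eta>))\<^sup>2 / 4))) \<partial>lborel) \<partial>lborel)"
    proof (intro nn_integral_mono)
      fix w \<eta> :: 'a
      have "gauss 1 (\<eta> - reflect w \<zeta>) \<le> exp (1/4) * (exp (- (\<tau> * (norm \<eta>)\<^sup>2 / 2)) * exp (- (norm
        (reflect w \<zeta> - \<eta>))\<^sup>2 / 4))"
        using gauss_one_split[of "reflect w \<zeta>" \<eta>] \<zeta> by (simp add: \<tau>_def \<rho>_def)
      then have "?S \<eta> * gauss 1 (\<eta> - reflect w \<zeta>) \<le> ?S \<eta> * (exp (1/4) * (exp (- (\<tau> * (norm \<eta>)\<^sup>2 / 2)) * exp
        (- (norm (reflect w \<zeta> - \<eta>))\<^sup>2 / 4)))"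
        by (intro mult_left_mono) auto
      also have "\<dots> = exp (1/4) * (?S \<eta> * exp (- (\<tau> * (norm \<eta>)\<^sup>2 / 2))) * exp (- (norm (reflect w \<zeta> - \<eta>))\<^sup>2 / 4)"
        by (simp only: mult_ac)
      finally have "ennreal (?S \<eta> * gauss 1 (\<eta> - reflect w \<zeta>)) \<le>
         ennreal (exp (1/4) * (?S \<eta> * exp (- (\<tau> * (norm \<eta>)\<^sup>2 / 2))) * exp (- (norm (reflect w \<zeta> - \<eta>))\<^sup>2 / 4))"
        by (rule ennreal_leI)
      then show "?D w * (ennreal (?S \<eta>) * ennreal (gauss 1 (\<eta> - reflect w \<zeta>))) \<le>
         ennreal (exp (1/4)) * ennreal (?S \<eta> * exp (- (\<tau> * (norm \<eta>)\<^sup>2 / 2))) *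
         (?D w * ennreal (exp (- (norm (reflect w \<zeta> - \<eta>))\<^sup>2 / 4)))"
        by (auto simp: ennreal_mult split: split_indicator)
    qed
    also have "\<dots> = (\<integral>\<^sup>+\<eta>. (\<integral>\<^sup>+w. ennreal (exp (1/4)) * ennreal (?S \<eta> * exp (- (\<tau> * (norm \<eta>)\<^sup>2 / 2))) *
         (?D w * ennreal (exp (- (norm (reflect w \<zeta> - \<eta>))\<^sup>2 / 4))) \<partial>lborel) \<partial>lborel)"
      by (rule lborel_pair.Fubini') measurable
    also have "\<dots> = (\<integral>\<^sup>+\<eta>. ennreal (exp (1/4)) * ennreal (?S \<eta> * exp (- (\<tau> * (norm \<eta>)\<^sup>2 / 2))) *
         (\<integral>\<^sup>+w. ?D w * ennreal (exp (- (norm (reflect w \<zeta> - \<eta>))\<^sup>2 / 4)) \<partial>lborel) \<partial>lborel)"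
      by (intro nn_integral_cong nn_integral_cmult) measurable
    also have "\<dots> \<le> (\<integral>\<^sup>+\<eta>. ennreal (exp (1/4)) * ennreal (?S \<eta> * exp (- (\<tau> * (norm \<eta>)\<^sup>2 / 2))) * ennreal (C1
      * \<rho> powr (\<kappa> - 1)) \<partial>lborel)"
      unfolding \<rho>_def by (intro nn_integral_mono mult_left_mono C1 \<zeta>) auto
    also have "\<dots> = (\<integral>\<^sup>+\<eta>. ennreal (exp (1/4)) * ennreal (C1 * \<rho> powr (\<kappa> - 1)) * ennreal (?S \<eta> * exp (- (\<tau> *
      (norm \<eta>)\<^sup>2 / 2))) \<partial>lborel)"
      by (simp only: mult_ac)
    also have "\<dots> = ennreal (exp (1/4)) * ennreal (C1 * \<rho> powr (\<kappa> - 1)) * (\<integral>\<^sup>+\<eta>. ennreal (?S \<eta> * exp (- (\<tau> *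
      (norm \<eta>)\<^sup>2 / 2))) \<partial>lborel)"
      by (intro nn_integral_cmult) measurable
    also have "\<dots> \<le> ennreal (exp (1/4)) * ennreal (C1 * \<rho> powr (\<kappa> - 1)) *
       (ennreal (exp (C\<^sup>2)) * ennreal (C2 * \<tau> powr (- \<delta> / 2) * max 1 (((1/4)^n / \<tau>) powr (s / 2))))"
      unfolding \<delta>_def by
        (intro mult_left_mono order_trans[OF spectrum_energy_tilt[OF fr \<tau>]] C2(2)[OF fr \<tau>]) auto
    also have "\<dots> = ennreal (exp (1/4) * (C1 * \<rho> powr (\<kappa> - 1)) * (exp (C\<^sup>2) * (C2 * \<tau> powr (- \<delta> / 2) * max 1
      (((1/4)^n / \<tau>) powr (s / 2)))))"
      using C1(1) C2(1) by (simp add: ennreal_mult)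
    also have "\<dots> \<le> ennreal (exp (1/4) * (C1 * \<rho> powr (\<kappa> - 1)) * (exp (C\<^sup>2) * (C2 * (8 powr (\<delta> / 2)
      * \<rho> powr \<delta>) * (K * exp ((1/4)^n * \<rho>\<^sup>2 / 2)))))"
    proof (intro ennreal_leI mult_left_mono mult_mono)
      have "\<tau> powr (- \<delta> / 2) = (8 * \<rho>\<^sup>2) powr (\<delta> / 2)"
      proof -
        have "(1 / X) powr (- \<delta> / 2) = X powr (\<delta> / 2)" if "X > 0" for X :: real
          using that by (simp add: powr_def ln_div)
        moreover have "8 * \<rho>\<^sup>2 > 0" using \<rho> by simp
        ultimately show ?thesis by (simp only: \<tau>_def)
      qed
      also have "\<dots> = 8 powr (\<delta> / 2) * \<rho> powr \<delta>"
        using \<rho> by (simp add: powr_mult powr_powr flip: powr_numeral)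
      finally show "\<tau> powr (- \<delta> / 2) \<le> 8 powr (\<delta> / 2) * \<rho> powr \<delta>" by simp
      define y where "y = (1/4)^n / \<tau>"
      have y: "y \<ge> 0" "y / 16 = (1/4)^n * \<rho>\<^sup>2 / 2" using \<tau> by (auto simp: y_def \<tau>_def)
      have "y powr (s / 2) \<le> (s / 2 / (1/16)) powr (s / 2) * exp (1/16 * y)"
        using s y by (intro powr_le_exp) auto
      also have "\<dots> \<le> K * exp (y / 16)" by (auto simp: K_def)
      finally have 1: "y powr (s / 2) \<le> K * exp (y / 16)" .
      have "1 * 1 \<le> K * exp (y / 16)" using K y by (intro mult_mono) auto
      then have "max 1 (y powr (s / 2)) \<le> K * exp (y / 16)" using 1 by simp
      then show "max 1 (((1/4)^n / \<tau>) powr (s / 2)) \<le> K * exp ((1/4)^n * \<rho>\<^sup>2 / 2)"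
        unfolding y(2) by (simp add: y_def)
    qed (use C1 C2 in auto)
    also have "exp (1/4) * (C1 * \<rho> powr (\<kappa> - 1)) * (exp (C\<^sup>2) * (C2 * (8 powr (\<delta> / 2) * \<rho> powr \<delta>) * (K * exp
      ((1/4)^n * \<rho>\<^sup>2 / 2))))
       = C' * (\<rho> powr (\<kappa> - 1) * \<rho> powr \<delta>) * exp ((1/4)^n * \<rho>\<^sup>2 / 2)"
      by (simp only: C'_def mult_ac)
    also have "\<rho> powr (\<kappa> - 1) * \<rho> powr \<delta> = \<rho> powr (\<kappa> - 1 + (DIM('a) - s))"
      by (simp add: powr_add \<delta>_def)
    finally show ?thesis by (simp add: \<rho>_def)
  qed
  ultimately show ?thesis by (rule that)
qed

section \<open>Averaging over reflections\<close>

text \<open>Plancherel's identity without Fourier inversion: once the squares are expanded, both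
  sides become the same finite combination of \<open>gauss\<close> at the differences
  \<open>P i - P j\<close>.\<close>

lemma nn_integral_gauss_mixture_diff:
  fixes P :: "'i \<Rightarrow> 'a::euclidean_space"
  assumes t: "t > 0" and u: "u > 0"
  shows "(\<integral>\<^sup>+x. ennreal (((\<Sum>i\<in>I. M i * gauss t (x - P i)) - (\<Sum>i\<in>I. M i * gauss u (x - P i)))\<^sup>2) \<partial>lborel) =
    ennreal (1 / (2 * pi) ^ DIM('a)) *
    (\<integral>\<^sup>+\<xi>. ennreal ((exp (- (t * (norm \<xi>)\<^sup>2 / 2)) - exp (- (u * (norm \<xi>)\<^sup>2 / 2)))\<^sup>2 * spectrum I M P \<xi>)
      \<partial>lborel)"
proof -
  define G where "G i j = gauss (t + t) (P i - P j) - gauss (t + u) (P i - P j) - gauss (u + t) (P i - P j)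
    + gauss (u + u) (P i - P j)" for i j
  define c where "c = (2 * pi) ^ DIM('a)"
  have c: "c > 0" by (simp add: c_def)
  define S where "S = (\<Sum>i\<in>I. \<Sum>j\<in>I. M i * M j * G i j)"
  have "has_bochner_integral lborel (\<lambda>x. \<Sum>i\<in>I. \<Sum>j\<in>I. M i * M j *
     (gauss t (x - P i) * gauss t (x - P j) - gauss t (x - P i) * gauss u (x - P j)
       - gauss u (x - P i) * gauss t (x - P j) + gauss u (x - P i) * gauss u (x - P j))) S"
    unfolding S_def G_def
    by (intro has_bochner_integral_sum has_bochner_integral_mult_right has_bochner_integral_add
        has_bochner_integral_diff has_bochner_integral_gauss_mult t u)
  also have "(\<lambda>x. \<Sum>i\<in>I. \<Sum>j\<in>I. M i * M j *
     (gauss t (x - P i) * gauss t (x - P j) - gauss t (x - P i) * gauss u (x - P j)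
       - gauss u (x - P i) * gauss t (x - P j) + gauss u (x - P i) * gauss u (x - P j))) =
     (\<lambda>x. ((\<Sum>i\<in>I. M i * gauss t (x - P i)) - (\<Sum>i\<in>I. M i * gauss u (x - P i)))\<^sup>2)"
    unfolding sum_subtractf[symmetric] power2_eq_square sum_product
    by (intro ext sum.cong refl) (simp add: algebra_simps)
  finally have 1: "(\<integral>\<^sup>+x. ennreal (((\<Sum>i\<in>I. M i * gauss t (x - P i)) - (\<Sum>i\<in>I. M i * gauss u (x - P i)))\<^sup>2)
    \<partial>lborel) = ennreal S"
    by (auto simp: has_bochner_integral_iff nn_integral_eq_integral)
  define e where "e r \<xi> = exp (- (r * (norm \<xi>)\<^sup>2 / 2))" for r and \<xi> :: 'a
  have ee: "e (r + q) \<xi> = e r \<xi> * e q \<xi>" for r q \<xi>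
    unfolding e_def exp_add[symmetric] by (simp add: field_simps)
  have "has_bochner_integral lborel (\<lambda>\<xi>. \<Sum>i\<in>I. \<Sum>j\<in>I. M i * M j *
     (cos (\<xi> \<bullet> (P i - P j)) * e (t + t) \<xi> - cos (\<xi> \<bullet> (P i - P j)) * e (t + u) \<xi>
      - cos (\<xi> \<bullet> (P i - P j)) * e (u + t) \<xi> + cos (\<xi> \<bullet> (P i - P j)) * e (u + u) \<xi>))
     (\<Sum>i\<in>I. \<Sum>j\<in>I. M i * M j * (c * gauss (t + t) (P i - P j) - c * gauss (t + u) (P i - P j) - c * gauss (u
       + t) (P i - P j) + c * gauss (u + u) (P i - P j)))"
    unfolding c_def e_def using t u
    by (intro has_bochner_integral_sum has_bochner_integral_mult_right has_bochner_integral_add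
        has_bochner_integral_diff has_bochner_integral_gauss_cos) auto
  also have "(\<Sum>i\<in>I. \<Sum>j\<in>I. M i * M j * (c * gauss (t + t) (P i - P j) - c * gauss (t + u) (P i - P j) - c
    * gauss (u + t) (P i - P j) + c * gauss (u + u) (P i - P j))) = c * S"
    unfolding S_def G_def sum_distrib_left by (intro sum.cong refl) (simp add: algebra_simps)
  also have "(\<lambda>\<xi>. \<Sum>i\<in>I. \<Sum>j\<in>I. M i * M j *
     (cos (\<xi> \<bullet> (P i - P j)) * e (t + t) \<xi> - cos (\<xi> \<bullet> (P i - P j)) * e (t + u) \<xi>
      - cos (\<xi> \<bullet> (P i - P j)) * e (u + t) \<xi> + cos (\<xi> \<bullet> (P i - P j)) * e (u + u) \<xi>)) =
     (\<lambda>\<xi>. (e t \<xi> - e u \<xi>)\<^sup>2 * spectrum I M P \<xi>)"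
    unfolding ee spectrum_double_sum sum_distrib_left
    by (intro ext sum.cong refl) (simp add: algebra_simps power2_eq_square)
  finally have "(\<integral>\<^sup>+\<xi>. ennreal ((e t \<xi> - e u \<xi>)\<^sup>2 * spectrum I M P \<xi>) \<partial>lborel) = ennreal (c * S)"
    by (auto simp: has_bochner_integral_iff nn_integral_eq_integral)
  then have "ennreal (1 / c) * (\<integral>\<^sup>+\<xi>. ennreal ((e t \<xi> - e u \<xi>)\<^sup>2 * spectrum I M P \<xi>) \<partial>lborel) = ennreal (1
    / c) * ennreal (c * S)"
    by (simp only:)
  also have "\<dots> = ennreal ((1 / c) * (c * S))"
    using c by (intro ennreal_mult'[symmetric]) simp
  also have "(1 / c) * (c * S) = S" using c by simp
  finally show ?thesis using 1 unfolding e_def c_def by simp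
qed

text \<open>The law of the difference is a convolution, so its transform is a product. Reflections
  are self-adjoint, hence the two are applied to the frequency in the opposite order; the
  conjugation caused by the minus sign disappears in the modulus.\<close>

lemma spectrum_reflected_pairs:
  fixes A :: "'a::euclidean_space set"
  shows "spectrum (A \<times> A) (\<lambda>(a, b). m a * m b) (\<lambda>(a, b). b - reflect w' (reflect w a)) \<xi> =
    spectrum A m (\<lambda>a. a) \<xi> * spectrum A m (\<lambda>a. a) (reflect w (reflect w' \<xi>))"
proof -
  have "(\<Sum>(a, b)\<in>A \<times> A. (m a * m b) *\<^sub>R cis (\<xi> \<bullet> (b - reflect w' (reflect w a)))) =
     (\<Sum>a\<in>A. m a *\<^sub>R cis (- (reflect w (reflect w' \<xi>) \<bullet> a))) * (\<Sum>b\<in>A. m b *\<^sub>R cis (\<xi> \<bullet> b))"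
    unfolding sum.cartesian_product[symmetric] sum_product
    by (intro sum.cong refl)
       (simp add: inner_diff_right inner_reflect_left cis_mult)
  also have "(\<Sum>a\<in>A. m a *\<^sub>R cis (- (reflect w (reflect w' \<xi>) \<bullet> a))) = cnj (\<Sum>a\<in>A. m a *\<^sub>R cis (reflect w
    (reflect w' \<xi>) \<bullet> a))"
    by (simp add: cis_cnj)
  finally show ?thesis
    unfolding spectrum_def case_prod_unfold
    by (simp only: norm_mult complex_mod_cnj power_mult_distrib mult.commute)
qed

text \<open>Energies are available only with Gaussian damping, so the power weight is spread over
  dyadic scales. For 2^j \<le> \<rho> < 2^(j + 1) the Gaussian in the \<open>j\<close>-th term is at
  least exp (-2); beyond 2^n the last term carries the given Gaussian itself.\<close>

lemma powr_neg_le_gauss_sum: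
  fixes \<rho> \<beta> :: real
  assumes \<rho>: "\<rho> \<ge> 1" and \<beta>: "\<beta> \<ge> 0"
  shows "exp (- ((1/4)^n * \<rho>\<^sup>2 / 2)) * \<rho> powr (- \<beta>) \<le> exp 2 * (\<Sum>j\<le>n. (2 ^ j) powr (- \<beta>) * exp (- ((1/4)^j
    * \<rho>\<^sup>2 / 2)))"
proof -
  let ?T = "\<lambda>j. (2 ^ j) powr (- \<beta>) * exp (- ((1/4)^j * \<rho>\<^sup>2 / 2))"
  have dec: "\<rho> powr (- \<beta>) \<le> (2 ^ j) powr (- \<beta>)" if "2 ^ j \<le> \<rho>" for j :: nat
    using that \<beta> by (intro powr_mono2') auto
  have "\<exists>j\<le>n. exp (- ((1/4)^n * \<rho>\<^sup>2 / 2)) * \<rho> powr (- \<beta>) \<le> exp 2 * ?T j"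
  proof (cases "2 ^ n \<le> \<rho>")
    case True
    have "exp (- ((1/4)^n * \<rho>\<^sup>2 / 2)) * \<rho> powr (- \<beta>) \<le> 1 * ?T n"
      using dec[OF True] by (simp add: mult.commute mult_right_mono)
    also have "\<dots> \<le> exp 2 * ?T n" by (intro mult_right_mono) auto
    finally show ?thesis by blast
  next
    case False
    define J where "J = {j. j \<le> n \<and> 2 ^ j \<le> \<rho>}"
    have J: "finite J" "0 \<in> J" using \<rho> by (auto simp: J_def)
    define j where "j = Max J"
    have "J \<noteq> {}" using J(2) by blast
    then have j: "j \<in> J" using Max_in[OF J(1)] by (simp add: j_def)
    then have "j < n" using False by (auto simp: J_def le_less)
    moreover have "Suc j \<notin> J"
    proof
      assume "Suc j \<in> J"
      from Max_ge[OF J(1) this] show False by (simp add: j_def)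
    qed
    ultimately have up: "\<rho> < 2 * 2 ^ j" by (auto simp: J_def)
    then have "\<rho>\<^sup>2 \<le> (2 * 2 ^ j)\<^sup>2" using \<rho> by (intro power_mono) auto
    also have "\<dots> = 4 * 4 ^ j" by (simp add: power_mult_distrib power2_eq_square flip: power_mult_distrib)
    finally have "(1/4)^j * \<rho>\<^sup>2 / 2 \<le> 2" by (simp add: power_one_over field_simps)
    then have "1 \<le> exp 2 * exp (- ((1/4)^j * \<rho>\<^sup>2 / 2))" by (simp flip: exp_add)
    then have "exp (- ((1/4)^n * \<rho>\<^sup>2 / 2)) \<le> exp 2 * exp (- ((1/4)^j * \<rho>\<^sup>2 / 2))"
      by (rule order_trans[rotated]) simp
    moreover have "\<rho> powr (- \<beta>) \<le> (2 ^ j) powr (- \<beta>)" using j by (intro dec) (auto simp: J_def)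
    ultimately have "exp (- ((1/4)^n * \<rho>\<^sup>2 / 2)) * \<rho> powr (- \<beta>) \<le> (exp 2 * exp (- ((1/4)^j * \<rho>\<^sup>2 / 2))) *
      (2 ^ j) powr (- \<beta>)"
      by (intro mult_mono) auto
    then show ?thesis using \<open>j < n\<close> by (intro exI[of _ j]) (simp add: mult_ac)
  qed
  then obtain j where j: "j \<le> n" "exp (- ((1/4)^n * \<rho>\<^sup>2 / 2)) * \<rho> powr (- \<beta>) \<le> exp 2 * ?T j" by blast
  have "?T j \<le> (\<Sum>j\<le>n. ?T j)" using j by (intro member_le_sum) auto
  then have "exp 2 * ?T j \<le> exp 2 * (\<Sum>j\<le>n. ?T j)" by (intro mult_left_mono) auto
  then show ?thesis using j by linarith
qed

text \<open>The difference factors as \<open>E * d\<close> with \<open>d\<close> between 0 and the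
  minimum of 1 and \<open>u * \<rho>^2\<close>; the exponent \<open>q\<close> interpolates between
  the two resulting bounds on the square of \<open>d\<close>. The power of \<open>u\<close> is the
  gain that makes fine scales small.\<close>

lemma gauss_window_le:
  fixes \<rho> t u q :: real
  assumes t: "0 < t" "t \<le> u" and \<rho>: "0 \<le> \<rho>" and q: "0 \<le> q" "q \<le> 2"
  shows "(exp (- (t * \<rho>\<^sup>2 / 2)) - exp (- (u * \<rho>\<^sup>2 / 2)))\<^sup>2 \<le> exp (- (t * \<rho>\<^sup>2)) * (u * \<rho>\<^sup>2) powr q"
proof (cases "\<rho> = 0")
  case True
  then show ?thesis by simp
next
  case False
  define x where "x = u * \<rho>\<^sup>2"
  have x: "x > 0" using False t by (simp add: x_def)
  define E where "E = exp (- (t * \<rho>\<^sup>2 / 2))"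
  define d where "d = 1 - exp (- ((u - t) * \<rho>\<^sup>2 / 2))"
  have eq: "exp (- (t * \<rho>\<^sup>2 / 2)) - exp (- (u * \<rho>\<^sup>2 / 2)) = E * d"
    unfolding E_def d_def right_diff_distrib exp_add[symmetric] by (simp add: field_simps)
  have d0: "0 \<le> d" using t by (simp add: d_def)
  have d1: "d \<le> 1" by (simp add: d_def)
  have "d \<le> (u - t) * \<rho>\<^sup>2 / 2" using exp_ge_add_one_self[of "- ((u - t) * \<rho>\<^sup>2 / 2)"] by (simp add: d_def)
  also have "\<dots> \<le> x" using t by (simp add: x_def algebra_simps)
  finally have dx: "d \<le> x" .
  have "d\<^sup>2 \<le> x powr q"
  proof (cases "x \<ge> 1")
    case True
    have "d\<^sup>2 \<le> 1" using d0 d1 by (simp add: power_le_one)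
    also have "1 \<le> x powr q" using True q by (simp add: ge_one_powr_ge_zero)
    finally show ?thesis .
  next
    case False
    have "d\<^sup>2 \<le> x\<^sup>2" using d0 dx by (intro power_mono) auto
    also have "x\<^sup>2 = x powr 2" using x by simp
    also have "\<dots> \<le> x powr q" using x False q by (intro powr_mono') auto
    finally show ?thesis .
  qed
  then have "E\<^sup>2 * d\<^sup>2 \<le> E\<^sup>2 * x powr q" by (intro mult_left_mono) auto
  moreover have "E\<^sup>2 = exp (- (t * \<rho>\<^sup>2))" by (simp add: E_def power2_eq_square flip: exp_add)
  ultimately show ?thesis unfolding eq power_mult_distrib x_def by simp
qed

text \<open>The density of \<open>b - reflect w' (reflect w a)\<close> for \<open>(a, b)\<close> distributed by \<open>m \<times> m\<close>, smoothed by a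
  Gaussian of variance \<open>t\<close>.\<close>

definition mixture :: "real \<Rightarrow> 'a::euclidean_space set \<Rightarrow> ('a \<Rightarrow> real) \<Rightarrow> 'a \<Rightarrow> 'a \<Rightarrow> 'a \<Rightarrow> real" where
  "mixture t A m w' w x =
     (\<Sum>i\<in>A \<times> A. (case i of (a, b) \<Rightarrow> m a * m b) * gauss t (x - (case i of (a, b) \<Rightarrow> b - reflect w'
       (reflect w a))))"

lemma mixture_nonneg: "(\<And>a. 0 \<le> m a) \<Longrightarrow> 0 \<le> mixture t A m w' w x"
  unfolding mixture_def by (intro sum_nonneg) (auto split: prod.splits)

lemma mixture_eq: "mixture t A m w' w x = (\<Sum>a\<in>A. m a * (\<Sum>b\<in>A. m b * gauss t ((x + reflect w'
  (reflect w a)) - b)))"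
  unfolding mixture_def sum_distrib_left sum.cartesian_product
  by (intro sum.cong refl) (auto simp: algebra_simps)

lemma borel_measurable_mixture [measurable (raw)]:
  fixes f g h :: "'b \<Rightarrow> 'a::euclidean_space"
  assumes [measurable]: "f \<in> borel_measurable M" "g \<in> borel_measurable M" "h \<in> borel_measurable M"
  shows "(\<lambda>x. mixture t A m (f x) (g x) (h x)) \<in> borel_measurable M"
  unfolding mixture_eq by measurable

text \<open>Plancherel gives a frequency integral of a window times two spectra. Averaging over
  \<open>w\<close> bounds the reflected spectrum by the power \<open>\<kappa> - 1 + \<delta>\<close>
  of the frequency, the window beats the exponential that comes with it, and the other spectrum is
  integrated over dyadic scales. The choice of \<open>q\<close> leaves a geometric series with ratio
  2^(-\<kappa>).\<close>

lemma averaged_L2_difference: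
  fixes c0 :: "'a::euclidean_space" and C s \<kappa> :: real
  assumes dim: "DIM('a) \<ge> 2" and c0: "norm c0 = 2" and \<kappa>: "\<kappa> > 0" and C: "C \<ge> 0" and s: "s > 0"
    and \<delta>: "\<delta> = DIM('a) - s" "\<delta> \<ge> 0" and q: "q = (1 - 2 * \<kappa> - 2 * \<delta>) / 2" "q \<ge> 0"
  obtains C' where "C' > 0"
    "\<And>n l (A::'a set) m w'. frostman C s n A m \<Longrightarrow> l \<le> n \<Longrightarrow>
       (\<integral>\<^sup>+w. indicator (cball c0 1) w *
         (\<integral>\<^sup>+x. ennreal ((mixture ((1/4)^n) A m w' w x - mixture ((1/4)^l) A m w' w x)\<^sup>2) \<partial>lborel) \<partial>lborel)
       \<le> ennreal (C' * ((1/4)^l) powr q)"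
proof -
  obtain C1 where C1: "C1 > 0"
    "\<And>n (A::'a set) m \<zeta>. frostman C s n A m \<Longrightarrow> norm \<zeta> \<ge> 1 \<Longrightarrow>
       (\<integral>\<^sup>+w. indicator (cball c0 1) w * ennreal (spectrum A m (\<lambda>a. a) (reflect w \<zeta>)) \<partial>lborel)
       \<le> ennreal (C1 * norm \<zeta> powr (\<kappa> - 1 + (DIM('a) - s)) * exp ((1/4)^n * (norm \<zeta>)\<^sup>2 / 2))"
    using spherical_average[OF dim c0 \<kappa> C s] by blast
  obtain C2 where C2: "C2 > 0"
    "\<And>n (A::'a set) m \<tau>. frostman C s n A m \<Longrightarrow> \<tau> > 0 \<Longrightarrow>
       (\<integral>\<^sup>+\<xi>. ennreal (spectrum A m (\<lambda>a. a) \<xi> * exp (- (\<tau> * (norm \<xi>)\<^sup>2 / 2))) \<partial>lborel)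
       \<le> ennreal (C2 * \<tau> powr (- (DIM('a) - s) / 2) * max 1 (((1/4)^n / \<tau>) powr (s / 2)))"
    using frostman_spectrum_energy[OF C less_imp_le[OF s]] by blast
  have [measurable]: "cball c0 r \<in> sets borel" for r by simp
  \<comment> \<open>The powers add up to
    \<open>2 * q + (\<kappa> - 1 + \<delta>) = - \<beta>\<close>; against the dyadic energy 2^(j
    \<delta>) this leaves 2^(-j \<kappa>).\<close>
  define \<beta> where "\<beta> = \<delta> + \<kappa>"
  define V where "V = measure lborel (cball c0 1)"
  have "emeasure lborel (cball c0 1) < \<infinity>" by (rule emeasure_bounded_finite) simp
  then have V: "emeasure lborel (cball c0 1) = ennreal V" "V \<ge> 0"
    by (auto simp: V_def intro!: emeasure_eq_ennreal_measure)
  \<comment> \<open>The summands serve frequencies of norm at least 1 and below 1,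
    respectively.\<close>
  define C3 where "C3 = C1 * exp 2 + V * C\<^sup>2 * exp (1/2)"
  have C3: "C3 > 0" using C1 V by (simp add: C3_def add_pos_nonneg)
  define G where "G = 1 / (1 - 2 powr (- \<kappa>))"
  have G: "G > 0" using \<kappa> by (simp add: G_def powr_less_one)
  define Kd where "Kd = 1 / (2 * pi) ^ DIM('a)"
  have Kd: "Kd > 0" by (simp add: Kd_def)
  define C' where "C' = Kd * (C3 * (C2 * G))"
  have "C' > 0" using C3 C2 G Kd by (simp add: C'_def)
  moreover have "(\<integral>\<^sup>+w. indicator (cball c0 1) w *
         (\<integral>\<^sup>+x. ennreal ((mixture ((1/4)^n) A m w' w x - mixture ((1/4)^l) A m w' w x)\<^sup>2) \<partial>lborel) \<partial>lborel)
       \<le> ennreal (C' * ((1/4)^l) powr q)"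
    if fr: "frostman C s n A m" and ln: "l \<le> n" for n l and A :: "'a set" and m w'
  proof -
    have m: "\<And>a. 0 \<le> m a" and mA: "sum m A \<le> C" using fr by (auto simp: frostman_def)
    define t :: real where "t = (1/4)^n"
    define u :: real where "u = (1/4)^l"
    have tu: "0 < t" "t \<le> u" "u > 0" using ln by (auto simp: t_def u_def power_decreasing)
    let ?D = "indicator (cball c0 1) :: 'a \<Rightarrow> ennreal"
    let ?S = "spectrum A m (\<lambda>a. a)"
    let ?A = "\<lambda>\<xi>. \<integral>\<^sup>+w. ?D w * ennreal (?S (reflect w (reflect w' \<xi>))) \<partial>lborel"
    define \<Phi> where "\<Phi> \<xi> = (exp (- (t * (norm \<xi>)\<^sup>2 / 2)) - exp (- (u * (norm \<xi>)\<^sup>2 / 2)))\<^sup>2" for \<xi> :: 'a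
    have [measurable]: "\<Phi> \<in> borel_measurable borel" unfolding \<Phi>_def by measurable
    have \<Phi>0: "0 \<le> \<Phi> \<xi>" for \<xi> by (simp add: \<Phi>_def)
    have \<Phi>_le: "\<Phi> \<xi> \<le> exp (- (t * (norm \<xi>)\<^sup>2)) * (u * (norm \<xi>)\<^sup>2) powr q" for \<xi>
      unfolding \<Phi>_def using tu q \<kappa> \<delta> by (intro gauss_window_le) auto
    define W where "W \<xi> = (\<Sum>j\<le>n. (2 ^ j) powr (- \<beta>) * exp (- ((1/4)^j * (norm \<xi>)\<^sup>2 / 2)))" for \<xi> :: 'a
    have W0: "0 \<le> W \<xi>" for \<xi> unfolding W_def by (intro sum_nonneg) auto
    have main: "ennreal (\<Phi> \<xi>) * ?A \<xi>
       \<le> ennreal (C3 * u powr q * W \<xi>)" for \<xi>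
    proof (cases "norm \<xi> \<ge> 1")
      case True
      define \<rho> where "\<rho> = norm \<xi>"
      have \<rho>: "\<rho> \<ge> 1" using True by (simp add: \<rho>_def)
      have "?A \<xi> \<le> ennreal (C1 * \<rho> powr (\<kappa> - 1 + \<delta>) * exp (t * \<rho>\<^sup>2 / 2))"
        using C1(2)[OF fr, of "reflect w' \<xi>"] True by (simp add: \<rho>_def t_def \<delta>)
      then have "ennreal (\<Phi> \<xi>) * ?A \<xi>
        \<le> ennreal (exp (- (t * \<rho>\<^sup>2)) * (u * \<rho>\<^sup>2) powr q) * ennreal (C1 * \<rho> powr (\<kappa> - 1 + \<delta>) * exp (t * \<rho>\<^sup>2
          / 2))"
        unfolding \<rho>_def by (intro mult_mono ennreal_leI \<Phi>_le) auto
      also have "\<dots> = ennreal ((exp (- (t * \<rho>\<^sup>2)) * (u * \<rho>\<^sup>2) powr q) * (C1 * \<rho> powr (\<kappa> - 1 + \<delta>) * exp (t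
        * \<rho>\<^sup>2 / 2)))"
        by (intro ennreal_mult[symmetric]) (use C1 in auto)
      also have "(exp (- (t * \<rho>\<^sup>2)) * (u * \<rho>\<^sup>2) powr q) * (C1 * \<rho> powr (\<kappa> - 1 + \<delta>) * exp (t * \<rho>\<^sup>2 / 2))
        = C1 * u powr q * (exp (- (t * \<rho>\<^sup>2 / 2)) * \<rho> powr (- \<beta>))"
      proof -
        have 1: "exp (- (t * \<rho>\<^sup>2)) * exp (t * \<rho>\<^sup>2 / 2) = exp (- (t * \<rho>\<^sup>2 / 2))"
          by (simp flip: exp_add)
        have "(u * \<rho>\<^sup>2) powr q = u powr q * (\<rho>\<^sup>2) powr q" by (rule powr_mult)
        also have "(\<rho>\<^sup>2) powr q = \<rho> powr (2 * q)"
          using \<rho> by (subst powr_numeral[symmetric]) (auto simp only: powr_powr)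
        finally have 2: "(u * \<rho>\<^sup>2) powr q = u powr q * \<rho> powr (2 * q)" .
        have "2 * q + (\<kappa> - 1 + \<delta>) = - \<beta>" using q by (simp add: \<beta>_def field_simps)
        then have 3: "\<rho> powr (2 * q) * \<rho> powr (\<kappa> - 1 + \<delta>) = \<rho> powr (- \<beta>)" by (simp only: powr_add[symmetric])
        have "(exp (- (t * \<rho>\<^sup>2)) * (u * \<rho>\<^sup>2) powr q) * (C1 * \<rho> powr (\<kappa> - 1 + \<delta>) * exp (t * \<rho>\<^sup>2 / 2))
          = C1 * u powr q * ((exp (- (t * \<rho>\<^sup>2)) * exp (t * \<rho>\<^sup>2 / 2)) * (\<rho> powr (2 * q) * \<rho> powr (\<kappa> - 1 + \<delta>)))"
          unfolding 2 by (simp only: mult_ac)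
        then show ?thesis unfolding 1 3 .
      qed
      also have "ennreal \<dots> \<le> ennreal (C1 * u powr q * (exp 2 * W \<xi>))"
        using powr_neg_le_gauss_sum[OF \<rho>, of \<beta> n] \<delta> \<kappa> C1
        by (intro ennreal_leI mult_left_mono) (auto simp: t_def W_def \<rho>_def \<beta>_def)
      also have "\<dots> \<le> ennreal (C3 * u powr q * W \<xi>)"
      proof (intro ennreal_leI)
        have "(C1 * exp 2) * (u powr q * W \<xi>) \<le> C3 * (u powr q * W \<xi>)"
          using V W0 by (intro mult_right_mono) (auto simp: C3_def)
        then show "C1 * u powr q * (exp 2 * W \<xi>) \<le> C3 * u powr q * W \<xi>" by (simp add: mult_ac)
      qed
      finally show ?thesis .
    next
      case False
      \<comment> \<open>The spherical average is of no use at low frequencies, but there the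
        spectrum is at most \<open>C^2\<close>, and \<open>W\<close> is bounded below by its term
        for \<open>j = 0\<close>.\<close>
      have "?A \<xi> \<le> (\<integral>\<^sup>+w. ?D w * ennreal (C\<^sup>2) \<partial>lborel)"
      proof (intro nn_integral_mono mult_left_mono ennreal_leI)
        fix w
        have "?S (reflect w (reflect w' \<xi>)) \<le> (sum m A)\<^sup>2" using m by (intro spectrum_le) auto
        also have "\<dots> \<le> C\<^sup>2" using mA m by (intro power_mono sum_nonneg) auto
        finally show "?S (reflect w (reflect w' \<xi>)) \<le> C\<^sup>2" .
      qed auto
      also have "\<dots> = ennreal (V * C\<^sup>2)"
        using V by (subst nn_integral_multc) (auto simp: ennreal_mult)
      finally have "ennreal (\<Phi> \<xi>) * ?A \<xi>
         \<le> ennreal (u powr q) * ennreal (V * C\<^sup>2)"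
      proof (intro mult_mono ennreal_leI)
        have n2: "(norm \<xi>)\<^sup>2 \<le> 1" using False by (simp add: power_le_one)
        have "\<Phi> \<xi> \<le> exp (- (t * (norm \<xi>)\<^sup>2)) * (u * (norm \<xi>)\<^sup>2) powr q" by (rule \<Phi>_le)
        also have "\<dots> \<le> 1 * u powr q"
          using tu q n2 by (intro mult_mono powr_mono2) (auto simp: mult_left_le)
        finally show "\<Phi> \<xi> \<le> u powr q" by simp
      qed auto
      also have "\<dots> = ennreal (u powr q * (V * C\<^sup>2))" using V by (simp add: ennreal_mult)
      also have "\<dots> \<le> ennreal (C3 * u powr q * W \<xi>)"
      proof (intro ennreal_leI)
        have "exp (- (1/2)) \<le> exp (- ((1/4)^0 * (norm \<xi>)\<^sup>2 / 2))"
          using False by (simp add: power_le_one)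
        also have "\<dots> = (2 ^ 0) powr (- \<beta>) * exp (- ((1/4)^0 * (norm \<xi>)\<^sup>2 / 2))" by simp
        also have "\<dots> \<le> W \<xi>" unfolding W_def by (rule member_le_sum) auto
        finally have "exp (1/2) * exp (- (1/2)) \<le> exp (1/2) * W \<xi>" by (intro mult_left_mono) auto
        then have "1 \<le> exp (1/2) * W \<xi>" by (simp flip: exp_add)
        then have "u powr q * (V * C\<^sup>2) * 1 \<le> u powr q * (V * C\<^sup>2) * (exp (1/2) * W \<xi>)"
          using V by (intro mult_left_mono) auto
        also have "\<dots> = (V * C\<^sup>2 * exp (1/2)) * (u powr q * W \<xi>)" by (simp only: mult_ac)
        also have "\<dots> \<le> C3 * (u powr q * W \<xi>)"
          using C1 W0 by (intro mult_right_mono) (auto simp: C3_def)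
        finally show "u powr q * (V * C\<^sup>2) \<le> C3 * u powr q * W \<xi>" by (simp add: mult_ac)
      qed
      finally show ?thesis .
    qed
    have "(\<integral>\<^sup>+x. ennreal ((mixture t A m w' w x - mixture u A m w' w x)\<^sup>2) \<partial>lborel)
      = ennreal Kd * (\<integral>\<^sup>+\<xi>. ennreal (\<Phi> \<xi> * (?S \<xi> * ?S (reflect w (reflect w' \<xi>)))) \<partial>lborel)" for w
      unfolding mixture_def nn_integral_gauss_mixture_diff[OF tu(1) tu(3)] Kd_def \<Phi>_def
      using spectrum_reflected_pairs[of A m w' w] by simp
    then have "(\<integral>\<^sup>+w. ?D w * (\<integral>\<^sup>+x. ennreal ((mixture t A m w' w x - mixture u A m w' w x)\<^sup>2) \<partial>lborel) \<partial>lborel)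
      = (\<integral>\<^sup>+w. (\<integral>\<^sup>+\<xi>. ennreal Kd * (ennreal (?S \<xi>) * ennreal (\<Phi> \<xi>) * (?D w * ennreal (?S (reflect w
        (reflect w' \<xi>))))) \<partial>lborel) \<partial>lborel)"
    proof (intro nn_integral_cong)
      fix w
      assume eq: "\<And>w. (\<integral>\<^sup>+x. ennreal ((mixture t A m w' w x - mixture u A m w' w x)\<^sup>2) \<partial>lborel)
        = ennreal Kd * (\<integral>\<^sup>+\<xi>. ennreal (\<Phi> \<xi> * (?S \<xi> * ?S (reflect w (reflect w' \<xi>)))) \<partial>lborel)"
      have "(\<integral>\<^sup>+\<xi>. ennreal Kd * (ennreal (?S \<xi>) * ennreal (\<Phi> \<xi>) * (?D w * ennreal (?S (reflect w
        (reflect w' \<xi>))))) \<partial>lborel)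
        = (\<integral>\<^sup>+\<xi>. (?D w * ennreal Kd) * ennreal (\<Phi> \<xi> * (?S \<xi> * ?S (reflect w (reflect w' \<xi>)))) \<partial>lborel)"
        using \<Phi>0 by (intro nn_integral_cong) (simp add: ennreal_mult mult_ac)
      also have "\<dots> = (?D w * ennreal Kd) * (\<integral>\<^sup>+\<xi>. ennreal (\<Phi> \<xi> * (?S \<xi> * ?S (reflect w (reflect w' \<xi>))))
        \<partial>lborel)"
        by (rule nn_integral_cmult) measurable
      finally show "?D w * (\<integral>\<^sup>+x. ennreal ((mixture t A m w' w x - mixture u A m w' w x)\<^sup>2) \<partial>lborel)
        = (\<integral>\<^sup>+\<xi>. ennreal Kd * (ennreal (?S \<xi>) * ennreal (\<Phi> \<xi>) * (?D w * ennreal (?S (reflect w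
          (reflect w' \<xi>))))) \<partial>lborel)"
        by (simp only: eq mult.assoc)
    qed
    also have "\<dots> = (\<integral>\<^sup>+\<xi>. (\<integral>\<^sup>+w. ennreal Kd * (ennreal (?S \<xi>) * ennreal (\<Phi> \<xi>) * (?D w * ennreal (?S
      (reflect w (reflect w' \<xi>))))) \<partial>lborel) \<partial>lborel)"
      by (rule lborel_pair.Fubini') measurable
    also have "\<dots> = (\<integral>\<^sup>+\<xi>. ennreal Kd * (ennreal (?S \<xi>) * (ennreal (\<Phi> \<xi>) * ?A \<xi>)) \<partial>lborel)"
      by (simp only: mult.assoc[symmetric] nn_integral_cmult[symmetric])
         (intro nn_integral_cong, subst nn_integral_cmult[symmetric], measurable, simp only: mult.assoc)
    also have "\<dots> \<le> (\<integral>\<^sup>+\<xi>. ennreal Kd * (ennreal (?S \<xi>) * ennreal (C3 * u powr q * W \<xi>)) \<partial>lborel)"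
      by (intro nn_integral_mono mult_left_mono main) auto
    also have "\<dots> = (\<integral>\<^sup>+\<xi>. (\<Sum>j\<le>n. ennreal (Kd * (C3 * u powr q * (2 ^ j) powr (- \<beta>))) * ennreal (?S \<xi> * exp
      (- ((1/4)^j * (norm \<xi>)\<^sup>2 / 2)))) \<partial>lborel)"
    proof (intro nn_integral_cong)
      fix \<xi> :: 'a
      have "Kd * (?S \<xi> * (C3 * u powr q * W \<xi>)) =
         (\<Sum>j\<le>n. (Kd * (C3 * u powr q * (2 ^ j) powr (- \<beta>))) * (?S \<xi> * exp (- ((1/4)^j * (norm \<xi>)\<^sup>2 / 2))))"
        unfolding W_def sum_distrib_left by (intro sum.cong refl) (simp only: mult_ac)
      then have "ennreal (Kd * (?S \<xi> * (C3 * u powr q * W \<xi>))) =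
         (\<Sum>j\<le>n. ennreal ((Kd * (C3 * u powr q * (2 ^ j) powr (- \<beta>))) * (?S \<xi> * exp (- ((1/4)^j * (norm \<xi>)\<^sup>2
           / 2)))))"
        using Kd C3 by (subst sum_ennreal) auto
      then show "ennreal Kd * (ennreal (?S \<xi>) * ennreal (C3 * u powr q * W \<xi>)) =
        (\<Sum>j\<le>n. ennreal (Kd * (C3 * u powr q * (2 ^ j) powr (- \<beta>))) * ennreal (?S \<xi> * exp (- ((1/4)^j *
          (norm \<xi>)\<^sup>2 / 2))))"
        using Kd C3 W0 by (simp add: ennreal_mult)
    qed
    also have "\<dots> = (\<Sum>j\<le>n. ennreal (Kd * (C3 * u powr q * (2 ^ j) powr (- \<beta>))) *
        (\<integral>\<^sup>+\<xi>. ennreal (?S \<xi> * exp (- ((1/4)^j * (norm \<xi>)\<^sup>2 / 2))) \<partial>lborel))"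
      by (subst nn_integral_sum) (auto intro!: sum.cong nn_integral_cmult)
    also have "\<dots> \<le> (\<Sum>j\<le>n. ennreal (Kd * (C3 * u powr q * (2 ^ j) powr (- \<beta>))) * ennreal (C2 * (2 ^ j) powr \<delta>))"
    proof (intro sum_mono mult_left_mono)
      fix j assume "j \<in> {..n}"
      then have "(1/4::real)^n \<le> (1/4)^j" by (auto intro: power_decreasing)
      then have "((1/4)^n / (1/4)^j) powr (s / 2) \<le> 1 powr (s / 2)"
        using s by (intro powr_mono2) (auto simp: divide_le_eq)
      then have 1: "max 1 (((1/4)^n / (1/4)^j) powr (s / 2)) = (1::real)" by simp
      have 2: "((1/4)^j) powr (- \<delta> / 2) = (2 ^ j) powr \<delta>"
      proof -
        have "(1/4::real)^j = (2 ^ j) powr (-2)"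
          by (simp add: powr_minus_divide power_one_over power2_eq_square flip: power_mult_distrib)
        then show ?thesis by (simp add: powr_powr)
      qed
      show "(\<integral>\<^sup>+\<xi>. ennreal (?S \<xi> * exp (- ((1/4)^j * (norm \<xi>)\<^sup>2 / 2))) \<partial>lborel) \<le> ennreal (C2 * (2 ^ j) powr \<delta>)"
        using C2(2)[OF fr, of "(1/4)^j"] unfolding 1 \<delta>(1)[symmetric] 2 by simp
    qed auto
    also have "\<dots> = ennreal (\<Sum>j\<le>n. Kd * (C3 * u powr q * (2 ^ j) powr (- \<beta>)) * (C2 * (2 ^ j) powr \<delta>))"
      using Kd C3 C2 by (simp add: ennreal_mult flip: sum_ennreal)
    also have "\<dots> \<le> ennreal (C' * u powr q)"
    proof (intro ennreal_leI)
      have "(\<Sum>j\<le>n. Kd * (C3 * u powr q * (2 ^ j) powr (- \<beta>)) * (C2 * (2 ^ j) powr \<delta>)) =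
        (\<Sum>j\<le>n. Kd * C3 * u powr q * C2 * (2 powr (- \<kappa>)) ^ j)"
      proof (intro sum.cong refl)
        fix j
        have "(2 ^ j) powr (- \<beta>) * (2 ^ j) powr \<delta> = (2 ^ j) powr (- \<kappa>)"
          by (simp add: \<beta>_def flip: powr_add)
        also have "\<dots> = (2 powr (- \<kappa>)) ^ j"
          by (simp add: powr_powr mult.commute flip: powr_realpow)
        finally have "(2 powr (- \<kappa>)) ^ j = (2 ^ j) powr (- \<beta>) * (2 ^ j) powr \<delta>" ..
        then show "Kd * (C3 * u powr q * (2 ^ j) powr (- \<beta>)) * (C2 * (2 ^ j) powr \<delta>) = Kd * C3 * u powr q
          * C2 * (2 powr (- \<kappa>)) ^ j"
          by (simp only: mult_ac)
      qed
      also have "\<dots> = Kd * C3 * u powr q * C2 * (\<Sum>j\<in>{..<Suc n}. (2 powr (- \<kappa>)) ^ j)"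
        unfolding sum_distrib_left lessThan_Suc_atMost ..
      also have "\<dots> \<le> Kd * C3 * u powr q * C2 * G"
        unfolding G_def using Kd C3 C2 \<kappa> by (intro mult_left_mono sum_geometric_powr_le) auto
      also have "\<dots> = C' * u powr q" by (simp add: C'_def)
      finally show "(\<Sum>j\<le>n. Kd * (C3 * u powr q * (2 ^ j) powr (- \<beta>)) * (C2 * (2 ^ j) powr \<delta>)) \<le> C' * u powr q" .
    qed
    finally show ?thesis by (simp add: t_def u_def)
  qed
  ultimately show ?thesis by (rule that)
qed

text \<open>A single smoothed copy of the masses already has density of order t^((s - d)/2) with
  \<open>t = (1/4)^l\<close>; the other copy merely averages this bound and contributes its total
  mass.\<close>

lemma frostman_mixture_le:
  fixes C s :: real
  assumes C: "C \<ge> 0" and s: "s > 0" and \<delta>: "\<delta> = DIM('a::euclidean_space) - s"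
  obtains C' where "C' > 0"
    "\<And>n l (A::'a set) m w' w x. frostman C s n A m \<Longrightarrow> l \<le> n \<Longrightarrow> mixture ((1/4)^l) A m w' w x \<le> C' * 2 powr (\<delta> * l)"
proof -
  obtain C1 where C1: "C1 > 0"
    "\<And>n (A::'a set) m x \<tau>. frostman C s n A m \<Longrightarrow> (1/4)^n \<le> \<tau> \<Longrightarrow>
       (\<Sum>b\<in>A. m b * exp (- ((norm (x - b))\<^sup>2 / (2 * \<tau>)))) \<le> C1 * \<tau> powr (s / 2)"
    using frostman_gaussian_mass[OF C less_imp_le[OF s]] by blast
  define C' where "C' = C1 * C + 1"
  have "C' > 0" using C1 C by (simp add: C'_def add_nonneg_pos)
  moreover have "mixture ((1/4)^l) A m w' w x \<le> C' * 2 powr (\<delta> * l)"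
    if fr: "frostman C s n A m" and ln: "l \<le> n" for n l and A :: "'a set" and m w' w x
  proof -
    have m: "\<And>a. 0 \<le> m a" and mA: "sum m A \<le> C" using fr by (auto simp: frostman_def)
    define t :: real where "t = (1/4)^l"
    have t: "t > 0" "(1/4)^n \<le> t" using ln by (auto simp: t_def power_decreasing)
    have b: "(\<Sum>b\<in>A. m b * gauss t (y - b)) \<le> C1 * 2 powr (\<delta> * l)" for y
    proof -
      have "(\<Sum>b\<in>A. m b * gauss t (y - b)) = (\<Sum>b\<in>A. m b * exp (- ((norm (y - b))\<^sup>2 / (2 * t)))) / (2 * pi
        * t) powr (DIM('a) / 2)"
        by (simp add: gauss_def sum_divide_distrib)
      also have "\<dots> \<le> (C1 * t powr (s / 2)) / t powr (DIM('a) / 2)"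
      proof (intro frac_le C1(2)[OF fr t(2)])
        have "1 * t \<le> (2 * pi) * t" using t pi_gt3 by (intro mult_right_mono) auto
        then show "t powr (DIM('a) / 2) \<le> (2 * pi * t) powr (DIM('a) / 2)"
          using t by (intro powr_mono2) auto
      qed (use C1 t in auto)
      also have "\<dots> = C1 * (t powr (s / 2) / t powr (DIM('a) / 2))" by simp
      also have "t powr (s / 2) / t powr (DIM('a) / 2) = t powr (- \<delta> / 2)"
        by (simp add: \<delta> diff_divide_distrib flip: powr_diff)
      also have "t powr (- \<delta> / 2) = 2 powr (\<delta> * l)"
      proof -
        have "(1/4::real)^l = 2 powr (-2 * real l)"
          by (simp add: powr_minus_divide power_one_over powr_mult_base flip: powr_powr powr_realpow)
        then show ?thesis by (simp add: t_def powr_powr mult.commute)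
      qed
      finally show ?thesis .
    qed
    have "mixture t A m w' w x \<le> (\<Sum>a\<in>A. m a * (C1 * 2 powr (\<delta> * l)))"
      unfolding mixture_eq by (intro sum_mono mult_left_mono b m)
    also have "\<dots> = C1 * 2 powr (\<delta> * l) * sum m A" unfolding sum_distrib_left by (intro sum.cong refl)
      (rule mult.commute)
    also have "\<dots> \<le> C1 * 2 powr (\<delta> * l) * C" using C1 mA by (intro mult_left_mono) auto
    also have "\<dots> \<le> C' * 2 powr (\<delta> * l)" by (simp add: C'_def algebra_simps)
    finally show ?thesis by (simp add: t_def)
  qed
  ultimately show ?thesis by (rule that)
qed

text \<open>If \<open>N\<close> exceeds the bound at scale \<open>l\<close> but not at scale \<open>l + 1\<close>, then \<open>N - f l\<close> is comparable to
  \<open>N\<close>. This trades the \<open>p\<close>-th power for squares of differences.\<close>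

lemma power_le_scale_differences:
  fixes N :: real and f M :: "nat \<Rightarrow> real"
  assumes N: "0 \<le> N" "N \<le> M n" and f: "\<And>l. l < n \<Longrightarrow> f l \<le> M l" and M: "\<And>l. 0 < M l" and p: "p \<ge> 2"
  shows "N ^ p \<le> (2 * M 0) ^ (p - 1) * N + (\<Sum>l<n. 4 * (2 * M (Suc l)) ^ (p - 2) * (N - f l)\<^sup>2)"
proof -
  have pos: "0 \<le> 4 * (2 * M (Suc i)) ^ (p - 2) * (N - f i)\<^sup>2" for i using M[of "Suc i"] by simp
  show ?thesis
  proof (cases "N \<le> 2 * M 0")
    case True
    have "N ^ p = N ^ (p - 1) * N" using p by (simp flip: power_Suc2)
    also have "\<dots> \<le> (2 * M 0) ^ (p - 1) * N" using N True by (intro mult_right_mono power_mono) auto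
    moreover have "0 \<le> (\<Sum>l<n. 4 * (2 * M (Suc l)) ^ (p - 2) * (N - f l)\<^sup>2)"
      using pos by (intro sum_nonneg) auto
    ultimately show ?thesis by linarith
  next
    case False
    define j where "j = (LEAST j. N \<le> 2 * M j)"
    have Nn: "N \<le> 2 * M n" using N M[of n] by linarith
    have j: "N \<le> 2 * M j" "j \<le> n"
      unfolding j_def using LeastI[of "\<lambda>j. N \<le> 2 * M j", OF Nn] Least_le[of "\<lambda>j. N \<le> 2 * M j", OF Nn] by auto
    obtain l where l: "j = Suc l" using False j by (cases j) auto
    have "\<not> N \<le> 2 * M l" using not_less_Least[of l "\<lambda>j. N \<le> 2 * M j"] l by (simp add: j_def)
    \<comment> \<open>Since \<open>f l \<le> M l < N / 2\<close>, the difference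
      \<open>N - f l\<close> exceeds \<open>N / 2\<close>.\<close>
    then have "2 * f l < N" using f[of l] l j by simp
    then have "N\<^sup>2 \<le> (2 * (N - f l))\<^sup>2" using N by (intro power_mono) auto
    then have sq: "N\<^sup>2 \<le> 4 * (N - f l)\<^sup>2" unfolding power_mult_distrib by simp
    have "N ^ p = N ^ (p - 2) * N\<^sup>2" using p by (metis le_add_diff_inverse2 power_add)
    also have "\<dots> \<le> (2 * M (Suc l)) ^ (p - 2) * (4 * (N - f l)\<^sup>2)"
      using N j l M[of "Suc l"] by (intro mult_mono power_mono sq) auto
    also have "\<dots> = 4 * (2 * M (Suc l)) ^ (p - 2) * (N - f l)\<^sup>2" by simp
    also have "\<dots> \<le> (\<Sum>l<n. 4 * (2 * M (Suc l)) ^ (p - 2) * (N - f l)\<^sup>2)"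
      using l j pos by (intro member_le_sum[where i=l and f="\<lambda>l. 4 * (2 * M (Suc l)) ^ (p - 2) *
        (N - f l)\<^sup>2"]) auto
    also have "0 \<le> (2 * M 0) ^ (p - 1) * N" using N M[of 0] by (intro mult_nonneg_nonneg zero_le_power) auto
    ultimately show ?thesis by linarith
  qed
qed

text \<open>The p-th power is split pointwise over scales, with the sup bounds as thresholds
  \<open>M l\<close>. The coarsest term costs only the total mass; the term of scale
  \<open>l\<close> is of order 2^(l (p - 2) \<delta>) times the averaged squared difference 2^(-2 l
  q).\<close>

lemma averaged_Lp:
  fixes c0 :: "'a::euclidean_space" and C s :: real and p :: nat
  assumes dim: "DIM('a) \<ge> 2" and c0: "norm c0 = 2" and C: "C \<ge> 0" and s: "s > 0" "s \<le> DIM('a)"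
    and p: "p \<ge> 2" "real p * (DIM('a) - s) < 1"
  obtains C' where "C' > 0"
    "\<And>n (A::'a set) m w'. frostman C s n A m \<Longrightarrow>
       (\<integral>\<^sup>+w. indicator (cball c0 1) w * (\<integral>\<^sup>+x. ennreal (mixture ((1/4)^n) A m w' w x ^ p) \<partial>lborel) \<partial>lborel)
         \<le> ennreal C'"
proof -
  define \<delta> where "\<delta> = DIM('a) - s"
  \<comment> \<open>A third of the slack, so that \<open>2 * q - (p - 2) * \<delta> = 1 - p *
    \<delta> - 2 * \<kappa> = \<kappa>\<close> and the scales form a convergent geometric
    series.\<close>
  define \<kappa> where "\<kappa> = (1 - real p * \<delta>) / 3"
  define q where "q = (1 - 2 * \<kappa> - 2 * \<delta>) / 2"
  have \<delta>: "\<delta> \<ge> 0" "real p * \<delta> < 1" using s p by (auto simp: \<delta>_def)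
  have \<kappa>: "\<kappa> > 0" using \<delta> by (simp add: \<kappa>_def)
  have q: "2 * q - real (p - 2) * \<delta> = \<kappa>"
    using p by (simp add: q_def \<kappa>_def of_nat_diff field_simps)
  have "0 \<le> real (p - 2) * \<delta>" using \<delta> by simp
  then have q0: "q \<ge> 0" using q \<kappa> by linarith
  obtain C1 where C1: "C1 > 0"
    "\<And>n l (A::'a set) m w'. frostman C s n A m \<Longrightarrow> l \<le> n \<Longrightarrow>
       (\<integral>\<^sup>+w. indicator (cball c0 1) w *
         (\<integral>\<^sup>+x. ennreal ((mixture ((1/4)^n) A m w' w x - mixture ((1/4)^l) A m w' w x)\<^sup>2) \<partial>lborel) \<partial>lborel)
       \<le> ennreal (C1 * ((1/4)^l) powr q)"
    using averaged_L2_difference[OF dim c0 \<kappa> C s(1) \<delta>_def \<delta>(1) q_def q0] by blast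
  obtain C2 where C2: "C2 > 0"
    "\<And>n l (A::'a set) m w' w x. frostman C s n A m \<Longrightarrow> l \<le> n \<Longrightarrow> mixture ((1/4)^l) A m w' w x \<le> C2 * 2 powr (\<delta> * l)"
    using frostman_mixture_le[OF C s(1) \<delta>_def] by blast
  have [measurable]: "cball c0 r \<in> sets borel" for r by simp
  define V where "V = measure lborel (cball c0 1)"
  have "emeasure lborel (cball c0 1) < \<infinity>" by (rule emeasure_bounded_finite) simp
  then have V: "emeasure lborel (cball c0 1) = ennreal V" "V \<ge> 0"
    by (auto simp: V_def intro!: emeasure_eq_ennreal_measure)
  define M where "M l = C2 * 2 powr (\<delta> * real l)" for l :: nat
  have M: "0 < M l" for l using C2 by (simp add: M_def)
  define K where "K = 4 * (2 * C2 * 2 powr \<delta>) ^ (p - 2)"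
  have K: "K > 0" using C2 by (simp add: K_def)
  define G where "G = 1 / (1 - 2 powr (- \<kappa>))"
  have G: "G > 0" using \<kappa> by (simp add: G_def powr_less_one)
  define H where "H = (2 * M 0) ^ (p - 1)"
  have H: "H > 0" using M[of 0] by (simp add: H_def)
  define C' where "C' = H * (V * C\<^sup>2) + K * C1 * G"
  have "C' > 0" using H V K C1 G by (simp add: C'_def add_nonneg_pos)
  moreover have "(\<integral>\<^sup>+w. indicator (cball c0 1) w * (\<integral>\<^sup>+x. ennreal (mixture ((1/4)^n) A m w' w x ^ p)
    \<partial>lborel) \<partial>lborel) \<le> ennreal C'"
    if fr: "frostman C s n A m" for n and A :: "'a set" and m w'
  proof -
    have m: "\<And>a. 0 \<le> m a" and mA: "sum m A \<le> C" using fr by (auto simp: frostman_def)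
    define N where "N l w x = mixture ((1/4)^l) A m w' w x" for l w x
    have [measurable]: "(\<lambda>x. N l (f x) (g x)) \<in> borel_measurable Q"
      if [measurable]: "f \<in> borel_measurable Q" "g \<in> borel_measurable Q" for l Q and f g :: "'q \<Rightarrow> 'a"
      unfolding N_def by measurable
    have N0: "0 \<le> N l w x" for l w x unfolding N_def by (intro mixture_nonneg m)
    let ?D = "indicator (cball c0 1) :: 'a \<Rightarrow> ennreal"
    let ?c = "\<lambda>l. 4 * (2 * M (Suc l)) ^ (p - 2)"
    have c0: "0 \<le> ?c l" for l using M[of "Suc l"] by simp
    have point: "ennreal (N n w x ^ p) \<le> ennreal H * ennreal (N n w x) + (\<Sum>l<n. ennreal (?c l) * ennreal
      ((N n w x - N l w x)\<^sup>2))" for w x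
    proof -
      have "N n w x ^ p \<le> H * N n w x + (\<Sum>l<n. ?c l * (N n w x - N l w x)\<^sup>2)"
        unfolding H_def using fr p M
        by (intro power_le_scale_differences N0) (auto simp: N_def M_def intro!: C2(2))
      then have "ennreal (N n w x ^ p) \<le> ennreal (H * N n w x + (\<Sum>l<n. ?c l * (N n w x - N l w x)\<^sup>2))"
        by (rule ennreal_leI)
      also have "\<dots> = ennreal H * ennreal (N n w x) + (\<Sum>l<n. ennreal (?c l) * ennreal ((N n w x - N l w x)\<^sup>2))"
        using H N0 c0 by (simp add: ennreal_mult sum_nonneg ennreal_plus flip: sum_ennreal)
      finally show ?thesis .
    qed
    have intN: "(\<integral>\<^sup>+x. ennreal (N n w x) \<partial>lborel) \<le> ennreal (C\<^sup>2)" for w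
    proof -
      have "has_bochner_integral lborel (\<lambda>x. \<Sum>a\<in>A. m a * (\<Sum>b\<in>A. m b * gauss ((1/4)^n) (x + (reflect w'
        (reflect w a) - b)))) (\<Sum>a\<in>A. m a * (\<Sum>b\<in>A. m b * 1))"
        by (intro has_bochner_integral_sum has_bochner_integral_mult_right has_bochner_integral_lborel_translate has_bochner_integral_gauss) simp
      also have "(\<lambda>x. \<Sum>a\<in>A. m a * (\<Sum>b\<in>A. m b * gauss ((1/4)^n) (x + (reflect w' (reflect w a) - b)))) = N n w"
        by (simp add: N_def mixture_eq fun_eq_iff add_diff_eq)
      also have "(\<Sum>a\<in>A. m a * (\<Sum>b\<in>A. m b * 1)) = (sum m A)\<^sup>2"
        by (simp add: power2_eq_square sum_distrib_right)
      finally have "(\<integral>\<^sup>+x. ennreal (N n w x) \<partial>lborel) = ennreal ((sum m A)\<^sup>2)"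
        using N0 by (auto simp: has_bochner_integral_iff nn_integral_eq_integral)
      also have "\<dots> \<le> ennreal (C\<^sup>2)" using mA m by (intro ennreal_leI power_mono sum_nonneg) auto
      finally show ?thesis .
    qed
    have "(\<integral>\<^sup>+w. ?D w * (\<integral>\<^sup>+x. ennreal (N n w x ^ p) \<partial>lborel) \<partial>lborel) \<le>
      (\<integral>\<^sup>+w. ?D w * (\<integral>\<^sup>+x. ennreal H * ennreal (N n w x) + (\<Sum>l<n. ennreal (?c l) * ennreal
        ((N n w x - N l w x)\<^sup>2)) \<partial>lborel) \<partial>lborel)"
      by (intro nn_integral_mono mult_left_mono point) auto
    also have "\<dots> = (\<integral>\<^sup>+w. ennreal H * (?D w * (\<integral>\<^sup>+x. ennreal (N n w x) \<partial>lborel)) +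
       (\<Sum>l<n. ennreal (?c l) * (?D w * (\<integral>\<^sup>+x. ennreal ((N n w x - N l w x)\<^sup>2) \<partial>lborel))) \<partial>lborel)"
    proof (intro nn_integral_cong)
      fix w
      have "(\<integral>\<^sup>+x. ennreal H * ennreal (N n w x) + (\<Sum>l<n. ennreal (?c l) * ennreal ((N n w x - N l w x)\<^sup>2))
        \<partial>lborel) =
        ennreal H * (\<integral>\<^sup>+x. ennreal (N n w x) \<partial>lborel) + (\<Sum>l<n. ennreal (?c l) * (\<integral>\<^sup>+x. ennreal
          ((N n w x - N l w x)\<^sup>2) \<partial>lborel))"
        by (simp add: nn_integral_add nn_integral_sum nn_integral_cmult)
      then show "?D w * (\<integral>\<^sup>+x. ennreal H * ennreal (N n w x) + (\<Sum>l<n. ennreal (?c l) * ennreal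
        ((N n w x - N l w x)\<^sup>2)) \<partial>lborel) =
        ennreal H * (?D w * (\<integral>\<^sup>+x. ennreal (N n w x) \<partial>lborel)) +
       (\<Sum>l<n. ennreal (?c l) * (?D w * (\<integral>\<^sup>+x. ennreal ((N n w x - N l w x)\<^sup>2) \<partial>lborel)))"
        by (auto split: split_indicator)
    qed
    also have "\<dots> = ennreal H * (\<integral>\<^sup>+w. ?D w * (\<integral>\<^sup>+x. ennreal (N n w x) \<partial>lborel) \<partial>lborel) +
       (\<Sum>l<n. ennreal (?c l) * (\<integral>\<^sup>+w. ?D w * (\<integral>\<^sup>+x. ennreal ((N n w x - N l w x)\<^sup>2) \<partial>lborel) \<partial>lborel))"
      by (simp add: nn_integral_add nn_integral_sum nn_integral_cmult)
    also have "\<dots> \<le> ennreal H * ennreal (V * C\<^sup>2) + (\<Sum>l<n. ennreal (?c l) * ennreal (C1 * ((1/4)^l) powr q))"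
    proof (intro add_mono mult_left_mono sum_mono)
      have "(\<integral>\<^sup>+w. ?D w * (\<integral>\<^sup>+x. ennreal (N n w x) \<partial>lborel) \<partial>lborel) \<le> (\<integral>\<^sup>+w. ?D w * ennreal (C\<^sup>2) \<partial>lborel)"
        by (intro nn_integral_mono mult_left_mono intN) auto
      also have "\<dots> = ennreal (V * C\<^sup>2)"
        using V by (subst nn_integral_multc) (auto simp: ennreal_mult)
      finally show "(\<integral>\<^sup>+w. ?D w * (\<integral>\<^sup>+x. ennreal (N n w x) \<partial>lborel) \<partial>lborel) \<le> ennreal (V * C\<^sup>2)" .
      show "(\<integral>\<^sup>+w. ?D w * (\<integral>\<^sup>+x. ennreal ((N n w x - N l w x)\<^sup>2) \<partial>lborel) \<partial>lborel) \<le> ennreal (C1 *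
        ((1/4)^l) powr q)"
        if "l \<in> {..<n}" for l
        using C1(2)[OF fr, of l w'] that by (simp add: N_def)
    qed auto
    also have "\<dots> = ennreal (H * (V * C\<^sup>2) + (\<Sum>l<n. ?c l * (C1 * ((1/4)^l) powr q)))"
      using H V C1 c0 by (simp add: ennreal_mult ennreal_plus sum_nonneg flip: sum_ennreal)
    also have "\<dots> \<le> ennreal C'"
    proof (intro ennreal_leI)
      have eq: "?c l * (C1 * ((1/4)^l) powr q) = K * C1 * (2 powr (- \<kappa>)) ^ l" for l
      proof -
        have "2 * M (Suc l) = (2 * C2 * 2 powr \<delta>) * 2 powr (\<delta> * real l)"
          by (simp add: M_def ring_distribs powr_add)
        then have "?c l = K * (2 powr (\<delta> * real l)) ^ (p - 2)"
          by (simp only: K_def power_mult_distrib mult.assoc)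
        also have "(2 powr (\<delta> * real l)) ^ (p - 2) = 2 powr (real (p - 2) * \<delta> * real l)"
          by (simp add: powr_powr mult_ac flip: powr_realpow)
        finally have 1: "?c l = K * 2 powr (real (p - 2) * \<delta> * real l)" .
        have "(1/4::real)^l = 2 powr (-2 * real l)"
          by (simp add: powr_minus_divide power_one_over powr_mult_base flip: powr_powr powr_realpow)
        then have 2: "((1/4)^l) powr q = 2 powr (- 2 * q * real l)" by (simp add: powr_powr mult_ac)
        have "real (p - 2) * \<delta> * real l + - 2 * q * real l = - \<kappa> * real l"
          unfolding q[symmetric] by (simp add: algebra_simps)
        then have 3: "2 powr (real (p - 2) * \<delta> * real l) * 2 powr (- 2 * q * real l) = 2 powr (- \<kappa> * real l)"
          by (simp only: powr_add[symmetric])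
        have 4: "2 powr (- \<kappa> * real l) = (2 powr (- \<kappa>)) ^ l" by (simp add: powr_powr flip: powr_realpow)
        have "?c l * (C1 * ((1/4)^l) powr q) = K * C1 * (2 powr (real (p - 2) * \<delta> * real l) * 2 powr (- 2
          * q * real l))"
          unfolding 1 2 by (simp only: mult_ac)
        then show ?thesis unfolding 3 4 .
      qed
      have "(\<Sum>l<n. ?c l * (C1 * ((1/4)^l) powr q)) = K * C1 * (\<Sum>l\<in>{..<n}. (2 powr (- \<kappa>)) ^ l)"
        by (simp only: eq sum_distrib_left)
      also have "\<dots> \<le> K * C1 * G"
        unfolding G_def using K C1 \<kappa> by (intro mult_left_mono sum_geometric_powr_le) auto
      finally show "H * (V * C\<^sup>2) + (\<Sum>l<n. ?c l * (C1 * ((1/4)^l) powr q)) \<le> C'" by (simp add: C'_def)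
    qed
    finally show ?thesis by (simp add: N_def)
  qed
  ultimately show ?thesis by (rule that)
qed

section \<open>Frostman's lemma at a finite scale\<close>

text \<open>Greedy choice: points are added one at a time, each with the largest mass that no
  constraint forbids. Earlier masses are unchanged, and a point in an already saturated set receives
  mass 0, so saturated constraints stay saturated.\<close>

lemma exists_saturating_masses:
  fixes S :: "'i \<Rightarrow> 'a set" and \<kappa> :: "'i \<Rightarrow> real"
  assumes "finite A" "finite I" "\<And>i. i \<in> I \<Longrightarrow> 0 \<le> \<kappa> i"
  shows "\<exists>m. (\<forall>a. 0 \<le> m a) \<and> (\<forall>i\<in>I. sum m (A \<inter> S i) \<le> \<kappa> i) \<and>
    (\<forall>a\<in>A. (\<exists>i\<in>I. a \<in> S i) \<longrightarrow> (\<exists>i\<in>I. a \<in> S i \<and> sum m (A \<inter> S i) = \<kappa> i))"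
  using assms(1)
proof induction
  case empty
  show ?case by (rule exI[of _ "\<lambda>_. 0"]) (use assms(3) in auto)
next
  case (insert a A)
  then obtain m where m: "\<And>a. 0 \<le> m a" "\<And>i. i \<in> I \<Longrightarrow> sum m (A \<inter> S i) \<le> \<kappa> i"
    "\<And>a. a \<in> A \<Longrightarrow> \<exists>i\<in>I. a \<in> S i \<Longrightarrow> \<exists>i\<in>I. a \<in> S i \<and> sum m (A \<inter> S i) = \<kappa> i"
    by blast
  define J where "J = {i\<in>I. a \<in> S i}"
  define slack where "slack i = \<kappa> i - sum m (A \<inter> S i)" for i
  \<comment> \<open>The smallest slack among the constraints on \<open>a\<close>; 0 is a default for
    a point without constraints.\<close>
  define x where "x = (if J = {} then 0 else Min (slack ` J))"
  have fJ: "finite J" using assms(2) by (simp add: J_def)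
  have x_le: "x \<le> slack i" if "i \<in> J" for i
    using that fJ by (auto simp: x_def)
  have x_nonneg: "0 \<le> x"
    using fJ m(2) by (auto simp: x_def slack_def J_def)
  have x_eq: "\<exists>i\<in>J. slack i = x" if "J \<noteq> {}"
    using Min_in[of "slack ` J"] fJ that by (fastforce simp: x_def image_iff)
  define m' where "m' = m(a := x)"
  have sum_m': "sum m' (insert a A \<inter> S i) = sum m (A \<inter> S i) + (if a \<in> S i then x else 0)" for i
  proof -
    have "sum m' (A \<inter> S i) = sum m (A \<inter> S i)"
      using insert(2) by (intro sum.cong) (auto simp: m'_def)
    then show ?thesis
      using insert(1,2) by (auto simp: Int_insert_left m'_def)
  qed
  show ?case
  proof (intro exI[of _ m'] conjI allI ballI impI)
    show "0 \<le> m' b" for b using m(1) x_nonneg by (simp add: m'_def)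
    show "sum m' (insert a A \<inter> S i) \<le> \<kappa> i" if "i \<in> I" for i
      using x_le[of i] m(2)[OF that] that by (auto simp: sum_m' J_def slack_def)
    show "\<exists>i\<in>I. b \<in> S i \<and> sum m' (insert a A \<inter> S i) = \<kappa> i" if b: "b \<in> insert a A" "\<exists>i\<in>I. b \<in> S i" for b
    proof (cases "b = a")
      case True
      then have "J \<noteq> {}" using b by (auto simp: J_def)
      from x_eq[OF this] obtain i where "i \<in> J" "slack i = x" by blast
      moreover from this have "sum m' (insert a A \<inter> S i) = \<kappa> i"
        unfolding sum_m' by (auto simp: J_def slack_def)
      ultimately show ?thesis using True by (auto simp: J_def)
    next
      case False
      then obtain i where i: "i \<in> I" "b \<in> S i" "sum m (A \<inter> S i) = \<kappa> i" using m(3) b by blast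
      have "a \<in> S i \<Longrightarrow> x = 0" using x_le[of i] i x_nonneg by (auto simp: J_def slack_def)
      then show ?thesis using i by (auto simp: sum_m')
    qed
  qed
qed

text \<open>Positivity of the premeasure at some scale \<open>\<delta>\<close> handles covers by
  balls of diameter at most \<open>\<delta>\<close>, while a cover with a larger ball has sum at
  least \<open>\<delta> powr s\<close> anyway. Hence one constant serves balls of all sizes.\<close>

lemma hausdorff_dim_content:
  fixes E :: "'a::euclidean_space set"
  assumes "0 < s" "ereal s < hausdorff_dim E"
  obtains c where "c > 0"
    "\<And>F (a::'i \<Rightarrow> 'a) R. finite F \<Longrightarrow> (\<And>i. i \<in> F \<Longrightarrow> 0 < R i) \<Longrightarrow> E \<subseteq> (\<Union>i\<in>F. cball (a i) (R i)) \<Longrightarrow>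
       c \<le> (\<Sum>i\<in>F. (2 * R i) powr s)"
proof -
  have "hausdorff_measure s E \<noteq> 0"
  proof
    assume "hausdorff_measure s E = 0"
    then have "hausdorff_dim E \<le> ereal s"
      unfolding hausdorff_dim_def using assms(1) by (intro INF_lower) auto
    then show False using assms(2) by simp
  qed
  then have "0 < hausdorff_measure s E" by (simp add: zero_less_iff_neq_zero)
  then obtain \<delta> where \<delta>: "\<delta> > 0" "0 < hausdorff_premeasure s \<delta> E"
    by (auto simp: hausdorff_measure_def less_SUP_iff)
  \<comment> \<open>The premeasure may be infinite, hence the truncation at 1 before passing to
    reals.\<close>
  define P where "P = min 1 (hausdorff_premeasure s \<delta> E)"
  have P: "0 < P" "P \<le> hausdorff_premeasure s \<delta> E" "P < \<infinity>"
    using \<delta> by (auto simp: P_def min_less_iff_disj)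
  define c where "c = min (\<delta> powr s) (enn2real P)"
  have "c > 0" using P \<delta> by (simp add: c_def enn2real_positive_iff)
  moreover have "c \<le> (\<Sum>i\<in>F. (2 * R i) powr s)"
    if F: "finite F" "\<And>i. i \<in> F \<Longrightarrow> 0 < R i" "E \<subseteq> (\<Union>i\<in>F. cball (a i) (R i))"
    for F and a :: "'i \<Rightarrow> 'a" and R
  proof (rule ccontr)
    assume "\<not> ?thesis"
    then have less: "(\<Sum>i\<in>F. (2 * R i) powr s) < c" by simp
    have small: "2 * R i \<le> \<delta>" if "i \<in> F" for i
    proof (rule ccontr)
      assume "\<not> ?thesis"
      then have "\<delta> powr s \<le> (2 * R i) powr s"
        using \<delta> assms(1) by (intro powr_mono2) auto
      also have "\<dots> \<le> (\<Sum>i\<in>F. (2 * R i) powr s)"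
        using that F by (intro member_le_sum) auto
      finally show False using less by (simp add: c_def)
    qed
    obtain f where f: "bij_betw f {0..<card F} F"
      using ex_bij_betw_nat_finite[OF F(1)] by blast
    \<comment> \<open>The finite cover is padded with empty sets, whose gauge is 0, to the sequence
      that the premeasure demands.\<close>
    define U where "U n = (if n < card F then cball (a (f n)) (R (f n)) else {})" for n
    have fF: "f n \<in> F" if "n < card F" for n
      using f that by (auto simp: bij_betw_def)
    have "hausdorff_premeasure s \<delta> E \<le> (\<Sum>i. diam_pow s (U i))"
      unfolding hausdorff_premeasure_def
    proof (intro INF_lower CollectI conjI allI)
      show "E \<subseteq> (\<Union>i. U i)"
      proof
        fix x assume "x \<in> E"
        then obtain i where i: "i \<in> F" "x \<in> cball (a i) (R i)" using F by auto
        then have "i \<in> f ` {0..<card F}" using f by (simp add: bij_betw_def)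
        then obtain n where "n < card F" "f n = i" by auto
        then show "x \<in> (\<Union>i. U i)" using i by (auto simp: U_def intro!: exI[of _ n])
      qed
      show "bounded (U i)" for i by (simp add: U_def)
      show "diameter (U i) \<le> \<delta>" for i
        using small[OF fF[of i]] F(2)[OF fF[of i]] \<delta> by (auto simp: U_def)
    qed
    also have "(\<Sum>i. diam_pow s (U i)) = (\<Sum>i<card F. diam_pow s (U i))"
      by (intro suminf_finite) (auto simp: U_def diam_pow_def)
    also have "\<dots> = (\<Sum>i<card F. ennreal ((2 * R (f i)) powr s))"
      using F(2) fF assms(1) by (intro sum.cong)
        (auto simp: U_def diam_pow_def not_less less_imp_le dest: less_imp_le)
    also have "\<dots> = (\<Sum>i\<in>F. ennreal ((2 * R i) powr s))"
      using sum.reindex_bij_betw[OF f, of "\<lambda>i. ennreal ((2 * R i) powr s)"] by (simp add: atLeast0LessThan)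
    also have "\<dots> = ennreal (\<Sum>i\<in>F. (2 * R i) powr s)"
      by (simp add: sum_ennreal)
    also have "\<dots> < ennreal c" using less \<open>c > 0\<close> by (simp add: ennreal_lessI)
    also have "\<dots> \<le> ennreal (enn2real P)" by (intro ennreal_leI) (simp add: c_def)
    also have "\<dots> = P" using P by simp
    finally show False using P by simp
  qed
  ultimately show ?thesis by (rule that)
qed

text \<open>Every atom lies in a ball whose constraint is saturated, and the Vitali covering lemma selects
  disjoint ones covering \<open>E\<close> up to a dilation. As the constants do not depend on \<open>n\<close>, no passage to a
  weak limit measure is needed.\<close>

lemma frostman_finite_scale:
  fixes E :: "'a::euclidean_space set"
  assumes "compact E" "0 < s" "ereal s < hausdorff_dim E"
  obtains C c where "C > 0" "c > 0"
    "\<And>n. \<exists>A m. finite A \<and> A \<subseteq> E \<and> (\<forall>a. 0 \<le> m a) \<and> c \<le> sum m A \<and>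
       (\<forall>x r. (1/2) ^ n \<le> r \<longrightarrow> sum m (A \<inter> cball x r) \<le> C * r powr s)"
proof -
  obtain c where c: "c > 0"
    "\<And>F (a::'a \<times> nat \<Rightarrow> 'a) R. finite F \<Longrightarrow> (\<And>i. i \<in> F \<Longrightarrow> 0 < R i) \<Longrightarrow> E \<subseteq> (\<Union>i\<in>F. cball (a i) (R i)) \<Longrightarrow>
       c \<le> (\<Sum>i\<in>F. (2 * R i) powr s)"
    using hausdorff_dim_content[OF assms(2,3)] by blast
  obtain R0 where R0: "\<And>x. x \<in> E \<Longrightarrow> norm x \<le> R0"
    using compact_imp_bounded[OF assms(1)] by (auto simp: bounded_iff)
  \<comment> \<open>The radii will be L 2^(-j). The largest ball around any point of
    \<open>E\<close> must contain \<open>E\<close>, and \<open>L \<ge> 4\<close> leaves room to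
    replace a ball with arbitrary centre by one centred at an atom.\<close>
  define L where "L = max 4 (2 * R0)"
  have L: "L \<ge> 4" "L > 0" "dist x y \<le> L" if "x \<in> E" "y \<in> E" for x y
    using R0[OF that(1)] R0[OF that(2)] norm_triangle_ineq4[of x y] by (auto simp: L_def dist_norm)
  have L4: "L \<ge> 4" by (simp add: L_def)
  define C where "C = L powr s"
  have "\<exists>A m. finite A \<and> A \<subseteq> E \<and> (\<forall>a. 0 \<le> m a) \<and> c / 12 powr s \<le> sum m A \<and>
       (\<forall>x r. (1/2) ^ n \<le> r \<longrightarrow> sum m (A \<inter> cball x r) \<le> C * r powr s)" for n
  proof -
    have "\<exists>A. finite A \<and> A \<subseteq> E \<and> E \<subseteq> (\<Union>x\<in>A. ball x ((1/2)^n))"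
      using assms(1) seq_compact_imp_totally_bounded[of E] by (auto simp: compact_eq_seq_compact_metric)
    then obtain A where A: "finite A" "A \<subseteq> E" "E \<subseteq> (\<Union>x\<in>A. ball x ((1/2)^n))" by blast
    define \<rho> where "\<rho> j = L * (1/2) ^ j" for j :: nat
    have \<rho>: "\<rho> j > 0" "\<rho> j \<le> L" for j using L4 by (auto simp: \<rho>_def mult_left_le power_le_one)
    define I where "I = A \<times> {..n}"
    have fI: "finite I" using A by (simp add: I_def)
    define S where "S i = cball (fst i) (\<rho> (snd i))" for i :: "'a \<times> nat"
    obtain m where m: "\<And>a. 0 \<le> m a" "\<And>i. i \<in> I \<Longrightarrow> sum m (A \<inter> S i) \<le> \<rho> (snd i) powr s"
      "\<And>a. a \<in> A \<Longrightarrow> \<exists>i\<in>I. a \<in> S i \<Longrightarrow> \<exists>i\<in>I. a \<in> S i \<and> sum m (A \<inter> S i) = \<rho> (snd i) powr s"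
    proof -
      have "\<exists>m. (\<forall>a. 0 \<le> m a) \<and> (\<forall>i\<in>I. sum m (A \<inter> S i) \<le> \<rho> (snd i) powr s) \<and>
        (\<forall>a\<in>A. (\<exists>i\<in>I. a \<in> S i) \<longrightarrow> (\<exists>i\<in>I. a \<in> S i \<and> sum m (A \<inter> S i) = \<rho> (snd i) powr s))"
        by (rule exists_saturating_masses[OF A(1) fI]) simp
      then obtain m where "\<forall>a. 0 \<le> m a" "\<forall>i\<in>I. sum m (A \<inter> S i) \<le> \<rho> (snd i) powr s"
        "\<forall>a\<in>A. (\<exists>i\<in>I. a \<in> S i) \<longrightarrow> (\<exists>i\<in>I. a \<in> S i \<and> sum m (A \<inter> S i) = \<rho> (snd i) powr s)"
        by (elim exE conjE)
      then show ?thesis by (intro that[of m]) (simp_all only: simp_thms)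
    qed
    define K where "K = {i\<in>I. sum m (A \<inter> S i) = \<rho> (snd i) powr s}"
    have "A \<subseteq> (\<Union>i\<in>K. cball (fst i) (\<rho> (snd i)))" (is "_ \<subseteq> ?U")
    proof
      fix a assume "a \<in> A"
      moreover have "\<exists>i\<in>I. a \<in> S i"
        using \<open>a \<in> A\<close> \<rho>(1)[of 0] by (intro bexI[of _ "(a, 0)"]) (auto simp: I_def S_def)
      ultimately obtain i where "i \<in> I" "a \<in> S i" "sum m (A \<inter> S i) = \<rho> (snd i) powr s"
        using m(3) by blast
      then show "a \<in> (\<Union>i\<in>K. cball (fst i) (\<rho> (snd i)))"
        unfolding K_def S_def by blast
    qed
    then obtain Q where Q: "Q \<subseteq> K"
      "pairwise (\<lambda>i j. disjnt (cball (fst i) (\<rho> (snd i))) (cball (fst j) (\<rho> (snd j)))) Q"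
      "A \<subseteq> (\<Union>i\<in>Q. cball (fst i) (5 * \<rho> (snd i)))"
    proof (rule Vitali_covering_lemma_cballs[where S=A and a=fst and r="\<lambda>i. \<rho> (snd i)" and K=K and B=L])
      show "\<And>i. i \<in> K \<Longrightarrow> 0 < \<rho> (snd i) \<and> \<rho> (snd i) \<le> L" using \<rho> by simp
    qed (rule that)
    have fQ: "finite Q" using Q(1) fI by (auto simp: K_def intro: finite_subset)
    \<comment> \<open>The factor 6 is 5 from the Vitali lemma plus 1 for the distance of a point of
      \<open>E\<close> to the net, which is below 2^(-n) and thus below every radius in use.\<close>
    have "E \<subseteq> (\<Union>i\<in>Q. cball (fst i) (6 * \<rho> (snd i)))"
    proof
      fix x assume "x \<in> E"
      then obtain a where a: "a \<in> A" "dist a x < (1/2)^n" using A by auto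
      then obtain i where i: "i \<in> Q" "dist (fst i) a \<le> 5 * \<rho> (snd i)" using Q(3) by auto
      have "snd i \<le> n" using i Q(1) by (auto simp: K_def I_def)
      then have "(1/2::real)^n \<le> 1 * (1/2)^snd i" by (simp add: power_decreasing)
      also have "\<dots> \<le> \<rho> (snd i)" unfolding \<rho>_def using L4 by (intro mult_right_mono) auto
      finally have "dist (fst i) x \<le> 6 * \<rho> (snd i)"
        using dist_triangle[of "fst i" x a] a i by simp
      then show "x \<in> (\<Union>i\<in>Q. cball (fst i) (6 * \<rho> (snd i)))" using i by auto
    qed
    then have "c \<le> (\<Sum>i\<in>Q. (2 * (6 * \<rho> (snd i))) powr s)"
      using fQ \<rho> by (intro c(2)) auto
    also have "\<dots> = 12 powr s * (\<Sum>i\<in>Q. \<rho> (snd i) powr s)"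
      using \<rho>(1) by (simp add: powr_mult sum_distrib_left less_imp_le)
    also have "(\<Sum>i\<in>Q. \<rho> (snd i) powr s) = (\<Sum>i\<in>Q. sum m (A \<inter> S i))"
      using Q(1) by (intro sum.cong) (auto simp: K_def)
    also have "\<dots> = sum m (\<Union>i\<in>Q. A \<inter> S i)"
    proof (intro sum.UNION_disjoint[symmetric] ballI impI)
      fix i j assume "i \<in> Q" "j \<in> Q" "i \<noteq> j"
      from pairwiseD[OF Q(2) this] show "A \<inter> S i \<inter> (A \<inter> S j) = {}"
        unfolding disjnt_def S_def by blast
    qed (use A(1) fQ in auto)
    also have "\<dots> \<le> sum m A"
      using A(1) m(1) by (intro sum_mono2) auto
    finally have lower: "c / 12 powr s \<le> sum m A" by (simp add: field_simps)
    have upper: "sum m (A \<inter> cball x r) \<le> C * r powr s" if r: "(1/2)^n \<le> r" for x r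
    proof (cases "A \<inter> cball x r = {}")
      case True
      show ?thesis unfolding True by (simp add: C_def)
    next
      case False
      then obtain a where a: "a \<in> A" "dist x a \<le> r" by auto
      have r0: "r > 0" using r by (meson less_le_trans zero_less_power zero_less_divide_1_iff zero_less_numeral)
      have bound: "sum m (A \<inter> cball x r) \<le> C * r powr s"
        if j: "j \<le> n" "A \<inter> cball x r \<subseteq> cball a (\<rho> j)" "\<rho> j \<le> L * r" for j
      proof -
        have "sum m (A \<inter> cball x r) \<le> sum m (A \<inter> S (a, j))"
          using j A(1) m(1) by (intro sum_mono2) (auto simp: S_def)
        also have "\<dots> \<le> \<rho> j powr s" using m(2)[of "(a, j)"] a j by (simp add: I_def)
        also have "\<dots> \<le> (L * r) powr s" using j \<rho>(1)[of j] assms(2) by (intro powr_mono2) auto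
        also have "\<dots> = C * r powr s" using L4 r0 by (simp add: powr_mult C_def)
        finally show ?thesis .
      qed
      have sub: "A \<inter> cball x r \<subseteq> cball a (2 * r)"
      proof
        fix y assume "y \<in> A \<inter> cball x r"
        then show "y \<in> cball a (2 * r)" using a dist_triangle3[of a y x] by auto
      qed
      \<comment> \<open>The largest \<open>j\<close> in \<open>J\<close> gives the smallest
        available ball around \<open>a\<close> that surely contains the atoms in question, with
        radius at most \<open>L * r\<close>. If \<open>J\<close> is empty, \<open>r\<close> is so
        large that the ball of radius \<open>L\<close> serves.\<close>
      define J where "J = {j. j \<le> n \<and> 2 * r \<le> \<rho> j}"
      have fJ: "finite J" by (simp add: J_def)
      show ?thesis
      proof (cases "J = {}")
        case True
        then have "\<rho> 0 < 2 * r" by (auto simp: J_def not_le)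
        then have "L \<le> L * r" using L4 mult_left_mono[of 1 r L] by (cases "r \<ge> 1") (auto simp: \<rho>_def)
        moreover have "A \<inter> cball x r \<subseteq> cball a L"
        proof
          fix y assume "y \<in> A \<inter> cball x r"
          then have "a \<in> E" "y \<in> E" using A(2) a(1) by auto
          then show "y \<in> cball a L" using L(3) by simp
        qed
        ultimately show ?thesis
          using bound[of 0] by (simp add: \<rho>_def)
      next
        case False
        define j where "j = Max J"
        have j: "j \<in> J" using Max_in[OF fJ False] by (simp add: j_def)
        have "\<rho> j \<le> L * r"
        proof (cases "j = n")
          case True
          then show ?thesis using r L4 by (simp add: \<rho>_def)
        next
          case False
          then have "Suc j \<le> n" using j by (auto simp: J_def)
          moreover have "Suc j \<notin> J" using Max_ge[OF fJ, of "Suc j"] by (auto simp: j_def)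
          ultimately have "\<rho> (Suc j) < 2 * r" by (auto simp: J_def)
          then have "\<rho> j < 4 * r" by (simp add: \<rho>_def)
          also have "\<dots> \<le> L * r" using L4 r0 by simp
          finally show ?thesis by simp
        qed
        moreover have "A \<inter> cball x r \<subseteq> cball a (\<rho> j)"
          using sub j by (auto simp: J_def)
        ultimately show ?thesis using j by (intro bound[of j]) (auto simp: J_def)
      qed
    qed
    show ?thesis using A(1,2) m(1) lower upper by blast
  qed
  moreover have "C > 0" "c / 12 powr s > 0" using L4 c by (auto simp: C_def)
  ultimately show ?thesis using that by blast
qed

section \<open>Congruent copies of tuples\<close>

lemma measurable_vec_lambda_PiM:
  "(\<lambda>f. \<chi> i. f i) \<in> measurable (\<Pi>\<^sub>M i\<in>(UNIV :: 'v::finite set). (lborel :: 'a::euclidean_space measure)) borel"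
proof (subst borel_measurable_euclidean_space, intro ballI)
  fix b :: "'a^'v" assume "b \<in> Basis"
  then obtain i u where "b = axis i u" by (auto simp: Basis_vec_def)
  then show "(\<lambda>f. (\<chi> i. f i) \<bullet> b) \<in> borel_measurable (\<Pi>\<^sub>M i\<in>(UNIV :: 'v set). (lborel :: 'a measure))"
    by (simp add: inner_axis)
qed

text \<open>Lebesgue measure is determined by its values on boxes, and a box of tuples is a product
  of boxes over the vertices.\<close>

lemma lborel_vec_eq:
  "(lborel :: (('a::euclidean_space)^'v) measure) = distr (\<Pi>\<^sub>M i\<in>UNIV. lborel) borel (\<lambda>f. \<chi> i. f i)"
proof (rule lborel_eqI)
  interpret P: product_sigma_finite "\<lambda>_::'v. lborel :: 'a measure" ..
  note measurable_vec_lambda_PiM [measurable]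
  fix l u :: "'a^'v"
  assume "\<And>b. b \<in> Basis \<Longrightarrow> l \<bullet> b \<le> u \<bullet> b"
  then have le: "l $ i \<bullet> b \<le> u $ i \<bullet> b" if "b \<in> Basis" for i b
    using that by (metis axis_in_Basis_iff inner_axis)
  have vimage: "(\<lambda>f. \<chi> i. f i) -` box l u \<inter> space (\<Pi>\<^sub>M i\<in>UNIV. lborel) = (\<Pi>\<^sub>E i\<in>UNIV. box (l $ i) (u $ i))"
    by (auto simp: space_PiM mem_box Basis_vec_def inner_axis PiE_iff)
  have "emeasure (distr (\<Pi>\<^sub>M i\<in>UNIV. lborel) borel (\<lambda>f. \<chi> i. f i)) (box l u) = (\<Prod>i\<in>UNIV. emeasure lborel
    (box (l $ i) (u $ i)))"
    by (simp add: emeasure_distr vimage P.emeasure_PiM)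
  also have "\<dots> = (\<Prod>i\<in>UNIV. ennreal (\<Prod>b\<in>Basis. (u $ i - l $ i) \<bullet> b))"
    using le by (intro prod.cong refl emeasure_lborel_box) auto
  also have "\<dots> = ennreal (\<Prod>i\<in>UNIV. \<Prod>b\<in>Basis. (u $ i - l $ i) \<bullet> b)"
    using le by (intro prod_ennreal prod_nonneg) (auto simp: inner_diff_left)
  also have "(\<Prod>i\<in>UNIV. \<Prod>b\<in>Basis. (u $ i - l $ i) \<bullet> b) = (\<Prod>b\<in>Basis. (u - l) \<bullet> b)"
  proof -
    have "(\<Prod>b\<in>(\<Union>i\<in>UNIV. axis i ` Basis). (u - l) \<bullet> b) = (\<Prod>i\<in>UNIV. \<Prod>b\<in>axis i ` Basis. (u - l) \<bullet> b)"
      by (intro prod.UNION_disjoint) (auto simp: axis_eq_axis)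
    moreover have "(\<Prod>b\<in>axis i ` Basis. (u - l) \<bullet> b) = (\<Prod>b\<in>Basis. (u $ i - l $ i) \<bullet> b)" for i
      by (subst prod.reindex) (auto simp: inj_on_def axis_eq_axis inner_axis)
    moreover have "(Basis :: ('a^'v) set) = (\<Union>i\<in>UNIV. axis i ` Basis)" by (auto simp: Basis_vec_def)
    ultimately show ?thesis by simp
  qed
  finally show "emeasure (distr (\<Pi>\<^sub>M i\<in>UNIV. lborel) borel (\<lambda>f. \<chi> i. f i)) (box l u) = (\<Prod>b\<in>Basis. (u - l)
    \<bullet> b)" .
qed simp

lemma borel_measurable_vec_nth [measurable (raw)]:
  fixes f :: "'b \<Rightarrow> ('a::euclidean_space)^'v"
  assumes [measurable]: "f \<in> borel_measurable M"
  shows "(\<lambda>x. f x $ i) \<in> borel_measurable M"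
proof -
  have "(\<lambda>x::'a^'v. x $ i) \<in> borel_measurable borel"
    by (intro borel_measurable_continuous_onI continuous_intros)
  then show ?thesis by (rule measurable_compose[OF assms])
qed

lemma nn_integral_vec_prod:
  fixes f :: "'v::finite \<Rightarrow> 'a::euclidean_space \<Rightarrow> ennreal"
  assumes [measurable]: "\<And>i. f i \<in> borel_measurable borel"
  shows "(\<integral>\<^sup>+x. (\<Prod>i\<in>UNIV. f i (x $ i)) \<partial>lborel) = (\<Prod>i\<in>UNIV. \<integral>\<^sup>+y. f i y \<partial>lborel)"
proof -
  interpret P: product_sigma_finite "\<lambda>_::'v. lborel :: 'a measure" ..
  show ?thesis
    by (subst lborel_vec_eq)
      (simp add: nn_integral_distr[OF measurable_vec_lambda_PiM] P.product_nn_integral_prod)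
qed

text \<open>Each atom is spread uniformly over a ball. The compact support is what later places
  tuples within \<open>\<epsilon>\<close> of copies of \<open>E\<close>; for square integrals the
  density is dominated by a Gaussian one.\<close>

definition ball_density :: "real \<Rightarrow> 'a::euclidean_space set \<Rightarrow> ('a \<Rightarrow> real) \<Rightarrow> 'a \<Rightarrow> real" where
  "ball_density \<epsilon> A m y = (\<Sum>a\<in>A. m a * (indicator (cball a \<epsilon>) y / measure lborel (cball (0::'a) \<epsilon>)))"

lemma borel_measurable_ball_density [measurable]: "ball_density \<epsilon> A m \<in> borel_measurable borel"
proof -
  have [measurable]: "cball a \<epsilon> \<in> sets borel" for a :: 'a by simp
  show ?thesis unfolding ball_density_def by measurable
qed

lemma measure_lborel_cball: "measure lborel (cball (a::'a::euclidean_space) \<epsilon>) = measure lborel (cball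
  (0::'a) \<epsilon>)"
  by (cases "\<epsilon> \<ge> 0") (simp_all add: content_cball)

lemma nn_integral_ball_density_isometry:
  fixes A :: "'a::euclidean_space set"
  assumes \<epsilon>: "\<epsilon> > 0" and m: "\<And>a. 0 \<le> m a"
  shows "(\<integral>\<^sup>+y. ennreal (ball_density \<epsilon> A m (reflect w y + z)) \<partial>lborel) = ennreal (sum m A)"
proof -
  have V: "measure lborel (cball (a::'a) \<epsilon>) > 0" for a using \<epsilon> by (simp add: content_cball_pos)
  have ind: "indicator (cball a \<epsilon>) (reflect w y + z) = (indicator (cball (reflect w (a - z)) \<epsilon>) y :: real)"
    for a y
  proof -
    have "norm (a - (reflect w y + z)) = norm (reflect w (a - (reflect w y + z)))" by simp
    also have "reflect w (a - (reflect w y + z)) = reflect w (a - z) - y"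
      by (simp add: reflect_diff reflect_add algebra_simps)
    finally show ?thesis by (simp add: indicator_def dist_norm)
  qed
  have fin: "emeasure lborel (cball a \<epsilon>) < \<infinity>" for a :: 'a
    using emeasure_bounded_finite[of "cball a \<epsilon>"] by simp
  have "has_bochner_integral lborel (\<lambda>y. \<Sum>a\<in>A. m a * (indicator (cball (reflect w (a - z)) \<epsilon>) y
    / measure lborel (cball (0::'a) \<epsilon>)))
     (\<Sum>a\<in>A. m a * (measure lborel (cball (reflect w (a - z)) \<epsilon>) / measure lborel (cball (0::'a) \<epsilon>)))"
    using V
    by (intro has_bochner_integral_sum has_bochner_integral_mult_right has_bochner_integral_divide_zero has_bochner_integral_real_indicator)
       (auto simp: fin[simplified])
  also have "(\<Sum>a\<in>A. m a * (measure lborel (cball (reflect w (a - z)) \<epsilon>) / measure lborel (cball (0::'a) \<epsilon>)))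
    = sum m A"
    using V[of 0] by (subst measure_lborel_cball) simp
  finally have "has_bochner_integral lborel (\<lambda>y. ball_density \<epsilon> A m (reflect w y + z)) (sum m A)"
    unfolding ball_density_def ind .
  moreover have "0 \<le> ball_density \<epsilon> A m y" for y
    unfolding ball_density_def using m by (intro sum_nonneg) auto
  ultimately show ?thesis by (auto simp: has_bochner_integral_iff nn_integral_eq_integral)
qed

text \<open>On the ball of radius \<open>\<epsilon>\<close> the Gaussian of variance
  \<open>\<epsilon>^2 / 2\<close> is at least exp (-1) times its maximum, and the ratio of the
  normalisations does not depend on the scale. The half makes the convolution of two such Gaussians
  have variance \<open>\<epsilon>^2\<close>.\<close>

lemma ball_density_le_gauss:
  obtains K where "K > 0"
    "\<And>\<epsilon> (A::'a::euclidean_space set) m y. \<epsilon> > 0 \<Longrightarrow> (\<And>a. 0 \<le> m a) \<Longrightarrow>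
       ball_density \<epsilon> A m y \<le> K * (\<Sum>a\<in>A. m a * gauss (\<epsilon>\<^sup>2 / 2) (y - a))"
proof -
  define U where "U = unit_ball_vol (DIM('a))"
  have U: "U > 0" by (simp add: U_def)
  define K where "K = exp 1 * pi powr (DIM('a) / 2) / U"
  have "K > 0" using U by (simp add: K_def)
  moreover have "ball_density \<epsilon> A m y \<le> K * (\<Sum>a\<in>A. m a * gauss (\<epsilon>\<^sup>2 / 2) (y - a))"
    if \<epsilon>: "\<epsilon> > 0" and m: "\<And>a. 0 \<le> m a" for \<epsilon> and A :: "'a set" and m y
    unfolding ball_density_def sum_distrib_left
  proof (intro sum_mono)
    fix a assume "a \<in> A"
    have "indicator (cball a \<epsilon>) y / measure lborel (cball (0::'a) \<epsilon>) \<le> K * gauss (\<epsilon>\<^sup>2 / 2) (y - a)"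
    proof (cases "y \<in> cball a \<epsilon>")
      case True
      then have "(norm (y - a))\<^sup>2 \<le> \<epsilon>\<^sup>2" by (intro power_mono) (auto simp: dist_norm norm_minus_commute)
      then have e: "exp (- 1) \<le> exp (- ((norm (y - a))\<^sup>2 / (2 * (\<epsilon>\<^sup>2 / 2))))" using \<epsilon> by simp
      have pw: "(2 * pi * (\<epsilon>\<^sup>2 / 2)) powr (DIM('a) / 2) = pi powr (DIM('a) / 2) * \<epsilon> ^ DIM('a)"
      proof -
        have "(2 * pi * (\<epsilon>\<^sup>2 / 2)) powr (DIM('a) / 2) = pi powr (DIM('a) / 2) * (\<epsilon>\<^sup>2) powr (DIM('a) / 2)"
          by (simp add: powr_mult)
        also have "(\<epsilon>\<^sup>2) powr (DIM('a) / 2) = \<epsilon> powr (2 * (DIM('a) / 2))"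
          using \<epsilon> by (subst powr_numeral[symmetric]) (auto simp only: powr_powr)
        also have "\<epsilon> powr (2 * (DIM('a) / 2)) = \<epsilon> ^ DIM('a)" using \<epsilon> by (simp add: powr_realpow)
        finally show ?thesis .
      qed
      have "1 / (U * \<epsilon> ^ DIM('a)) = K * (exp (- 1) / (pi powr (DIM('a) / 2) * \<epsilon> ^ DIM('a)))"
        using U \<epsilon> by (simp add: K_def exp_minus field_simps)
      also have "\<dots> \<le> K * gauss (\<epsilon>\<^sup>2 / 2) (y - a)"
        unfolding gauss_def pw using e \<open>K > 0\<close> \<epsilon> by (intro mult_left_mono divide_right_mono) auto
      finally show ?thesis using True \<epsilon> by (simp add: content_cball U_def)
    next
      case False
      then show ?thesis using \<open>K > 0\<close> by simp
    qed
    then have "m a * (indicator (cball a \<epsilon>) y / measure lborel (cball (0::'a) \<epsilon>)) \<le> m a * (K * gauss (\<epsilon>\<^sup>2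
      / 2) (y - a))"
      using m by (intro mult_left_mono) auto
    then show "m a * (indicator (cball a \<epsilon>) y / measure lborel (cball (0::'a) \<epsilon>)) \<le> K * (m a * gauss (\<epsilon>\<^sup>2
      / 2) (y - a))"
      by (simp add: mult_ac)
  qed
  ultimately show ?thesis by (rule that)
qed

text \<open>The overlap of two Gaussians is a Gaussian in the difference of their centres
  \<open>reflect w (a - z)\<close> and \<open>reflect w' (b - z')\<close>. Applying the isometry
  \<open>reflect w'\<close> to this difference brings it into the form of
  \<open>mixture\<close>.\<close>

lemma nn_integral_ball_density_pair:
  fixes A :: "'a::euclidean_space set"
  assumes \<epsilon>: "\<epsilon> > 0" and m: "\<And>a. 0 \<le> m a" and K: "K > 0"
    and le: "\<And>y. ball_density \<epsilon> A m y \<le> K * (\<Sum>a\<in>A. m a * gauss (\<epsilon>\<^sup>2 / 2) (y - a))"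
  shows "(\<integral>\<^sup>+y. ennreal (ball_density \<epsilon> A m (reflect w y + z)) * ennreal (ball_density \<epsilon> A m (reflect w' y
    + z')) \<partial>lborel)
    \<le> ennreal (K\<^sup>2 * mixture (\<epsilon>\<^sup>2) A m w' w (z' - reflect w' (reflect w z)))"
proof -
  define t where "t = \<epsilon>\<^sup>2 / 2"
  have t: "t > 0" "t + t = \<epsilon>\<^sup>2" using \<epsilon> by (auto simp: t_def)
  have nonneg: "0 \<le> ball_density \<epsilon> A m y" for y
    unfolding ball_density_def using m by (intro sum_nonneg) auto
  have g: "gauss t (reflect w y + z - a) = gauss t (y - reflect w (a - z))" for w y z a :: 'a
  proof -
    have "norm (reflect w y + z - a) = norm (reflect w (reflect w y + z - a))" by simp
    also have "reflect w (reflect w y + z - a) = y - reflect w (a - z)"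
      by (simp add: reflect_diff reflect_add algebra_simps)
    finally show ?thesis by (simp add: gauss_def)
  qed
  have g2: "gauss (t + t) (reflect w (a - z) - reflect w' (b - z')) =
     gauss (\<epsilon>\<^sup>2) (z' - reflect w' (reflect w z) - (b - reflect w' (reflect w a)))" for a b
  proof -
    have "norm (reflect w (a - z) - reflect w' (b - z')) = norm (reflect w' (reflect w (a - z) - reflect w'
      (b - z')))" by simp
    also have "reflect w' (reflect w (a - z) - reflect w' (b - z')) = z' - reflect w' (reflect w z) -
      (b - reflect w' (reflect w a))"
      by (simp only: reflect_diff reflect_reflect) simp
    finally show ?thesis unfolding t(2) by (simp add: gauss_def)
  qed
  have "(\<integral>\<^sup>+y. ennreal (ball_density \<epsilon> A m (reflect w y + z)) * ennreal (ball_density \<epsilon> A m (reflect w' y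
    + z')) \<partial>lborel)
    \<le> (\<integral>\<^sup>+y. ennreal (K\<^sup>2 * (\<Sum>a\<in>A. \<Sum>b\<in>A. (m a * m b) * (gauss t (y - reflect w (a - z)) * gauss t
      (y - reflect w' (b - z'))))) \<partial>lborel)"
  proof (intro nn_integral_mono)
    fix y
    have "ball_density \<epsilon> A m (reflect w y + z) * ball_density \<epsilon> A m (reflect w' y + z') \<le>
       (K * (\<Sum>a\<in>A. m a * gauss t (reflect w y + z - a))) * (K * (\<Sum>b\<in>A. m b * gauss t (reflect w' y + z' - b)))"
      unfolding t_def using nonneg K m by (intro mult_mono le mult_nonneg_nonneg sum_nonneg) auto
    also have "\<dots> = K\<^sup>2 * ((\<Sum>a\<in>A. m a * gauss t (reflect w y + z - a)) * (\<Sum>b\<in>A. m b * gauss t (reflect w' y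
      + z' - b)))"
      by (simp add: power2_eq_square mult_ac)
    also have "\<dots> = K\<^sup>2 * (\<Sum>a\<in>A. \<Sum>b\<in>A. (m a * m b) * (gauss t (y - reflect w (a - z)) * gauss t
      (y - reflect w' (b - z'))))"
    proof -
      have "(p * q) * (r * s) = (p * r) * (q * s)" for p q r s :: real by simp
      then show ?thesis
        unfolding sum_product g by (intro arg_cong[where f="\<lambda>X. K\<^sup>2 * X"] sum.cong refl)
    qed
    finally show "ennreal (ball_density \<epsilon> A m (reflect w y + z)) * ennreal (ball_density \<epsilon> A m (reflect w' y
      + z'))
      \<le> ennreal (K\<^sup>2 * (\<Sum>a\<in>A. \<Sum>b\<in>A. (m a * m b) * (gauss t (y - reflect w (a - z)) * gauss t (y - reflect w'
        (b - z')))))"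
      using nonneg by (simp add: ennreal_leI flip: ennreal_mult)
  qed
  also have "\<dots> = ennreal (K\<^sup>2 * (\<Sum>a\<in>A. \<Sum>b\<in>A. (m a * m b) * gauss (t + t) (reflect w (a - z) - reflect w'
    (b - z'))))"
  proof -
    have "has_bochner_integral lborel (\<lambda>y. K\<^sup>2 * (\<Sum>a\<in>A. \<Sum>b\<in>A. (m a * m b) * (gauss t (y - reflect w (a - z))
      * gauss t (y - reflect w' (b - z')))))
       (K\<^sup>2 * (\<Sum>a\<in>A. \<Sum>b\<in>A. (m a * m b) * gauss (t + t) (reflect w (a - z) - reflect w' (b - z'))))"
      by (intro has_bochner_integral_mult_right has_bochner_integral_sum has_bochner_integral_gauss_mult t)
    then show ?thesis
      using m by (subst nn_integral_eq_integral)
        (auto simp: has_bochner_integral_iff intro!: AE_I2 mult_nonneg_nonneg sum_nonneg)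
  qed
  also have "(\<Sum>a\<in>A. \<Sum>b\<in>A. (m a * m b) * gauss (t + t) (reflect w (a - z) - reflect w' (b - z'))) =
     mixture (\<epsilon>\<^sup>2) A m w' w (z' - reflect w' (reflect w z))"
    unfolding g2 mixture_def sum.cartesian_product by (intro sum.cong) auto
  finally show ?thesis .
qed

text \<open>The square becomes an integral over two isometries. Integrating over \<open>x\<close>
  first, it factors over the vertices into \<open>CARD('v)\<close> equal overlaps, which is where
  the power of \<open>mixture\<close> comes from.\<close>

lemma nn_integral_ball_density_product_square:
  fixes A :: "'a::euclidean_space set" and c0 :: 'a and Z :: "'a set"
  assumes \<epsilon>: "\<epsilon> > 0" and m: "\<And>a. 0 \<le> m a" and K: "K > 0"
    and le: "\<And>y. ball_density \<epsilon> A m y \<le> K * (\<Sum>a\<in>A. m a * gauss (\<epsilon>\<^sup>2 / 2) (y - a))"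
    and D: "D \<in> sets borel" and Z: "Z \<in> sets borel"
    and B: "\<And>w'. (\<integral>\<^sup>+w. indicator D w * (\<integral>\<^sup>+x. ennreal (mixture (\<epsilon>\<^sup>2) A m w' w x ^ CARD('v::finite))
      \<partial>lborel) \<partial>lborel) \<le> ennreal B"
  defines "F \<equiv> \<lambda>w z (x :: 'a^'v). \<Prod>i\<in>UNIV. ennreal (ball_density \<epsilon> A m (reflect w (x $ i) + z))"
  shows "(\<integral>\<^sup>+x. (\<integral>\<^sup>+w. indicator D w * (\<integral>\<^sup>+z. indicator Z z * F w z x \<partial>lborel) \<partial>lborel)\<^sup>2 \<partial>lborel)
    \<le> emeasure lborel D * (emeasure lborel Z * (ennreal ((K\<^sup>2) ^ CARD('v)) * ennreal B))"
proof -
  have [measurable]: "D \<in> sets borel" "Z \<in> sets borel" by fact+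
  have [measurable]: "(\<lambda>q. F (f q) (g q) (h q)) \<in> borel_measurable Q"
    if [measurable]: "f \<in> borel_measurable Q" "g \<in> borel_measurable Q" "h \<in> borel_measurable Q"
    for Q and f g :: "'q \<Rightarrow> 'a" and h
    unfolding F_def by measurable
  let ?D = "indicator D :: 'a \<Rightarrow> ennreal" and ?Z = "indicator Z :: 'a \<Rightarrow> ennreal"
  let ?N = "\<lambda>w' w x. ennreal (mixture (\<epsilon>\<^sup>2) A m w' w x ^ CARD('v))" and ?K = "ennreal ((K\<^sup>2) ^ CARD('v))"
  let ?b = "\<lambda>w z y. ennreal (ball_density \<epsilon> A m (reflect w y + z))"
  define \<Lambda> where "\<Lambda> x = (\<integral>\<^sup>+w. ?D w * (\<integral>\<^sup>+z. ?Z z * F w z x \<partial>lborel) \<partial>lborel)" for x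
  have \<Lambda>_swap: "\<Lambda> x = (\<integral>\<^sup>+z. ?Z z * (\<integral>\<^sup>+w. ?D w * F w z x \<partial>lborel) \<partial>lborel)" for x
  proof -
    have "\<Lambda> x = (\<integral>\<^sup>+w. (\<integral>\<^sup>+z. ?Z z * (?D w * F w z x) \<partial>lborel) \<partial>lborel)"
      unfolding \<Lambda>_def by (intro nn_integral_cong) (simp add: nn_integral_cmult[symmetric] mult.left_commute)
    also have "\<dots> = (\<integral>\<^sup>+z. (\<integral>\<^sup>+w. ?Z z * (?D w * F w z x) \<partial>lborel) \<partial>lborel)"
      by (rule lborel_pair.Fubini') measurable
    finally show ?thesis by (simp add: nn_integral_cmult)
  qed
  \<comment> \<open>The order \<open>w'\<close>, \<open>z\<close>, \<open>w\<close>,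
    \<open>z'\<close> is deliberate: the innermost translation becomes the variable of
    \<open>mixture\<close>, and the average over \<open>w\<close> with \<open>w'\<close> fixed is
    the one bounded by \<open>B\<close>.\<close>
  have sq: "(\<Lambda> x)\<^sup>2 = (\<integral>\<^sup>+w'. (\<integral>\<^sup>+z. (\<integral>\<^sup>+w. (\<integral>\<^sup>+z'. ?D w' * ?Z z * ?D w * ?Z z' * (F w z x * F w' z' x)
    \<partial>lborel) \<partial>lborel) \<partial>lborel) \<partial>lborel)" for x
  proof -
    have "(\<integral>\<^sup>+z'. ?D w' * ?Z z * ?D w * ?Z z' * (F w z x * F w' z' x) \<partial>lborel) =
      ?D w' * (\<integral>\<^sup>+z'. ?Z z' * F w' z' x \<partial>lborel) * (?Z z * (?D w * F w z x))" for w' z w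
      by (simp add: mult_ac flip: nn_integral_cmult)
    then have "(\<integral>\<^sup>+w'. (\<integral>\<^sup>+z. (\<integral>\<^sup>+w. (\<integral>\<^sup>+z'. ?D w' * ?Z z * ?D w * ?Z z' * (F w z x * F w' z' x) \<partial>lborel)
      \<partial>lborel) \<partial>lborel) \<partial>lborel)
      = (\<integral>\<^sup>+w'. ?D w' * (\<integral>\<^sup>+z'. ?Z z' * F w' z' x \<partial>lborel) * \<Lambda> x \<partial>lborel)"
      by (simp add: nn_integral_cmult \<Lambda>_swap)
    also have "\<dots> = \<Lambda> x * \<Lambda> x" by (simp add: nn_integral_multc \<Lambda>_def)
    finally show ?thesis by (simp add: power2_eq_square)
  qed
  have inner: "(\<integral>\<^sup>+x. F w z x * F w' z' x \<partial>lborel) \<le> ?K * ?N w' w (z' + (- reflect w' (reflect w z)))"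
    for w z w' z'
  proof -
    have "(\<integral>\<^sup>+x. F w z x * F w' z' x \<partial>lborel) = (\<integral>\<^sup>+x. (\<Prod>i\<in>UNIV. (\<lambda>y. ?b w z y * ?b w' z' y) (x $ i))
      \<partial>(lborel :: ('a^'v) measure))"
      by (simp add: F_def prod.distrib)
    also have "\<dots> = (\<Prod>i\<in>(UNIV::'v set). \<integral>\<^sup>+y. ?b w z y * ?b w' z' y \<partial>lborel)"
      by (rule nn_integral_vec_prod) measurable
    also have "\<dots> \<le> (\<Prod>i\<in>(UNIV::'v set). ennreal (K\<^sup>2 * mixture (\<epsilon>\<^sup>2) A m w' w (z' - reflect w' (reflect w z))))"
    proof -
      have "a ^ j \<le> b ^ j" if "a \<le> b" for a b :: ennreal and j
        using that by (induction j) (auto intro: mult_mono)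
      then show ?thesis
        unfolding prod_constant by (simp add: nn_integral_ball_density_pair \<epsilon> m K le)
    qed
    also have "\<dots> = ?K * ?N w' w (z' + (- reflect w' (reflect w z)))"
      using mixture_nonneg[of m] m by (simp add: ennreal_power power_mult_distrib flip: ennreal_mult)
    finally show ?thesis .
  qed
  have "(\<integral>\<^sup>+x. (\<Lambda> x)\<^sup>2 \<partial>lborel) = (\<integral>\<^sup>+w'. (\<integral>\<^sup>+z. (\<integral>\<^sup>+w. (\<integral>\<^sup>+z'. (\<integral>\<^sup>+x. ?D w' * ?Z z * ?D w * ?Z z' *
    (F w z x * F w' z' x) \<partial>lborel) \<partial>lborel) \<partial>lborel) \<partial>lborel) \<partial>lborel)"
    unfolding sq
    apply (subst lborel_pair.Fubini', measurable)
    apply (intro nn_integral_cong)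
    apply (subst lborel_pair.Fubini', measurable)
    apply (intro nn_integral_cong)
    apply (subst lborel_pair.Fubini', measurable)
    apply (intro nn_integral_cong)
    apply (subst lborel_pair.Fubini', measurable)
    done
  also have "\<dots> = (\<integral>\<^sup>+w'. (\<integral>\<^sup>+z. (\<integral>\<^sup>+w. (\<integral>\<^sup>+z'. ?D w' * ?Z z * ?D w * ?Z z' * (\<integral>\<^sup>+x. F w z x * F w' z' x
    \<partial>lborel) \<partial>lborel) \<partial>lborel) \<partial>lborel) \<partial>lborel)"
    by (simp add: nn_integral_cmult)
  also have "\<dots> \<le> (\<integral>\<^sup>+w'. (\<integral>\<^sup>+z. (\<integral>\<^sup>+w. (\<integral>\<^sup>+z'. ?D w' * ?Z z * ?D w * ?Z z' *
     (?K * ?N w' w (z' + (- reflect w' (reflect w z)))) \<partial>lborel) \<partial>lborel) \<partial>lborel) \<partial>lborel)"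
    by (intro nn_integral_mono mult_left_mono inner) auto
  also have "\<dots> \<le> (\<integral>\<^sup>+w'. (\<integral>\<^sup>+z. (\<integral>\<^sup>+w. (?D w' * ?Z z * ?K) * (?D w *
     (\<integral>\<^sup>+x. ?N w' w x \<partial>lborel)) \<partial>lborel) \<partial>lborel) \<partial>lborel)"
  proof (intro nn_integral_mono)
    fix w' z w :: 'a
    \<comment> \<open>The restriction of \<open>z'\<close> to \<open>Z\<close> is dropped, so that
      translation invariance removes the dependence of \<open>mixture\<close> on
      \<open>z\<close>.\<close>
    have "(\<integral>\<^sup>+z'. ?D w' * ?Z z * ?D w * ?Z z' * (?K * ?N w' w (z' + (- reflect w' (reflect w z)))) \<partial>lborel)
      \<le> (\<integral>\<^sup>+z'. (?D w' * ?Z z * ?K * ?D w) * ?N w' w (z' + (- reflect w' (reflect w z))) \<partial>lborel)"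
      by (intro nn_integral_mono) (auto split: split_indicator)
    also have "\<dots> = (?D w' * ?Z z * ?K * ?D w) * (\<integral>\<^sup>+z'. ?N w' w (z' + (- reflect w' (reflect w z))) \<partial>lborel)"
      by (rule nn_integral_cmult) measurable
    also have "(\<integral>\<^sup>+z'. ?N w' w (z' + (- reflect w' (reflect w z))) \<partial>lborel) = (\<integral>\<^sup>+x. ?N w' w x \<partial>lborel)"
      by (rule nn_integral_lborel_translate) measurable
    finally show "(\<integral>\<^sup>+z'. ?D w' * ?Z z * ?D w * ?Z z' * (?K * ?N w' w (z' + (- reflect w' (reflect w z))))
      \<partial>lborel)
      \<le> (?D w' * ?Z z * ?K) * (?D w * (\<integral>\<^sup>+x. ?N w' w x \<partial>lborel))"
      by (simp only: mult.assoc)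
  qed
  also have "\<dots> = (\<integral>\<^sup>+w'. (\<integral>\<^sup>+z. (?D w' * ?Z z * ?K) * (\<integral>\<^sup>+w. ?D w *
     (\<integral>\<^sup>+x. ?N w' w x \<partial>lborel) \<partial>lborel) \<partial>lborel) \<partial>lborel)"
    by (intro nn_integral_cong nn_integral_cmult) measurable
  also have "\<dots> \<le> (\<integral>\<^sup>+w'. (\<integral>\<^sup>+z. (?D w' * ?Z z * ?K) * ennreal B \<partial>lborel) \<partial>lborel)"
    by (intro nn_integral_mono mult_left_mono B) auto
  also have "\<dots> = emeasure lborel D * (emeasure lborel Z * (?K * ennreal B))"
    by (simp add: mult.assoc nn_integral_cmult nn_integral_multc)
  finally show ?thesis unfolding \<Lambda>_def .
qed

text \<open>At each scale the averaged density has mass bounded below and square integral bounded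
  above, uniformly in \<open>n\<close>, and it vanishes off \<open>Y n\<close>; Cauchy--Schwarz then
  bounds the measure of \<open>Y n\<close> from below. The compact sets \<open>Y n\<close> decrease,
  so the bound passes to their intersection, whose tuples have copies in \<open>E\<close> by
  compactness of the set of isometries used.\<close>

lemma congruent_tuples_measure_pos:
  fixes E :: "'a::euclidean_space set" and s :: real
  assumes dim: "DIM('a) \<ge> 2" and E: "compact E" and p: "CARD('v::finite) \<ge> 2"
    and s: "0 < s" "s \<le> DIM('a)" "ereal s < hausdorff_dim E" "real CARD('v) * (DIM('a) - s) < 1"
  shows "\<exists>Y \<in> sets borel. 0 < emeasure lborel (Y :: ('a^'v) set) \<and>
     (\<forall>x\<in>Y. \<exists>w z. \<forall>i. reflect w (x $ i) + z \<in> E)"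
proof -
  obtain C0 c where C0: "C0 > 0" "c > 0"
    "\<And>n. \<exists>A m. finite A \<and> A \<subseteq> E \<and> (\<forall>a. 0 \<le> m a) \<and> c \<le> sum m A \<and>
       (\<forall>x r. (1/2) ^ n \<le> r \<longrightarrow> sum m (A \<inter> cball x r) \<le> C0 * r powr s)"
    using frostman_finite_scale[OF E s(1,3)] by blast
  obtain R0 where R0: "R0 \<ge> 1" "\<And>x. x \<in> E \<Longrightarrow> norm x \<le> R0"
  proof -
    obtain b where "\<forall>x\<in>E. norm x \<le> b" using compact_imp_bounded[OF E] by (auto simp: bounded_iff)
    then show ?thesis by (intro that[of "max 1 b"]) auto
  qed
  define C where "C = max R0 (max C0 (C0 * R0 powr s))"
  have C: "C \<ge> 0" "R0 \<le> C" "C0 \<le> C" "C0 * R0 powr s \<le> C" using R0 by (auto simp: C_def)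
  have atoms: "\<exists>A m. frostman C s n A m \<and> A \<subseteq> E \<and> c \<le> sum m A" for n
  proof -
    obtain A m where A: "finite A" "A \<subseteq> E" "\<forall>a. 0 \<le> m a" "c \<le> sum m A"
      "\<And>x r. (1/2) ^ n \<le> r \<Longrightarrow> sum m (A \<inter> cball x r) \<le> C0 * r powr s"
      using C0(3)[of n] by blast
    have "A \<inter> cball 0 R0 = A" using A(2) R0(2) by auto
    moreover have "(1/2)^n \<le> (1::real)" by (simp add: power_le_one)
    then have "(1/2)^n \<le> R0" using R0(1) by linarith
    ultimately have "sum m A \<le> C" using A(5)[of R0 0] C by auto
    moreover have "sum m (A \<inter> cball x r) \<le> C * r powr s" if "(1/2)^n \<le> r" for x r
      using A(5)[OF that, of x] mult_right_mono[OF C(3), of "r powr s"] by simp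
    ultimately have "frostman C s n A m"
      using A(1-3) R0(2) C(2) unfolding frostman_def by fastforce
    then show ?thesis using A by blast
  qed
  obtain b :: 'a where "b \<in> Basis" using nonempty_Basis by blast
  \<comment> \<open>Norm 2 keeps the ball \<open>D\<close> of radius 1 away from the origin, where
    \<open>reflect\<close> is discontinuous in \<open>w\<close>.\<close>
  define c0 where "c0 = 2 *\<^sub>R b"
  have c0: "norm c0 = 2" using \<open>b \<in> Basis\<close> by (simp add: c0_def)
  define D where "D = cball c0 1"
  define Z :: "'a set" where "Z = cball 0 1"
  have DZ[measurable]: "D \<in> sets borel" "Z \<in> sets borel" by (auto simp: D_def Z_def)
  obtain B where B: "B > 0"
    "\<And>n (A::'a set) m w'. frostman C s n A m \<Longrightarrow>
       (\<integral>\<^sup>+w. indicator D w * (\<integral>\<^sup>+x. ennreal (mixture ((1/4)^n) A m w' w x ^ CARD('v)) \<partial>lborel) \<partial>lborel)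
         \<le> ennreal B"
    using averaged_Lp[OF dim c0 C(1) s(1,2) p s(4)] unfolding D_def by blast
  obtain K where K: "K > 0"
    "\<And>\<epsilon> (A::'a set) m y. \<epsilon> > 0 \<Longrightarrow> (\<And>a. 0 \<le> m a) \<Longrightarrow>
       ball_density \<epsilon> A m y \<le> K * (\<Sum>a\<in>A. m a * gauss (\<epsilon>\<^sup>2 / 2) (y - a))"
    using ball_density_le_gauss by blast
  define VD where "VD = measure lborel D"
  define VZ where "VZ = measure lborel Z"
  have "emeasure lborel D < \<infinity>" "emeasure lborel Z < \<infinity>"
    unfolding D_def Z_def by (rule emeasure_bounded_finite, simp)+
  then have VD: "emeasure lborel D = ennreal VD" "VD > 0" and VZ: "emeasure lborel Z = ennreal VZ" "VZ > 0"
    by (auto simp: VD_def VZ_def D_def Z_def content_cball_pos intro!: emeasure_eq_ennreal_measure)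
  define N where "N = CARD('v)"
  have N: "N > 0" by (simp add: N_def)
  \<comment> \<open>Each contributing vertex has norm at most \<open>R0 + 2\<close>: the bound for
    \<open>E\<close>, plus a smoothing radius of at most 1, plus a translation of norm at most
    1.\<close>
  define X :: "('a^'v) set" where "X = cball 0 (real N * (R0 + 2))"
  define g where "g = (\<lambda>(x :: 'a^'v, w, z). \<Sum>i\<in>UNIV. infdist (reflect w (x $ i) + z) E)"
  define S where "S \<eta> = {q \<in> X \<times> (D \<times> Z). g q \<le> \<eta>}" for \<eta>
  have D0: "w \<noteq> 0" if "w \<in> D" for w using that c0 by (auto simp: D_def)
  have cont: "continuous_on (X \<times> (D \<times> Z)) g"
    unfolding g_def reflect_def case_prod_unfold
    by (intro continuous_intros) (use D0 in auto)
  have cK: "compact (X \<times> (D \<times> Z))" by (auto simp: X_def D_def Z_def intro!: compact_Times)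
  have cS: "compact (S \<eta>)" for \<eta>
  proof -
    have "closedin (top_of_set (X \<times> (D \<times> Z))) ((X \<times> (D \<times> Z)) \<inter> g -` {..\<eta>})"
      using cont by (rule continuous_closedin_preimage) simp
    moreover have "(X \<times> (D \<times> Z)) \<inter> g -` {..\<eta>} = S \<eta>" by (auto simp: S_def)
    ultimately show ?thesis using closedin_compact[OF cK] by simp
  qed
  define \<epsilon> where "\<epsilon> n = (1/2::real)^n" for n :: nat
  have \<epsilon>: "\<epsilon> n > 0" "\<epsilon> n \<le> 1" "(\<epsilon> n)\<^sup>2 = (1/4)^n" for n
    by (auto simp: \<epsilon>_def power_le_one power2_eq_square simp flip: power_mult_distrib)
  \<comment> \<open>Each of the \<open>N\<close> vertices may contribute a distance of
    \<open>\<epsilon> n\<close> to \<open>g\<close>.\<close>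
  define Y where "Y n = fst ` S (real N * \<epsilon> n)" for n
  have cY: "compact (Y n)" for n
    unfolding Y_def by (intro compact_continuous_image cS continuous_intros)
  have decS: "S (real N * \<epsilon> n') \<subseteq> S (real N * \<epsilon> n)" if "n \<le> n'" for n n'
  proof -
    have "\<epsilon> n' \<le> \<epsilon> n" unfolding \<epsilon>_def using that by (intro power_decreasing) auto
    then have "real N * \<epsilon> n' \<le> real N * \<epsilon> n" by (intro mult_left_mono) auto
    then show ?thesis unfolding S_def by fastforce
  qed
  define \<beta> where "\<beta> = (VD * VZ) * c ^ N * c ^ N / ((K\<^sup>2) ^ N * B)"
  have \<beta>: "\<beta> > 0" using VD VZ C0 K B by (simp add: \<beta>_def)
  have lower: "ennreal \<beta> \<le> emeasure lborel (Y n)" for n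
  proof -
    obtain A m where A: "frostman C s n A m" "A \<subseteq> E" "c \<le> sum m A" using atoms by blast
    have m: "\<And>a. 0 \<le> m a" and fA: "finite A" using A(1) by (auto simp: frostman_def)
    define F where "F w z x = (\<Prod>i\<in>UNIV. ennreal (ball_density (\<epsilon> n) A m (reflect w (x $ i) + z)))" for w z
      and x :: "'a^'v"
    have [measurable]: "(\<lambda>q. F (f q) (g q) (h q)) \<in> borel_measurable Q"
      if [measurable]: "f \<in> borel_measurable Q" "g \<in> borel_measurable Q" "h \<in> borel_measurable Q"
      for Q and f g :: "'q \<Rightarrow> 'a" and h
      unfolding F_def by measurable
    define \<Lambda> where "\<Lambda> x = (\<integral>\<^sup>+w. indicator D w * (\<integral>\<^sup>+z. indicator Z z * F w z x \<partial>lborel) \<partial>lborel)" for x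
    have [measurable]: "\<Lambda> \<in> borel_measurable borel" unfolding \<Lambda>_def by measurable
    have [measurable]: "Y n \<in> sets borel" using cY by (simp add: borel_compact)
    have supp: "\<Lambda> x = 0" if "x \<notin> Y n" for x
    proof -
      have eq0: "indicator D w * (indicator Z z * F w z x) = 0" for w z
      proof (rule ccontr)
        assume nz: "\<not> ?thesis"
        then have wz: "w \<in> D" "z \<in> Z" "F w z x \<noteq> 0" by (auto simp: indicator_def split: if_splits)
        have near: "norm (x $ i) \<le> R0 + 2 \<and> infdist (reflect w (x $ i) + z) E \<le> \<epsilon> n" for i
        proof -
          have "\<forall>i. ennreal (ball_density (\<epsilon> n) A m (reflect w (x $ i) + z)) \<noteq> 0"
            using wz(3) by (auto simp: F_def prod_zero_iff)
          then have "ball_density (\<epsilon> n) A m (reflect w (x $ i) + z) \<noteq> 0"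
            by (metis ennreal_0)
          then obtain a where a: "a \<in> A" "reflect w (x $ i) + z \<in> cball a (\<epsilon> n)"
            unfolding ball_density_def by
              (auto elim!: sum.not_neutral_contains_not_neutral simp: indicator_def split: if_splits)
          then have "infdist (reflect w (x $ i) + z) E \<le> \<epsilon> n"
            using A(2) infdist_le2[of a E "reflect w (x $ i) + z" "\<epsilon> n"] by (auto simp: dist_commute)
          moreover have "norm (x $ i) \<le> R0 + 2"
          proof -
            have "norm (x $ i) = norm (reflect w (x $ i))" by simp
            also have "reflect w (x $ i) = ((reflect w (x $ i) + z) - a) + a - z" by simp
            also have "norm \<dots> \<le> norm ((reflect w (x $ i) + z) - a) + norm a + norm z"
              by (metis add_right_mono norm_triangle_ineq norm_triangle_ineq4 order_trans)
            also have "\<dots> \<le> \<epsilon> n + R0 + 1"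
              using a A(2) R0(2) wz(2) by (intro add_mono) (auto simp: Z_def dist_norm norm_minus_commute)
            finally show ?thesis using \<epsilon>(2)[of n] by simp
          qed
          ultimately show ?thesis by simp
        qed
        have "norm x \<le> (\<Sum>i\<in>UNIV. norm (x $ i))" unfolding norm_vec_def by (rule L2_set_le_sum) simp
        also have "\<dots> \<le> (\<Sum>i\<in>(UNIV::'v set). R0 + 2)" using near by (intro sum_mono) auto
        finally have "x \<in> X" by (simp add: X_def N_def)
        moreover have "g (x, w, z) \<le> (\<Sum>i\<in>(UNIV::'v set). \<epsilon> n)"
          unfolding g_def prod.case using near by (intro sum_mono) blast
        ultimately have "(x, w, z) \<in> S (real N * \<epsilon> n)" using wz by (simp add: S_def N_def)
        then show False using that unfolding Y_def by force
      qed
      have "\<Lambda> x = (\<integral>\<^sup>+w. (\<integral>\<^sup>+z. indicator D w * (indicator Z z * F w z x) \<partial>lborel) \<partial>lborel)"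
        unfolding \<Lambda>_def by (intro nn_integral_cong nn_integral_cmult[symmetric]) measurable
      also have "\<dots> = 0" by (simp only: eq0) simp
      finally show ?thesis .
    qed
    have "(\<integral>\<^sup>+x. F w z x \<partial>lborel) = ennreal (sum m A ^ N)" for w z
    proof -
      have "(\<integral>\<^sup>+x. F w z x \<partial>lborel) = (\<Prod>i\<in>(UNIV::'v set). \<integral>\<^sup>+y. ennreal (ball_density (\<epsilon> n) A m (reflect w y
        + z)) \<partial>lborel)"
        unfolding F_def by (rule nn_integral_vec_prod) measurable
      also have "\<dots> = ennreal (sum m A) ^ N"
      proof -
        have "(\<integral>\<^sup>+y. ennreal (ball_density (\<epsilon> n) A m (reflect w y + z)) \<partial>lborel) = ennreal (sum m A)"
          by (rule nn_integral_ball_density_isometry[OF \<epsilon>(1)]) (rule m)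
        then show ?thesis by (simp add: N_def)
      qed
      finally show ?thesis using m by (simp add: ennreal_power sum_nonneg)
    qed
    then have "(\<integral>\<^sup>+x. \<Lambda> x \<partial>lborel) = emeasure lborel D * (emeasure lborel Z * ennreal (sum m A ^ N))"
      unfolding \<Lambda>_def
      by (subst lborel_pair.Fubini', measurable)
        (simp add: nn_integral_cmult, subst lborel_pair.Fubini', measurable, simp add: nn_integral_cmult nn_integral_multc)
    also have "\<dots> = ennreal (VD * VZ * sum m A ^ N)"
      using VD VZ m by (simp add: ennreal_mult sum_nonneg mult.assoc)
    finally have "ennreal (VD * VZ * c ^ N) \<le> (\<integral>\<^sup>+x. \<Lambda> x \<partial>lborel)"
      using A(3) C0(2) VD VZ by (auto intro!: ennreal_leI mult_left_mono power_mono)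
    also have "\<dots> = (\<integral>\<^sup>+x. \<Lambda> x * indicator (Y n) x \<partial>lborel)"
      using supp by (intro nn_integral_cong) (auto split: split_indicator)
    finally have 1: "ennreal (VD * VZ * c ^ N) \<le> (\<integral>\<^sup>+x. \<Lambda> x * indicator (Y n) x \<partial>lborel)" .
    have "(ennreal (VD * VZ * c ^ N))\<^sup>2 \<le> (\<integral>\<^sup>+x. \<Lambda> x * indicator (Y n) x \<partial>lborel)\<^sup>2"
      using 1 by (simp add: power2_eq_square mult_mono)
    also have "\<dots> \<le> (\<integral>\<^sup>+x. (\<Lambda> x)\<^sup>2 \<partial>lborel) * (\<integral>\<^sup>+x. (indicator (Y n) x)\<^sup>2 \<partial>lborel)"
      by (rule Cauchy_Schwarz_nn_integral) measurable
    also have "(\<integral>\<^sup>+x. (indicator (Y n) x)\<^sup>2 \<partial>lborel) = emeasure lborel (Y n)"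
      by (subst nn_integral_indicator[symmetric], simp) (intro nn_integral_cong, simp split: split_indicator)
    also have "(\<integral>\<^sup>+x. (\<Lambda> x)\<^sup>2 \<partial>lborel) \<le> emeasure lborel D * (emeasure lborel Z * (ennreal
      ((K\<^sup>2) ^ CARD('v)) * ennreal B))"
      unfolding \<Lambda>_def F_def
      by (intro nn_integral_ball_density_product_square \<epsilon> m K DZ) (simp add: \<epsilon>(3) B(2)[OF A(1)])
    also have "\<dots> = ennreal (VD * VZ * ((K\<^sup>2) ^ N * B))"
      using VD VZ K B by (simp add: N_def ennreal_mult mult.assoc)
    finally have 2: "(ennreal (VD * VZ * c ^ N))\<^sup>2 \<le> ennreal (VD * VZ * ((K\<^sup>2) ^ N * B)) * emeasure lborel
      (Y n)"
      by (simp add: mult_right_mono)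
    have "emeasure lborel (Y n) < \<infinity>" by (rule emeasure_bounded_finite) (simp add: cY compact_imp_bounded)
    then obtain y where y: "emeasure lborel (Y n) = ennreal y" "y \<ge> 0"
      by (cases "emeasure lborel (Y n)") auto
    have "(VD * VZ * c ^ N)\<^sup>2 \<le> (VD * VZ * ((K\<^sup>2) ^ N * B)) * y"
      using 2 VD VZ C0 K B y by (simp add: ennreal_power flip: ennreal_mult)
    then have "\<beta> \<le> y"
      using VD VZ K B by (simp add: \<beta>_def divide_simps power2_eq_square mult_ac)
    then show ?thesis using y by (simp add: ennreal_leI)
  qed
  define T where "T = (\<Inter>n. Y n)"
  have Yb: "Y n \<in> sets lborel" for n using cY by (simp add: borel_compact)
  have decY: "decseq Y" unfolding decseq_def Y_def using decS by (auto intro!: image_mono)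
  have "emeasure lborel (Y n) \<noteq> \<infinity>" for n
    using emeasure_bounded_finite[OF compact_imp_bounded[OF cY[of n]]] by simp
  then have "(INF n. emeasure lborel (Y n)) = emeasure lborel T"
    unfolding T_def using Yb decY by (intro INF_emeasure_decseq) auto
  moreover have "ennreal \<beta> \<le> (INF n. emeasure lborel (Y n))" by (intro INF_greatest lower)
  ultimately have "ennreal \<beta> \<le> emeasure lborel T" by simp
  then have Tpos: "0 < emeasure lborel T" using \<beta> by (metis ennreal_less_zero_iff less_le_trans)
  have "\<exists>w z. \<forall>i. reflect w (x $ i) + z \<in> E" if x: "x \<in> T" for x
  proof -
    \<comment> \<open>The parameters of isometries that bring \<open>x\<close> close to
      \<open>E\<close> at scale \<open>n\<close>. These are nested nonempty compact sets, and a
      common point makes all distances to \<open>E\<close> vanish at once.\<close>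
    define Q where "Q n = ({x} \<times> UNIV) \<inter> S (real N * \<epsilon> n)" for n
    have "compact (Q n)" for n unfolding Q_def
      by (intro closed_Int_compact cS closed_Times) auto
    moreover have "Q n \<noteq> {}" for n using x unfolding T_def Y_def Q_def by force
    moreover have "Q n' \<subseteq> Q n" if "n \<le> n'" for n n' using decS[OF that] by (auto simp: Q_def)
    ultimately have "(\<Inter>n. Q n) \<noteq> {}" by (intro compact_nest) auto
    then obtain w z where wz: "\<And>n. (x, w, z) \<in> S (real N * \<epsilon> n)" by (force simp: Q_def)
    have gn: "g (x, w, z) \<le> real N * \<epsilon> n" for n using wz[of n] by (simp add: S_def)
    have "(\<lambda>n. real N * \<epsilon> n) \<longlonglongrightarrow> real N * 0"
      unfolding \<epsilon>_def by (intro tendsto_intros) auto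
    then have "g (x, w, z) \<le> 0" using gn by (intro LIMSEQ_le_const[of _ "real N * 0", simplified]) auto
    then have "(\<Sum>i\<in>UNIV. infdist (reflect w (x $ i) + z) E) = 0"
      unfolding g_def using sum_nonneg[of UNIV "\<lambda>i. infdist (reflect w (x $ i) + z) E"] by
        (simp add: infdist_nonneg)
    then have "infdist (reflect w (x $ i) + z) E = 0" for i
      by (subst (asm) sum_nonneg_eq_0_iff) (auto simp: infdist_nonneg)
    moreover have "E \<noteq> {}"
    proof
      assume "E = {}"
      moreover obtain A m where "A \<subseteq> E" "c \<le> sum m A" using atoms[of 0] by blast
      ultimately show False using C0(2) by simp
    qed
    ultimately show ?thesis
      using in_closed_iff_infdist_zero[OF compact_imp_closed[OF E]] by blast
  qed
  moreover have "T \<in> sets borel" unfolding T_def using Yb by (intro sets.countable_INT) auto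
  ultimately show ?thesis using Tpos by blast
qed

section \<open>Rigidity and distance maps\<close>

lemma set_lex_list [simp]: "set (lex_list S) = S"
  by (auto simp: lex_list_def)

lemma distinct_lex_list: "distinct (lex_list S)"
  unfolding lex_list_def by (intro distinct_filter distinct_product) auto

lemma length_lex_list: "length (lex_list S) = card S"
  using distinct_card[OF distinct_lex_list, of S] by simp

lemma sum_lex_list: "(\<Sum>i<card S. f (lex_list S ! i)) = (\<Sum>e\<in>S. f e)"
  using sum.reindex_bij_betw[OF bij_betw_nth[OF distinct_lex_list, of "{..<card S}" S S], of f]
  by (simp add: length_lex_list)

lemma edge_dist_square: "(edge_dist e y)\<^sup>2 = (y $ fst e - y $ snd e) \<bullet> (y $ fst e - y $ snd e)"
  by (simp add: edge_dist_def power2_norm_eq_inner)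

lemma has_derivative_edge_dist_square:
  "((\<lambda>y. (edge_dist e y)\<^sup>2) has_derivative (\<lambda>h. 2 * ((x $ fst e - x $ snd e) \<bullet> (h $ fst e - h $ snd e))))
    (at x)"
proof -
  have [derivative_intros]: "((\<lambda>y. y $ i) has_derivative (\<lambda>h. h $ i)) (at x)" for i
    by (rule bounded_linear.has_derivative[OF bounded_linear_vec_nth has_derivative_ident])
  show ?thesis
    unfolding edge_dist_square
    by (rule derivative_eq_intros refl | simp)+ (simp add: inner_commute fun_eq_iff)
qed

lemma axis_nth: "axis i y $ j = (if j = i then y else 0)"
  by (simp add: axis_def)

lemma DF_row_eq:
  "DF_row e x = axis (fst e) (2 *\<^sub>R (x $ fst e - x $ snd e)) - axis (snd e) (2 *\<^sub>R (x $ fst e - x $ snd e))"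
proof -
  have "frechet_derivative (\<lambda>y. (edge_dist e y)\<^sup>2) (at x) = (\<lambda>h. 2 * ((x $ fst e - x $ snd e) \<bullet>
    (h $ fst e - h $ snd e)))"
    by (rule frechet_derivative_at[symmetric, OF has_derivative_edge_dist_square])
  then show ?thesis
    by (auto simp: DF_row_def Finite_Cartesian_Product.vec_eq_iff axis_nth inner_diff_right inner_axis)
qed

lemma inner_DF_row: "DF_row e x \<bullet> u = 2 * ((x $ fst e - x $ snd e) \<bullet> (u $ fst e - u $ snd e))"
  by (simp add: DF_row_eq inner_diff_left inner_diff_right inner_axis' algebra_simps)

lemma DF_row_add: "DF_row e (x + y) = DF_row e x + DF_row e y"
  by (simp add: DF_row_eq Finite_Cartesian_Product.vec_eq_iff axis_nth algebra_simps)

lemma DF_row_scaleR: "DF_row e (c *\<^sub>R x) = c *\<^sub>R DF_row e x"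
  by (simp add: DF_row_eq Finite_Cartesian_Product.vec_eq_iff axis_nth algebra_simps)

text \<open>A nonzero \<open>P_edges\<close> provides a nonzero maximal minor. A linear relation
  among the rows, restricted to the columns of this minor, is a kernel vector of its transpose and
  therefore zero.\<close>

lemma generic_imp_indep_edges_at:
  fixes x :: "('d::{finite,linorder}, 'v::{finite,linorder}) tuple"
  assumes "generic x" and H: "H \<subseteq> complete_edges" "indep_edges TYPE(('d, 'v) tuple) H"
  shows "indep_edges_at H x"
proof (cases "H = {}")
  case True
  then show ?thesis by (simp add: indep_edges_at_def)
next
  case False
  then have "P_edges H x \<noteq> 0"
    using assms by (auto simp: generic_def P_total_def)
  then obtain C :: "('v \<times> 'd) set" where C: "card C = card H" "DF_minor H C x \<noteq> 0"
    unfolding P_edges_def by (auto elim!: sum.not_neutral_contains_not_neutral)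
  show ?thesis
    unfolding indep_edges_at_def
  proof (intro allI impI)
    fix a assume zero: "(\<Sum>e\<in>H. a e *\<^sub>R DF_row e x) = 0"
    define n where "n = card H"
    define A where "A = Matrix.mat n n (\<lambda>(i, j). DF_row (lex_list H ! i) x $ fst (lex_list C ! j) $ snd
      (lex_list C ! j))"
    define v where "v = Matrix.vec n (\<lambda>i. a (lex_list H ! i))"
    have vc: "v \<in> carrier_vec n" by (simp add: v_def)
    have A: "A \<in> carrier_mat n n" "transpose_mat A \<in> carrier_mat n n" by (auto simp: A_def)
    have "Determinant.det A \<noteq> 0" using C by (simp add: DF_minor_def A_def n_def)
    then have "Determinant.det (transpose_mat A) \<noteq> 0" using det_transpose[OF A(1)] by simp
    moreover have "transpose_mat A *\<^sub>v v = 0\<^sub>v n"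
    proof (rule Matrix.eq_vecI)
      fix j assume "j < dim_vec (0\<^sub>v n :: real Matrix.vec)"
      then have j: "j < n" by simp
      define p where "p = lex_list C ! j"
      have "Matrix.vec_index (transpose_mat A *\<^sub>v v) j = (\<Sum>i<n. DF_row (lex_list H ! i) x $ fst p $ snd p
        * a (lex_list H ! i))"
        using j by (simp add: A_def v_def Matrix.scalar_prod_def p_def atLeast0LessThan)
      also have "\<dots> = (\<Sum>e\<in>H. DF_row e x $ fst p $ snd p * a e)"
        unfolding n_def by (rule sum_lex_list)
      also have "\<dots> = (\<Sum>e\<in>H. a e *\<^sub>R DF_row e x) $ fst p $ snd p"
        by (simp add: mult.commute)
      finally show "Matrix.vec_index (transpose_mat A *\<^sub>v v) j = Matrix.vec_index (0\<^sub>v n) j"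
        using j by (simp add: zero)
    qed (simp add: A_def)
    ultimately have "v = 0\<^sub>v n"
      using det_0_iff_vec_prod_zero[OF A(2)] vc by blast
    then have *: "a (lex_list H ! i) = 0" if "i < n" for i
      using that by (metis index_vec index_zero_vec(1) v_def)
    show "\<forall>e\<in>H. a e = 0"
    proof
      fix e assume "e \<in> H"
      then obtain i where "i < n" "lex_list H ! i = e"
        by (metis in_set_conv_nth length_lex_list n_def set_lex_list)
      then show "a e = 0" using * by blast
    qed
  qed
qed

text \<open>In a dependence of the enlarged set the coefficient of \<open>e\<close> cannot vanish,
  so the row of \<open>e\<close> is a combination of rows of \<open>H\<close>, and \<open>u\<close>
  is orthogonal to all of these.\<close>

lemma DF_kernel_insert_dependent:
  assumes "indep_edges_at H x" "\<not> indep_edges_at (insert e H) x" "u \<in> DF_kernel H x"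
  shows "DF_row e x \<bullet> u = 0"
proof (cases "e \<in> H")
  case True
  then show ?thesis using assms(3) by (simp add: DF_kernel_def)
next
  case False
  have fin: "finite H" by simp
  obtain a where a: "(\<Sum>f\<in>insert e H. a f *\<^sub>R DF_row f x) = 0" "\<exists>f\<in>insert e H. a f \<noteq> 0"
    using assms(2) by (auto simp: indep_edges_at_def)
  then have sum: "a e *\<^sub>R DF_row e x + (\<Sum>f\<in>H. a f *\<^sub>R DF_row f x) = 0"
    using False by simp
  have "a e \<noteq> 0"
  proof
    assume "a e = 0"
    then have "(\<Sum>f\<in>H. a f *\<^sub>R DF_row f x) = 0" using sum by simp
    then have "\<forall>f\<in>H. a f = 0" using assms(1) by (simp add: indep_edges_at_def)
    then show False using a(2) \<open>a e = 0\<close> by auto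
  qed
  have "0 = (a e *\<^sub>R DF_row e x + (\<Sum>f\<in>H. a f *\<^sub>R DF_row f x)) \<bullet> u" using sum by simp
  also have "\<dots> = a e * (DF_row e x \<bullet> u) + (\<Sum>f\<in>H. a f * (DF_row f x \<bullet> u))"
    by (simp add: inner_add_left inner_sum_left)
  also have "(\<Sum>f\<in>H. a f * (DF_row f x \<bullet> u)) = 0"
    using assms(3) by (intro sum.neutral) (auto simp: DF_kernel_def)
  finally show ?thesis using \<open>a e \<noteq> 0\<close> by simp
qed

text \<open>A maximal independent subset of \<open>G\<close> has the same kernel as \<open>G\<close> at generic tuples, so minimality
  forces it to be all of \<open>G\<close>.\<close>

lemma min_inf_rigid_imp_indep_edges:
  fixes G :: "('v::{finite,linorder} \<times> 'v) set"
  assumes G: "G \<subseteq> complete_edges" and min: "min_inf_rigid TYPE(('d::{finite,linorder}, 'v) tuple) G"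
  shows "indep_edges TYPE(('d, 'v) tuple) G"
proof -
  define \<I> where "\<I> = {H. H \<subseteq> G \<and> indep_edges TYPE(('d, 'v) tuple) H}"
  have "{} \<in> \<I>" by (simp add: \<I>_def indep_edges_def indep_edges_at_def)
  then obtain H where H: "H \<in> \<I>" "\<And>H'. H' \<in> \<I> \<Longrightarrow> H \<subseteq> H' \<Longrightarrow> H' = H"
    using finite_has_maximal[of \<I>] by auto
  have HG: "H \<subseteq> G" "indep_edges TYPE(('d, 'v) tuple) H" using H(1) by (auto simp: \<I>_def)
  have "inf_rigid TYPE(('d, 'v) tuple) H"
    unfolding inf_rigid_def inf_rigid_framework_def
  proof (intro allI impI)
    fix x :: "('d, 'v) tuple" assume x: "generic x"
    have Hx: "indep_edges_at H x" using generic_imp_indep_edges_at[OF x] HG G by blast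
    have "DF_row e x \<bullet> u = 0" if e: "e \<in> G" and u: "u \<in> DF_kernel H x" for e u
    proof (cases "indep_edges_at (insert e H) x")
      case True
      then have "insert e H \<in> \<I>" using e HG by (auto simp: \<I>_def indep_edges_def)
      then have "e \<in> H" using H(2)[of "insert e H"] by auto
      then show ?thesis using u by (simp add: DF_kernel_def)
    next
      case False
      then show ?thesis using DF_kernel_insert_dependent[OF Hx _ u] by blast
    qed
    then have "DF_kernel H x = DF_kernel G x" using HG by (auto simp: DF_kernel_def)
    also have "\<dots> = DF_kernel complete_edges x"
      using min x by (auto simp: min_inf_rigid_def inf_rigid_def inf_rigid_framework_def)
    finally show "DF_kernel H x = DF_kernel complete_edges x" .
  qed
  then have "H = G" using min HG by (auto simp: min_inf_rigid_def)
  then show ?thesis using HG by simp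
qed

section \<open>Null sets under the squared distance map\<close>

lemma negligible_preimage_regular:
  fixes f :: "real^'m \<Rightarrow> real^'m" and J :: "real^'m \<Rightarrow> real^'m^'m"
  assumes f: "\<And>y. (f has_derivative (\<lambda>h. J y *v h)) (at y)" and J: "continuous_on UNIV J" and S: "negligible S"
  shows "negligible {y. f y \<in> S \<and> det (J y) \<noteq> 0}" (is "negligible ?W")
  unfolding locally_negligible_alt[of ?W]
proof
  fix y0 assume y0: "y0 \<in> ?W"
  define f' where "f' y = Blinfun (\<lambda>h. J y *v h)" for y
  have f': "blinfun_apply (f' y) = (\<lambda>h. J y *v h)" for y
    unfolding f'_def by (intro bounded_linear_Blinfun_apply) (simp add: linear_linear)
  obtain invJ where invJ: "invJ ** J y0 = mat 1"
    using y0 by (auto simp: invertible_det_nz[symmetric] invertible_def)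
  define invf where "invf = Blinfun (\<lambda>h. invJ *v h)"
  have invf: "blinfun_apply invf = (\<lambda>h. invJ *v h)"
    unfolding invf_def by (intro bounded_linear_Blinfun_apply) (simp add: linear_linear)
  have cont: "continuous_on UNIV f'"
  proof (rule continuous_on_blinfun_componentwise)
    fix i :: "real^'m"
    show "continuous_on UNIV (\<lambda>x. blinfun_apply (f' x) i)"
      unfolding f' matrix_vector_mult_def
      by (intro continuous_on_vec_lambda continuous_on_sum continuous_on_mult continuous_on_component continuous_on_const J)
  qed
  \<comment> \<open>Near \<open>y0\<close> the set is contained in the image of a part of
    \<open>S\<close> under the differentiable local inverse, and such images of null sets are null.
    Being negligible is a local property, so this suffices.\<close>
  obtain U V g g' where U: "open U" "y0 \<in> U" "homeomorphism U V f g"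
    "\<And>y. y \<in> V \<Longrightarrow> (g has_derivative (g' y)) (at y)"
  proof (rule inverse_function_theorem[of UNIV f f' y0 invf])
    show "invf o\<^sub>L f' y0 = id_blinfun"
      by (rule blinfun_eqI) (simp add: f' invf matrix_vector_mul_assoc invJ)
    fix U V g g'
    assume "open U" "y0 \<in> U" "homeomorphism U V f g" "\<And>y. y \<in> V \<Longrightarrow> (g has_derivative (g' y)) (at y)"
    then show thesis by (rule that)
  qed (use f cont in \<open>auto simp: f'\<close>)
  have "g differentiable_on S \<inter> V"
    unfolding differentiable_on_def differentiable_def using U(4) has_derivative_at_withinI by blast
  then have "negligible (g ` (S \<inter> V))"
    by (intro negligible_differentiable_image_negligible negligible_subset[OF S]) auto
  moreover have "?W \<inter> U \<subseteq> g ` (S \<inter> V)"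
  proof
    fix y assume "y \<in> ?W \<inter> U"
    then have "f y \<in> S \<inter> V" "y = g (f y)"
      using U(3) by (auto simp: homeomorphism_def)
    then show "y \<in> g ` (S \<inter> V)" by blast
  qed
  ultimately have "negligible (?W \<inter> U)" by (rule negligible_subset)
  then show "\<exists>W'. openin (top_of_set ?W) W' \<and> y0 \<in> W' \<and> negligible W'"
    using U y0 by (intro exI[of _ "?W \<inter> U"]) auto
qed

lemma poly_det:
  fixes Q :: "real poly^'m^'m"
  shows "poly (det Q) \<tau> = det (\<chi> a b. poly (Q $ a $ b) \<tau>)"
  by (simp add: Determinants.det_def poly_sum poly_prod)

text \<open>The determinant restricted to a line through \<open>x0\<close> is a nonzero polynomial.\<close>

lemma negligible_zeros_of_det_affine:
  fixes M :: "'x::euclidean_space \<Rightarrow> real^'m^'m" and x0 :: 'x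
  assumes lin: "linear M" and x0: "det (M x0) \<noteq> 0"
  shows "negligible {x. det (M x) = 0}"
proof -
  have contM: "continuous_on UNIV M" using lin linear_continuous_on linear_linear by blast
  have contD: "continuous_on UNIV (\<lambda>x. det (M x))"
    unfolding Determinants.det_def by (intro continuous_intros continuous_on_component contM)
  define Z where "Z = {h. det (M (x0 + h)) = 0}"
  have clZ: "closed Z"
  proof -
    have "continuous_on UNIV (\<lambda>h. det (M (x0 + h)))"
      by (rule continuous_on_compose2[OF contD]) (auto intro!: continuous_intros)
    then have "closed ((\<lambda>h. det (M (x0 + h))) -` {0})" by (intro continuous_closed_vimage)
      (auto simp: continuous_on_eq_continuous_at)
    then show ?thesis by (simp add: Z_def vimage_def)
  qed
  have [measurable]: "Z \<in> sets borel" using clZ by (rule borel_closed)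
  have fin: "finite {\<tau>::real. \<tau> *\<^sub>R h \<in> Z}" for h
  proof -
    \<comment> \<open>Along the line the matrix entries are affine in the parameter, so the
      determinant is the polynomial \<open>det Q\<close>, whose value at 0 is
      \<open>det (M x0)\<close>.\<close>
    define Q :: "real poly^'m^'m" where "Q = (\<chi> a b. [:M x0 $ a $ b, M h $ a $ b:])"
    have P: "poly (det Q) \<tau> = det (M (x0 + \<tau> *\<^sub>R h))" for \<tau>
    proof -
      have "(\<chi> a b. poly (Q $ a $ b) \<tau>) = M (x0 + \<tau> *\<^sub>R h)"
        using lin by (simp add: Q_def Finite_Cartesian_Product.vec_eq_iff linear_add linear_scale)
      then show ?thesis by (simp add: poly_det)
    qed
    from P[of 0] x0 have "det Q \<noteq> 0" by auto
    then have "finite {\<tau>. poly (det Q) \<tau> = 0}" by (rule poly_roots_finite)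
    then show ?thesis by (simp add: P Z_def)
  qed
  \<comment> \<open>Dilations replace polar coordinates: the measures of the dilates of
    \<open>Z\<close> are averaged over factors in [1, 2]. After exchanging integrals only the
    scalars with \<open>\<tau> *\<^sub>R h \<in> Z\<close> matter, which are finitely many for each
    \<open>h\<close>. Hence some dilate is null, and its factor can be inverted.\<close>
  have "(\<integral>\<^sup>+\<tau>. indicator {1..2} \<tau> * (\<integral>\<^sup>+h. indicator Z (\<tau> *\<^sub>R h) \<partial>lborel) \<partial>lborel) =
     (\<integral>\<^sup>+\<tau>. (\<integral>\<^sup>+h. indicator {1..2::real} \<tau> * indicator Z (\<tau> *\<^sub>R h) \<partial>lborel) \<partial>lborel)"
    by (intro nn_integral_cong nn_integral_cmult[symmetric]) measurable
  also have "\<dots> = (\<integral>\<^sup>+h. (\<integral>\<^sup>+\<tau>. indicator {1..2::real} \<tau> * indicator Z (\<tau> *\<^sub>R h) \<partial>lborel) \<partial>lborel)"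
    by (rule lborel_pair.Fubini') measurable
  also have "\<dots> = (\<integral>\<^sup>+h. 0 \<partial>(lborel :: 'x measure))"
  proof (intro nn_integral_cong)
    fix h :: 'x
    have "(\<integral>\<^sup>+\<tau>. indicator {1..2::real} \<tau> * indicator Z (\<tau> *\<^sub>R h) \<partial>lborel) \<le> (\<integral>\<^sup>+\<tau>. indicator {\<tau>. \<tau> *\<^sub>R h
      \<in> Z} \<tau> \<partial>lborel)"
      by (intro nn_integral_mono) (auto split: split_indicator)
    also have "\<dots> = emeasure lborel {\<tau>. \<tau> *\<^sub>R h \<in> Z}"
      using fin by (intro nn_integral_indicator) (simp add: finite_imp_closed borel_closed)
    also have "\<dots> = 0" using fin by (intro emeasure_lborel_countable countable_finite)
    finally show "(\<integral>\<^sup>+\<tau>. indicator {1..2::real} \<tau> * indicator Z (\<tau> *\<^sub>R h) \<partial>lborel) = 0" by simp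
  qed
  finally have "(\<integral>\<^sup>+\<tau>. indicator {1..2::real} \<tau> * (\<integral>\<^sup>+h. indicator Z (\<tau> *\<^sub>R h) \<partial>lborel) \<partial>lborel) = 0" by simp
  then have AE: "AE \<tau> in lborel. indicator {1..2::real} \<tau> * (\<integral>\<^sup>+h. indicator Z (\<tau> *\<^sub>R h) \<partial>lborel) = 0"
    by (subst (asm) nn_integral_0_iff_AE) measurable
  have "\<exists>\<tau>\<in>{1..2::real}. (\<integral>\<^sup>+h. indicator Z (\<tau> *\<^sub>R h) \<partial>lborel) = 0"
  proof (rule ccontr)
    assume "\<not> ?thesis"
    then have "AE \<tau> in lborel. \<tau> \<notin> {1..2::real}" using AE by
      (auto elim!: eventually_mono split: split_indicator_asm)
    then have "emeasure lborel {1..2::real} = 0" by (subst (asm) AE_iff_measurable[of "{1..2}"]) auto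
    then show False by simp
  qed
  then obtain \<tau> :: real where \<tau>: "\<tau> \<in> {1..2}" "(\<integral>\<^sup>+h. indicator Z (\<tau> *\<^sub>R h) \<partial>lborel) = 0" by blast
  define Z' where "Z' = {h. \<tau> *\<^sub>R h \<in> Z}"
  have clZ': "closed Z'"
  proof -
    have "closed ((\<lambda>h. \<tau> *\<^sub>R h) -` Z)" by (intro continuous_closed_vimage clZ) (auto intro!: continuous_intros)
    then show ?thesis by (simp add: Z'_def vimage_def)
  qed
  have "(\<integral>\<^sup>+h. indicator Z (\<tau> *\<^sub>R h) \<partial>lborel) = (\<integral>\<^sup>+h. indicator Z' h \<partial>lborel)"
    by (intro nn_integral_cong) (auto simp: Z'_def split: split_indicator)
  then have "emeasure lborel Z' = 0" using \<tau>(2) clZ' by (simp add: borel_closed)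
  then have "negligible Z'"
    using clZ' by (simp add: negligible_iff_emeasure0 borel_closed)
  then have "negligible ((\<lambda>h. x0 + \<tau> *\<^sub>R h) ` Z')"
    by (rule negligible_differentiable_image_negligible[OF order_refl]) (auto intro!: derivative_intros)
  moreover have "{x. det (M x) = 0} \<subseteq> (\<lambda>h. x0 + \<tau> *\<^sub>R h) ` Z'"
  proof
    fix x assume "x \<in> {x. det (M x) = 0}"
    then have "(x - x0) /\<^sub>R \<tau> \<in> Z'" "x = x0 + \<tau> *\<^sub>R ((x - x0) /\<^sub>R \<tau>)"
      using \<tau> by (auto simp: Z'_def Z_def)
    then show "x \<in> (\<lambda>h. x0 + \<tau> *\<^sub>R h) ` Z'" by blast
  qed
  ultimately show ?thesis by (rule negligible_subset)
qed


definition edge_at :: "('v::{finite,linorder} \<times> 'v) set \<Rightarrow> 'm::{finite,linorder} \<Rightarrow> 'v \<times> 'v" where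
  "edge_at G a = lex_list G ! card {..<a}"

lemma bij_betw_edge_at:
  fixes G :: "('v::{finite,linorder} \<times> 'v) set"
  assumes "card G = CARD('m::{finite,linorder})"
  shows "bij_betw (edge_at G) (UNIV :: 'm set) G"
proof -
  have card: "card {..<a} < card G" for a :: 'm
    unfolding assms by (rule psubset_card_mono) auto
  have mono: "card {..<a} < card {..<b}" if "a < b" for a b :: 'm
    using that by (intro psubset_card_mono) auto
  have inj: "inj (edge_at G :: 'm \<Rightarrow> _)"
  proof (rule injI)
    fix a b :: 'm assume "edge_at G a = edge_at G b"
    then have "card {..<a} = card {..<b}"
      using card by (simp add: edge_at_def nth_eq_iff_index_eq[OF distinct_lex_list] length_lex_list)
    then show "a = b" using mono[of a b] mono[of b a] by (cases a b rule: linorder_cases) auto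
  qed
  have "range (edge_at G :: 'm \<Rightarrow> _) \<subseteq> G"
  proof
    fix f assume "f \<in> range (edge_at G :: 'm \<Rightarrow> _)"
    then obtain a :: 'm where "f = edge_at G a" by blast
    then show "f \<in> G" using nth_mem[of "card {..<a}" "lex_list G"] card[of a] by
      (simp add: edge_at_def length_lex_list)
  qed
  then have "range (edge_at G :: 'm \<Rightarrow> _) = G"
    using inj assms by (intro card_subset_eq) (auto simp: card_image)
  then show ?thesis using inj by (simp add: bij_betw_def)
qed

text \<open>A kernel vector \<open>y\<close> of this Gram matrix gives a combination
  \<open>z\<close> of the rows that is orthogonal to every row, so \<open>z \<bullet> z = 0\<close>,
  and independence forces \<open>y = 0\<close>.\<close>

lemma det_gram_nonzero:
  fixes e :: "'m::finite \<Rightarrow> 'v::finite \<times> 'v" and x :: "('d::finite, 'v) tuple"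
  assumes ind: "indep_edges_at G x" and e: "bij_betw e UNIV G"
  shows "det (\<chi> a b. DF_row (e a) x \<bullet> DF_row (e b) x) \<noteq> 0" (is "det ?M \<noteq> 0")
proof -
  have "y = 0" if "?M *v y = 0" for y
  proof -
    define z where "z = (\<Sum>b\<in>UNIV. y $ b *\<^sub>R DF_row (e b) x)"
    have row: "DF_row (e a) x \<bullet> z = 0" for a
    proof -
      have "DF_row (e a) x \<bullet> z = (?M *v y) $ a"
        by (simp add: z_def inner_sum_right matrix_vector_mult_def mult.commute)
      then show ?thesis using that by simp
    qed
    have "z \<bullet> z = (\<Sum>b\<in>UNIV. y $ b * (DF_row (e b) x \<bullet> z))"
      by (subst (1) z_def) (simp add: inner_sum_left)
    then have "z = 0" by (simp add: row)
    define c where "c f = y $ (inv_into UNIV e f)" for f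
    have c: "c (e b) = y $ b" for b
      using e by (simp add: c_def bij_betw_def inv_into_f_f)
    have "(\<Sum>f\<in>G. c f *\<^sub>R DF_row f x) = (\<Sum>b\<in>UNIV. c (e b) *\<^sub>R DF_row (e b) x)"
      by (rule sum.reindex_bij_betw[OF e, symmetric])
    also have "\<dots> = 0" using \<open>z = 0\<close> by (simp add: c z_def)
    finally have "\<forall>f\<in>G. c f = 0" using ind by (simp add: indep_edges_at_def)
    then have "y $ b = 0" for b using e c[of b] by (auto simp: bij_betw_def)
    then show "y = 0" by (simp add: Finite_Cartesian_Product.vec_eq_iff)
  qed
  then have "\<exists>B. B ** ?M = mat 1" unfolding matrix_left_invertible_ker by blast
  then show ?thesis unfolding invertible_left_inverse[symmetric] invertible_det_nz .
qed

lemma has_derivative_squared_distances: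
  fixes e :: "'m::finite \<Rightarrow> 'v::finite \<times> 'v" and x :: "('d::finite, 'v) tuple"
  assumes L: "bounded_linear L" "\<And>h. L h = (\<Sum>b\<in>UNIV. h $ b *\<^sub>R r b)"
  shows "((\<lambda>y. \<chi> a. (edge_dist (e a) (z + L y))\<^sup>2) has_derivative
           (\<lambda>h. (\<chi> a b. DF_row (e a) (z + L y) \<bullet> r b) *v h)) (at y)"
proof -
  have dL: "((\<lambda>y. z + L y) has_derivative L) (at y)"
    using has_derivative_add[OF has_derivative_const[of z] bounded_linear.has_derivative[OF L(1) has_derivative_ident]]
    by simp
  have comp: "((\<lambda>y. (edge_dist (e a) (z + L y))\<^sup>2) has_derivative (\<lambda>h. DF_row (e a) (z + L y) \<bullet> L h))
    (at y)" for a
    unfolding inner_DF_row using has_derivative_compose[OF dL has_derivative_edge_dist_square] by simp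
  have eq: "(\<lambda>h. (\<chi> a b. DF_row (e a) (z + L y) \<bullet> r b) *v h) = (\<lambda>h. \<chi> a. DF_row (e a) (z + L y) \<bullet> L h)"
    by (auto simp: fun_eq_iff Finite_Cartesian_Product.vec_eq_iff matrix_vector_mult_def L(2) inner_sum_right mult.commute)
  show ?thesis
    unfolding eq
  proof (subst has_derivative_componentwise_within, intro ballI)
    fix i :: "real^'m" assume "i \<in> Basis"
    then obtain a where "i = axis a 1" by (auto simp: Basis_vec_def)
    then show "((\<lambda>y. (\<chi> a. (edge_dist (e a) (z + L y))\<^sup>2) \<bullet> i) has_derivative (\<lambda>h. (\<chi> a. DF_row (e a) (z
      + L y) \<bullet> L h) \<bullet> i)) (at y)"
      using comp[of a] by (simp add: inner_axis)
  qed
qed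

text \<open>On the slices \<open>z + span (rows of DF at x0)\<close> the squared distance map is a local diffeomorphism between
  spaces of equal dimension, wherever its Jacobian determinant does not vanish.\<close>

lemma negligible_squared_distances_preimage:
  fixes e :: "'m::finite \<Rightarrow> 'v::finite \<times> 'v" and x0 :: "('d::finite, 'v) tuple"
  assumes ind: "indep_edges_at G x0" and e: "bij_betw e UNIV G"
    and S: "negligible S" "S \<in> sets borel"
  shows "negligible {x :: ('d, 'v) tuple. (\<chi> a. (edge_dist (e a) x)\<^sup>2) \<in> S}"
proof -
  define r where "r b = DF_row (e b) x0" for b
  define M where "M x = (\<chi> a b. DF_row (e a) x \<bullet> r b)" for x :: "('d, 'v) tuple"
  define L where "L y = (\<Sum>b\<in>UNIV. y $ b *\<^sub>R r b)" for y :: "real^'m"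
  define F where "F x = (\<chi> a. (edge_dist (e a) x)\<^sup>2)" for x :: "('d, 'v) tuple"
  have linM: "linear M"
    by (rule linearI) (simp_all add: M_def Finite_Cartesian_Product.vec_eq_iff DF_row_add DF_row_scaleR inner_add_left)
  have contM: "continuous_on UNIV M" using linM linear_continuous_on linear_linear by blast
  have contD: "continuous_on UNIV (\<lambda>x. det (M x))"
    unfolding Determinants.det_def by (intro continuous_intros continuous_on_component contM)
  have linL: "linear L"
    by (rule linearI) (simp_all add: L_def scaleR_add_left sum.distrib scaleR_sum_right)
  have bL: "bounded_linear L" using linL by (simp add: linear_linear)
  have [measurable]: "L \<in> borel_measurable borel"
    by (intro borel_measurable_continuous_onI linear_continuous_on bL)
  have contF: "continuous_on UNIV F"
    unfolding F_def edge_dist_square by (intro continuous_on_vec_lambda continuous_intros)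
  have [measurable]: "F \<in> borel_measurable borel" by (intro borel_measurable_continuous_onI contF)
  have [measurable]: "(\<lambda>x. det (M x)) \<in> borel_measurable borel" by (intro borel_measurable_continuous_onI contD)
  have [measurable]: "S \<in> sets borel" by fact
  \<comment> \<open>\<open>M x0\<close> is the Gram matrix of the independent rows at
    \<open>x0\<close>, so the determinant does not vanish identically.\<close>
  have null1: "negligible {x. det (M x) = 0}"
    using det_gram_nonzero[OF ind e] by (intro negligible_zeros_of_det_affine[OF linM, of x0])
      (simp add: M_def r_def)
  define W where "W = {x. F x \<in> S \<and> det (M x) \<noteq> 0}"
  have W[measurable]: "W \<in> sets borel" unfolding W_def by measurable
  have null_slice: "negligible {y. z + L y \<in> W}" for z
  proof -
    have der: "((\<lambda>y. F (z + L y)) has_derivative (\<lambda>h. M (z + L y) *v h)) (at y)" for y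
      unfolding F_def M_def by (rule has_derivative_squared_distances[OF bL]) (simp add: L_def)
    have "continuous_on UNIV (\<lambda>y. M (z + L y))"
      by (rule continuous_on_compose2[OF contM continuous_on_add[OF continuous_on_const linear_continuous_on[OF bL]]]) auto
    from negligible_preimage_regular[OF der this S(1)] show ?thesis by (simp add: W_def)
  qed
  let ?B = "cball (0 :: real^'m) 1"
  have [measurable]: "?B \<in> sets borel" by simp
  \<comment> \<open>Translating \<open>W\<close> by \<open>L y\<close> does not change its measure.
    Averaging over \<open>y\<close> in a ball and exchanging integrals reduces the claim to the null
    slices, without a change of coordinates adapted to the span of the rows.\<close>
  have "emeasure lborel ?B * emeasure lborel W = (\<integral>\<^sup>+y. indicator ?B y * (\<integral>\<^sup>+z. indicator W (z + L y)
    \<partial>lborel) \<partial>lborel)"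
    by (subst nn_integral_lborel_translate[where f="indicator W"]) (simp_all add: nn_integral_multc)
  also have "\<dots> = (\<integral>\<^sup>+y. (\<integral>\<^sup>+z. indicator ?B y * indicator W (z + L y) \<partial>lborel) \<partial>lborel)"
    by (intro nn_integral_cong nn_integral_cmult[symmetric]) measurable
  also have "\<dots> = (\<integral>\<^sup>+z. (\<integral>\<^sup>+y. indicator ?B y * indicator W (z + L y) \<partial>lborel) \<partial>lborel)"
    by (rule lborel_pair.Fubini') measurable
  also have "\<dots> = (\<integral>\<^sup>+z. 0 \<partial>(lborel :: ('d, 'v) tuple measure))"
  proof (intro nn_integral_cong)
    fix z :: "('d, 'v) tuple"
    have meas: "{y. z + L y \<in> W} \<in> sets borel" by measurable
    have "(\<integral>\<^sup>+y. indicator ?B y * indicator W (z + L y) \<partial>lborel) \<le> (\<integral>\<^sup>+y. indicator {y. z + L y \<in> W} y \<partial>lborel)"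
      by (intro nn_integral_mono) (auto split: split_indicator)
    also have "\<dots> = emeasure lborel {y. z + L y \<in> W}" using meas by (intro nn_integral_indicator) simp
    also have "\<dots> = 0" using null_slice[of z] meas by (simp add: negligible_iff_emeasure0)
    finally show "(\<integral>\<^sup>+y. indicator ?B y * indicator W (z + L y) \<partial>lborel) = 0" by simp
  qed
  finally have "emeasure lborel ?B * emeasure lborel W = 0" by simp
  moreover have "measure lborel ?B > 0" by (simp add: content_cball_pos)
  then have "emeasure lborel ?B \<noteq> 0" by (metis measure_def enn2real_0 less_irrefl)
  ultimately have "emeasure lborel W = 0" by simp
  then have "negligible W" using W by (simp add: negligible_iff_emeasure0)
  from negligible_Un[OF this null1] show ?thesis
    by (rule negligible_subset) (auto simp: W_def F_def)
qed

lemma compact_tuples: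
  fixes E :: "'a::euclidean_space set"
  assumes "compact E"
  shows "compact {x :: 'a^'v. \<forall>i. x $ i \<in> E}" (is "compact ?X")
proof -
  have "closed (\<Inter>i. (\<lambda>x :: 'a^'v. x $ i) -` E)"
    using compact_imp_closed[OF assms]
    by (intro closed_INT ballI continuous_closed_vimage) (auto intro: continuous_intros)
  moreover have "(\<Inter>i. (\<lambda>x :: 'a^'v. x $ i) -` E) = ?X" by auto
  ultimately have "closed ?X" by simp
  moreover obtain b where b: "\<And>y. y \<in> E \<Longrightarrow> norm y \<le> b"
    using compact_imp_bounded[OF assms] by (auto simp: bounded_iff)
  have "norm x \<le> real CARD('v) * b" if "x \<in> ?X" for x
  proof -
    have "norm x \<le> (\<Sum>i\<in>UNIV. norm (x $ i))" unfolding norm_vec_def by (rule L2_set_le_sum) simp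
    also have "\<dots> \<le> (\<Sum>i\<in>(UNIV :: 'v set). b)" using that b by (intro sum_mono) auto
    finally show ?thesis by simp
  qed
  then have "bounded ?X" by (intro boundedI) blast
  ultimately show ?thesis by (simp add: compact_eq_bounded_closed)
qed

lemma edge_dist_congruent:
  assumes "\<And>i. y $ i = reflect w (x $ i) + z"
  shows "edge_dist e y = edge_dist e x"
  by (simp add: edge_dist_def assms flip: reflect_diff)

theorem theorem2p18:
  fixes k :: nat
    and G :: "('v::{finite,linorder} \<times> 'v) set"
    and E :: "(real^('d::{finite,linorder})) set"
  assumes "CARD('d) \<ge> 2"
    and "k > CARD('d)"
    and "CARD('v) = k + 1"
    and "G \<subseteq> complete_edges"
    and "card G = CARD('m)"
    and "graph_connected G"
    and "min_inf_rigid TYPE(('d, 'v) tuple) G"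
    and "compact E"
    and "hausdorff_dim E > ereal (real CARD('d) - 1 / (real k + 1))"
  shows "emeasure lebesgue
           (dist_set G {x :: ('d, 'v) tuple. \<forall>i. x $ i \<in> E} :: (real^'m::{finite,linorder}) set) > 0"
proof (rule ccontr)
  let ?X = "{x :: ('d, 'v) tuple. \<forall>i. x $ i \<in> E}"
  let ?D = "dist_set G ?X :: ((real, 'm) Finite_Cartesian_Product.vec) set"
  assume "\<not> 0 < emeasure lebesgue ?D"
  then have zero: "emeasure lebesgue ?D = 0" by (simp add: zero_less_iff_neq_zero)
  define e :: "'m \<Rightarrow> 'v \<times> 'v" where "e = edge_at G"
  have e: "bij_betw e UNIV G" unfolding e_def by (rule bij_betw_edge_at[OF assms(5)])
  obtain x0 :: "('d, 'v) tuple" where x0: "indep_edges_at G x0"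
    using min_inf_rigid_imp_indep_edges[OF assms(4,7)] by (auto simp: indep_edges_def)
  have dist: "dist_map G x = (\<chi> a. edge_dist (e a) x)" for x :: "('d, 'v) tuple"
    by (simp add: dist_map_def e_def edge_at_def)
  have "continuous_on UNIV (\<lambda>x :: ('d, 'v) tuple. \<chi> a. edge_dist (e a) x)"
    unfolding edge_dist_def by (intro continuous_on_vec_lambda continuous_intros)
  \<comment> \<open>Compactness provides measurability; for a nonmeasurable set
    \<open>emeasure\<close> is 0 by convention, and its vanishing would say nothing.\<close>
  then have compD: "compact ?D"
    unfolding dist_set_def dist by
      (rule compact_continuous_image[OF continuous_on_subset compact_tuples[OF assms(8)]]) auto
  \<comment> \<open>Squaring is differentiable everywhere, also at coordinates equal to 0, and so it
    maps the null distance set to a null set of squared distances, where the rigidity matrix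
    applies.\<close>
  define sq :: "(real, 'm) Finite_Cartesian_Product.vec \<Rightarrow>
    (real, 'm) Finite_Cartesian_Product.vec" where "sq t = (\<chi> a. (t $ a)\<^sup>2)" for t
  have "negligible ?D"
    using zero compD by (simp add: negligible_iff_emeasure0 lmeasurable_compact fmeasurableD)
  moreover have "sq differentiable_on ?D"
    unfolding differentiable_on_def
  proof
    fix t
    have "((\<lambda>t. (t $ a)\<^sup>2) has_derivative (\<lambda>h. 2 * (t $ a) * (h $ a))) (at t within ?D)" for a
      by (rule derivative_eq_intros bounded_linear.has_derivative[OF bounded_linear_vec_nth has_derivative_ident] refl | simp)+
         (simp add: fun_eq_iff mult_ac)
    then have "(sq has_derivative (\<lambda>h. \<chi> a. 2 * (t $ a) * (h $ a))) (at t within ?D)"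
      unfolding sq_def
      by (subst has_derivative_componentwise_within) (auto simp: Basis_vec_def inner_axis)
    then show "sq differentiable at t within ?D" by (rule differentiableI)
  qed
  ultimately have "negligible (sq ` ?D)" by (intro negligible_differentiable_image_negligible) auto
  moreover have "compact (sq ` ?D)"
    unfolding sq_def by (intro compact_continuous_image compD continuous_on_vec_lambda continuous_intros)
  then have "sq ` ?D \<in> sets borel" by (rule borel_compact)
  ultimately have null: "negligible {x :: ('d, 'v) tuple. (\<chi> a. (edge_dist (e a) x)\<^sup>2) \<in> sq ` ?D}"
    by (rule negligible_squared_distances_preimage[OF x0 e])
  define d where "d = real CARD('d)"
  have "ereal (d - 1 / (real k + 1)) < min (ereal d) (hausdorff_dim E)"
    using assms(9) by (simp add: d_def)
  \<comment> \<open>A dimension above the threshold but strictly below both \<open>d\<close> and the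
    dimension of \<open>E\<close>; it is positive because the threshold is at least
    \<open>d - 1\<close>.\<close>
  from ereal_dense2[OF this] obtain s where s: "d - 1 / (real k + 1) < s" "s < d" "ereal s < hausdorff_dim E"
    by auto
  have "1 / (real k + 1) \<le> 1" by simp
  moreover have "2 \<le> d" using assms(1) by (simp add: d_def)
  ultimately have s0: "0 < s" using s(1) by linarith
  have "real CARD('v) * (DIM((real, 'd) Finite_Cartesian_Product.vec) - s) < 1"
    using s(1) assms(3) by (simp add: d_def field_simps)
  moreover have "CARD('v) \<ge> 2" using assms(1-3) by simp
  ultimately obtain Y :: "('d, 'v) tuple set" where Y: "Y \<in> sets borel" "0 < emeasure lborel Y"
    "\<And>x. x \<in> Y \<Longrightarrow> \<exists>w z. \<forall>i. reflect w (x $ i) + z \<in> E"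
    using congruent_tuples_measure_pos[of E s, where 'v='v] assms(1,8) s s0 by (auto simp: d_def)
  have "Y \<subseteq> {x :: ('d, 'v) tuple. (\<chi> a. (edge_dist (e a) x)\<^sup>2) \<in> sq ` ?D}"
  proof
    fix x assume "x \<in> Y"
    from Y(3)[OF this] obtain w z where wz: "\<And>i. reflect w (x $ i) + z \<in> E" by blast
    define y :: "('d, 'v) tuple" where "y = (\<chi> i. reflect w (x $ i) + z)"
    have "edge_dist f y = edge_dist f x" for f by (rule edge_dist_congruent) (simp add: y_def)
    then have "(\<chi> a. (edge_dist (e a) x)\<^sup>2) = sq (dist_map G y)" by (simp add: sq_def dist)
    moreover have "y \<in> ?X" using wz by (simp add: y_def)
    ultimately show "x \<in> {x. (\<chi> a. (edge_dist (e a) x)\<^sup>2) \<in> sq ` ?D}" by (auto simp: dist_set_def)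
  qed
  with null have "negligible Y" by (rule negligible_subset)
  then have "emeasure lborel Y = 0" using Y(1) by (simp add: negligible_iff_emeasure0)
  then show False using Y(2) by simp
qed

end
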